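(* Let $S$ be the set of all $h \in \mathcal H(\{0,1\}^{\mathbb N})$ with the following property: for every $m \in \mathbb N$, there are a partition $\mathcal P$ of $\{0,1\}^{\mathbb N}$ of mesh $< 1/m$ and a multiple $q \in \mathbb N$ of $m$ such that every component of $\operatorname{Gr}(h,\mathcal P)$ is a balanced dumbbell with plate weight $q!$ that contains both a left and a right loop of $h$. Then $S$ is a comeager conjugacy class of the group $\mathcal H(\{0,1\}^{\mathbb N})$.
   Context: $\mathbb N$ is the set of positive integers. $\{0,1\}^{\mathbb N}$ has the product topology and the metric $d(\sigma,\tau)=1/n$, where $n$ is the least positive integer with $\sigma(n)\neq\tau(n)$, and $d(\sigma,\sigma)=0$. $\mathcal H(\{0,1\}^{\mathbb N})$ is the group of all homeomorphisms of $\{0,1\}^{\mathbb N}$ onto itself, with the topology given by the metric $\tilde d(f,g)=\max_{\sigma} d(f(\sigma),g(\sigma))$. A partition of $\{0,1\}^{\mathbb N}$ is a finite collection of nonempty pairwise disjoint clopen sets whose union is $\{0,1\}^{\mathbb N}$. Its mesh is the maximum of the diameters of its members. A digraph consists of a finite set of vertices and a set of directed edges between vertices (an edge from a vertex to itself is allowed). For a partition $\mathcal P$, $\operatorname{Gr}(h,\mathcal P)$ is the digraph with vertex set $\mathcal P$ in which $\overrightarrow{ab}$ is an edge if and only if $h(a)\cap b\neq\emptyset$. A component of a digraph is a largest (in vertices and edges) subgraph in which any two vertices are joined by a sequence of vertices such that consecutive ones are joined by an edge in at least one of the two directions. A dumbbell of type $(r,s,t)$ ($r,s,t\ge 1$)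 is a digraph whose vertex set is the union of three disjoint sets $\{u_1,\dots,u_r\}$, $\{v_1,\dots,v_s\}$, $\{w_1,\dots,w_t\}$ (of $r$, $s$, $t$ distinct vertices, respectively), and whose edges are exactly: $\overrightarrow{u_iu_{i+1}}$ ($1\le i<r$) and $\overrightarrow{u_ru_1}$; $\overrightarrow{w_iw_{i+1}}$ ($1\le i<t$) and $\overrightarrow{w_tw_1}$; $\overrightarrow{v_iv_{i+1}}$ ($1\le i<s$); and $\overrightarrow{u_1v_1}$, $\overrightarrow{v_sw_1}$. It is balanced with plate weight $r$ if $r=t$. If a component $D$ of $\operatorname{Gr}(h,\mathcal P)$ is a dumbbell of type $(r,s,t)$ with vertices labeled $u_1,\dots,u_r,v_1,\dots,v_s,w_1,\dots,w_t$ so that its edges are exactly $\overrightarrow{u_iu_{i+1}}$ ($1\le i<r$), $\overrightarrow{u_ru_1}$, $\overrightarrow{w_iw_{i+1}}$ ($1\le i<t$), $\overrightarrow{w_tw_1}$, $\overrightarrow{v_iv_{i+1}}$ ($1\le i<s$), $\overrightarrow{u_1v_1}$ and $\overrightarrow{v_sw_1}$, then $D$ contains a left loop of $h$ (resp. a right loop of $h$) if there is a nonempty clopen subset $a$ of $u_1$ (resp. of $w_1$) such that $h^r(a)=a$ (resp. $h^t(a)=a$). *)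

theory Defs
  imports
    "HOL-Analysis.Analysis"
    "HOL-Algebra.Group"
    "HOL-Library.Disjoint_Sets"
    "Graph_Theory.Graph_Theory"
begin

section \<open>The Cantor space\<close>

text \<open>
  Points are functions on the type of natural numbers (which starts at 0) with the
  product topology supplied by the type class instance for functions.  The \<open>n\<close>-th coordinate,
  \<open>n \<ge> 1\<close>, of a sequence \<open>\<sigma>\<close> indexed by the positive integers is \<open>\<sigma> (n - 1)\<close> here, whence the
  \<open>Suc\<close> in the metric.
\<close>

type_synonym cantor = "nat \<Rightarrow> bool"

definition cdist :: "cantor \<Rightarrow> cantor \<Rightarrow> real" where
  "cdist \<sigma> \<tau> = (if \<sigma> = \<tau> then 0 else 1 / real (Suc (LEAST n. \<sigma> n \<noteq> \<tau> n)))"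

definition cdiameter :: "cantor set \<Rightarrow> real" where
  "cdiameter a = Sup {cdist \<sigma> \<tau> | \<sigma> \<tau>. \<sigma> \<in> a \<and> \<tau> \<in> a}"

definition clopen :: "cantor set \<Rightarrow> bool" where
  "clopen a \<longleftrightarrow> open a \<and> closed a"

definition clopen_partition :: "cantor set set \<Rightarrow> bool" where
  "clopen_partition P \<longleftrightarrow> finite P \<and> partition_on UNIV P \<and> (\<forall>a\<in>P. clopen a)"

definition mesh :: "cantor set set \<Rightarrow> real" where
  "mesh P = Max (cdiameter ` P)"

lemma cdist_less_iff:
  "cdist \<sigma> \<tau> < 1 / real (Suc k) \<longleftrightarrow> (\<forall>i\<le>k. \<sigma> i = \<tau> i)"
proof (cases "\<sigma> = \<tau>")
  case False
  then obtain j where j: "\<sigma> j \<noteq> \<tau> j" by blast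
  define L where "L = (LEAST n. \<sigma> n \<noteq> \<tau> n)"
  have L: "\<sigma> L \<noteq> \<tau> L" unfolding L_def using j by (rule LeastI)
  have lt: "\<sigma> i = \<tau> i" if "i < L" for i using that not_less_Least unfolding L_def by blast
  have "cdist \<sigma> \<tau> < 1 / real (Suc k) \<longleftrightarrow> k < L"
    using False unfolding cdist_def L_def [symmetric] by (simp add: divide_simps)
  also have "\<dots> \<longleftrightarrow> (\<forall>i\<le>k. \<sigma> i = \<tau> i)"
    using L lt by (meson le_less_trans not_le)
  finally show ?thesis .
qed (simp add: cdist_def)

lemma cdist_nonneg: "0 \<le> cdist \<sigma> \<tau>"
  and cdist_le_1: "cdist \<sigma> \<tau> \<le> 1"
  by (auto simp: cdist_def divide_simps)

lemma cdist_commute: "cdist \<sigma> \<tau> = cdist \<tau> \<sigma>"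
  by (auto simp: cdist_def eq_commute)

lemma cdist_eq_0_iff: "cdist \<sigma> \<tau> = 0 \<longleftrightarrow> \<sigma> = \<tau>"
  by (auto simp: cdist_def)

lemma cdist_ultra: "cdist \<sigma> \<upsilon> \<le> max (cdist \<sigma> \<tau>) (cdist \<tau> \<upsilon>)"
proof (cases "\<sigma> = \<upsilon>")
  case True
  then show ?thesis using cdist_nonneg [of \<sigma> \<tau>] by (simp add: cdist_def)
next
  case False
  define L where "L = (LEAST n. \<sigma> n \<noteq> \<upsilon> n)"
  have eq: "cdist \<sigma> \<upsilon> = 1 / real (Suc L)" using False by (simp add: cdist_def L_def)
  have "\<sigma> L \<noteq> \<upsilon> L" unfolding L_def
    using False LeastI_ex [of "\<lambda>n. \<sigma> n \<noteq> \<upsilon> n"] by blast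
  then have "\<not> (cdist \<sigma> \<tau> < 1 / real (Suc L) \<and> cdist \<tau> \<upsilon> < 1 / real (Suc L))"
    unfolding cdist_less_iff by auto
  then show ?thesis unfolding eq by linarith
qed

lemma cantor_metric: "Metric_space UNIV cdist"
proof
  show "cdist x z \<le> cdist x y + cdist y z" for x y z
    using cdist_ultra [of x z y] cdist_nonneg [of x y] cdist_nonneg [of y z] by linarith
qed (auto simp: cdist_nonneg cdist_eq_0_iff intro: cdist_commute)

lemma open_cantor_iff:
  fixes U :: "cantor set"
  shows "open U \<longleftrightarrow> (\<forall>x\<in>U. \<exists>r>0. \<forall>y. cdist x y < r \<longrightarrow> y \<in> U)"
proof
  assume U: "open U"
  show "\<forall>x\<in>U. \<exists>r>0. \<forall>y. cdist x y < r \<longrightarrow> y \<in> U"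
  proof
    fix x assume "x \<in> U"
    with U obtain X where X: "x \<in> Pi\<^sub>E UNIV X" "finite {i. X i \<noteq> UNIV}" "Pi\<^sub>E UNIV X \<subseteq> U"
      using product_topology_open_contains_basis [of "\<lambda>_. euclidean" UNIV U x]
      unfolding open_fun_def topspace_euclidean by blast
    obtain k where k: "\<And>i. X i \<noteq> UNIV \<Longrightarrow> i \<le> k"
      using X(2) finite_nat_set_iff_bounded_le by auto
    have "y \<in> U" if y: "cdist x y < 1 / real (Suc k)" for y
    proof -
      have "y i \<in> X i" for i
      proof (cases "X i = UNIV")
        case False
        then have "x i = y i" using y k unfolding cdist_less_iff by blast
        moreover have "x i \<in> X i" using X(1) by (simp add: PiE_iff)
        ultimately show ?thesis by simp
      qed simp
      then show ?thesis using X(3) by (auto simp: PiE_iff)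
    qed
    then show "\<exists>r>0. \<forall>y. cdist x y < r \<longrightarrow> y \<in> U" by (intro exI [of _ "1 / real (Suc k)"]) simp
  qed
next
  assume *: "\<forall>x\<in>U. \<exists>r>0. \<forall>y. cdist x y < r \<longrightarrow> y \<in> U"
  show "open U"
  proof (subst open_subopen, intro ballI)
    fix x assume "x \<in> U"
    with * obtain r where r: "r > 0" "\<And>y. cdist x y < r \<Longrightarrow> y \<in> U" by blast
    obtain k where k: "1 / real (Suc k) < r" using r(1) nat_approx_posE by blast
    have "open (Pi\<^sub>E UNIV (\<lambda>i. if i \<le> k then {x i} else UNIV))"
      by (rule open_PiE) (auto intro: finite_subset [of _ "{..k}"] split: if_splits simp: open_discrete)
    moreover have "x \<in> Pi\<^sub>E UNIV (\<lambda>i. if i \<le> k then {x i} else UNIV)" by (auto simp: PiE_iff)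
    moreover have "Pi\<^sub>E UNIV (\<lambda>i. if i \<le> k then {x i} else UNIV) \<subseteq> U"
    proof
      fix y assume "y \<in> Pi\<^sub>E UNIV (\<lambda>i. if i \<le> k then {x i} else UNIV)"
      then have "y i \<in> (if i \<le> k then {x i} else UNIV)" for i by (simp only: PiE_iff UNIV_I)
      then have "\<forall>i\<le>k. x i = y i" by (metis singletonD)
      then have "cdist x y < 1 / real (Suc k)" unfolding cdist_less_iff .
      then show "y \<in> U" using r k by (meson less_trans)
    qed
    ultimately show "\<exists>T. open T \<and> x \<in> T \<and> T \<subseteq> U" by blast
  qed
qed

lemma mtopology_cantor: "Metric_space.mtopology UNIV cdist = euclidean"
proof -
  interpret Metric_space UNIV cdist by (rule cantor_metric)
  show ?thesis
    unfolding topology_eq openin_mtopology by (auto simp: open_cantor_iff subset_iff)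
qed


section \<open>The homeomorphism group\<close>

definition homeos :: "(cantor \<Rightarrow> cantor) set" where
  "homeos = {h. \<exists>g. homeomorphism UNIV UNIV h g}"

definition homeo_group :: "(cantor \<Rightarrow> cantor) monoid" where
  "homeo_group = \<lparr>carrier = homeos, monoid.mult = (\<circ>), one = id\<rparr>"

definition homeo_dist :: "(cantor \<Rightarrow> cantor) \<Rightarrow> (cantor \<Rightarrow> cantor) \<Rightarrow> real" where
  "homeo_dist f g = (SUP \<sigma>. cdist (f \<sigma>) (g \<sigma>))"

definition homeo_topology :: "(cantor \<Rightarrow> cantor) topology" where
  "homeo_topology = Metric_space.mtopology homeos homeo_dist"

text \<open>The supremum in \<^const>\<open>homeo_dist\<close> is a maximum, for arbitrary maps: 0 is the only
  accumulation point of the values of the metric.\<close>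

lemma homeo_dist_attained: "\<exists>\<sigma>. homeo_dist f g = cdist (f \<sigma>) (g \<sigma>)"
proof (cases "f = g")
  case True
  then show ?thesis by (simp add: homeo_dist_def cdist_def)
next
  case False
  define A where "A = {n. \<exists>\<sigma>. f \<sigma> n \<noteq> g \<sigma> n}"
  define L where "L = (LEAST n. n \<in> A)"
  have "A \<noteq> {}" using False by (auto simp: A_def fun_eq_iff)
  then have "L \<in> A" unfolding L_def using LeastI_ex [of "\<lambda>n. n \<in> A"] by blast
  then obtain \<sigma> where \<sigma>: "f \<sigma> L \<noteq> g \<sigma> L" by (auto simp: A_def)
  have le: "cdist (f \<tau>) (g \<tau>) \<le> 1 / real (Suc L)" for \<tau>
  proof (cases "f \<tau> = g \<tau>")
    case False
    then have "f \<tau> (LEAST n. f \<tau> n \<noteq> g \<tau> n) \<noteq> g \<tau> (LEAST n. f \<tau> n \<noteq> g \<tau> n)"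
      using LeastI_ex [of "\<lambda>n. f \<tau> n \<noteq> g \<tau> n"] by blast
    then have "L \<le> (LEAST n. f \<tau> n \<noteq> g \<tau> n)"
      unfolding L_def by (intro Least_le) (auto simp: A_def)
    then show ?thesis using False by (simp add: cdist_def divide_simps)
  qed (simp add: cdist_def)
  moreover have ge: "1 / real (Suc L) \<le> cdist (f \<sigma>) (g \<sigma>)"
    using cdist_less_iff [of "f \<sigma>" "g \<sigma>" L] \<sigma> by force
  ultimately have le_ge: "cdist (f \<tau>) (g \<tau>) \<le> cdist (f \<sigma>) (g \<sigma>)" for \<tau>
    using order_trans by blast
  have "homeo_dist f g = cdist (f \<sigma>) (g \<sigma>)"
    unfolding homeo_dist_def
    using le_ge by (intro cSup_eq_maximum) auto
  then show ?thesis by blast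
qed

lemma cdist_le_homeo_dist: "cdist (f \<sigma>) (g \<sigma>) \<le> homeo_dist f g"
  unfolding homeo_dist_def by (rule cSUP_upper) (auto intro!: bdd_aboveI [of _ 1] simp: cdist_le_1)

lemma homeo_metric: "Metric_space homeos homeo_dist"
proof
  fix f g k :: "cantor \<Rightarrow> cantor"
  show "0 \<le> homeo_dist f g" using homeo_dist_attained [of f g] cdist_nonneg by metis
  show "homeo_dist f g = homeo_dist g f" by (simp add: homeo_dist_def cdist_commute)
  show "homeo_dist f g = 0 \<longleftrightarrow> f = g"
  proof
    assume "homeo_dist f g = 0"
    then have "cdist (f \<sigma>) (g \<sigma>) = 0" for \<sigma>
      using cdist_le_homeo_dist [of f \<sigma> g] cdist_nonneg [of "f \<sigma>" "g \<sigma>"] by linarith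
    then show "f = g" by (auto simp: cdist_eq_0_iff)
  qed (simp add: homeo_dist_def cdist_def)
  show "homeo_dist f k \<le> homeo_dist f g + homeo_dist g k"
  proof -
    interpret Metric_space UNIV cdist by (rule cantor_metric)
    obtain \<sigma> where "homeo_dist f k = cdist (f \<sigma>) (k \<sigma>)" using homeo_dist_attained by blast
    then show ?thesis
      using triangle [of "f \<sigma>" "g \<sigma>" "k \<sigma>"]
        cdist_le_homeo_dist [of f \<sigma> g] cdist_le_homeo_dist [of g \<sigma> k] by simp
  qed
qed

lemma homeo_group: "group homeo_group"
proof (rule groupI)
  fix f g assume "f \<in> carrier homeo_group" "g \<in> carrier homeo_group"
  then obtain f' g' where "homeomorphism UNIV UNIV f f'" "homeomorphism UNIV UNIV g g'"
    by (auto simp: homeo_group_def homeos_def)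
  then have "homeomorphism UNIV UNIV (f \<circ> g) (g' \<circ> f')" by (blast intro: homeomorphism_compose)
  then show "f \<otimes>\<^bsub>homeo_group\<^esub> g \<in> carrier homeo_group" by (auto simp: homeo_group_def homeos_def)
next
  have "homeomorphism UNIV UNIV id (id :: cantor \<Rightarrow> cantor)" by (simp add: homeomorphism_def)
  then show "\<one>\<^bsub>homeo_group\<^esub> \<in> carrier homeo_group" by (auto simp: homeo_group_def homeos_def)
next
  fix f assume "f \<in> carrier homeo_group"
  then obtain g where g: "homeomorphism UNIV UNIV f g" by (auto simp: homeo_group_def homeos_def)
  then have "homeomorphism UNIV UNIV g f" by (rule homeomorphism_symD)
  moreover from g have "g \<circ> f = id" by (simp add: homeomorphism_def fun_eq_iff)
  ultimately show "\<exists>g\<in>carrier homeo_group. g \<otimes>\<^bsub>homeo_group\<^esub> f = \<one>\<^bsub>homeo_group\<^esub>"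
    unfolding homeo_group_def homeos_def by auto
qed (simp_all add: homeo_group_def comp_assoc)

definition conjugacy_class :: "('a, 'b) monoid_scheme \<Rightarrow> 'a set \<Rightarrow> bool" where
  "conjugacy_class G C \<longleftrightarrow>
     (\<exists>x\<in>carrier G. C = {g \<otimes>\<^bsub>G\<^esub> x \<otimes>\<^bsub>G\<^esub> inv\<^bsub>G\<^esub> g | g. g \<in> carrier G})"


section \<open>Baire category\<close>

definition nowhere_dense_in :: "'a topology \<Rightarrow> 'a set \<Rightarrow> bool" where
  "nowhere_dense_in X A \<longleftrightarrow> A \<subseteq> topspace X \<and> X interior_of (X closure_of A) = {}"

definition meager_in :: "'a topology \<Rightarrow> 'a set \<Rightarrow> bool" where
  "meager_in X A \<longleftrightarrow> (\<exists>F. countable F \<and> (\<forall>N\<in>F. nowhere_dense_in X N) \<and> A = \<Union>F)"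

definition comeager_in :: "'a topology \<Rightarrow> 'a set \<Rightarrow> bool" where
  "comeager_in X A \<longleftrightarrow> A \<subseteq> topspace X \<and> meager_in X (topspace X - A)"


section \<open>Digraphs\<close>

definition Gr :: "(cantor \<Rightarrow> cantor) \<Rightarrow> cantor set set \<Rightarrow> cantor set pair_pre_digraph" where
  "Gr h P = \<lparr>pverts = P, parcs = {(a, b). a \<in> P \<and> b \<in> P \<and> h ` a \<inter> b \<noteq> {}}\<rparr>"

text \<open>
  \<^const>\<open>Digraph_Component.connected\<close> is weak connectedness, and
  \<^const>\<open>pre_digraph.max_subgraph\<close> is maximality with respect to both vertices and arcs.
\<close>

definition component :: "'a pair_pre_digraph \<Rightarrow> 'a pair_pre_digraph \<Rightarrow> bool" where
  "component D G \<longleftrightarrow>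
     pre_digraph.max_subgraph (with_proj G) Digraph_Component.connected (with_proj D)"

text \<open>The labels of a dumbbell are \<open>u\<^sub>1,\<dots>,u\<^sub>r\<close>, \<open>v\<^sub>1,\<dots>,v\<^sub>s\<close>, \<open>w\<^sub>1,\<dots>,w\<^sub>t\<close>; other values of the
  functions \<open>u\<close>, \<open>v\<close>, \<open>w\<close> are irrelevant.\<close>

definition dumbbell_labelling ::
  "'a pair_pre_digraph \<Rightarrow> nat \<Rightarrow> nat \<Rightarrow> nat \<Rightarrow> (nat \<Rightarrow> 'a) \<Rightarrow> (nat \<Rightarrow> 'a) \<Rightarrow> (nat \<Rightarrow> 'a) \<Rightarrow> bool"
where
  "dumbbell_labelling D r s t u v w \<longleftrightarrow>
     1 \<le> r \<and> 1 \<le> s \<and> 1 \<le> t \<and>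
     inj_on u {1..r} \<and> inj_on v {1..s} \<and> inj_on w {1..t} \<and>
     u ` {1..r} \<inter> v ` {1..s} = {} \<and> u ` {1..r} \<inter> w ` {1..t} = {} \<and> v ` {1..s} \<inter> w ` {1..t} = {} \<and>
     pverts D = u ` {1..r} \<union> v ` {1..s} \<union> w ` {1..t} \<and>
     parcs D =
       {(u i, u (i + 1)) | i. 1 \<le> i \<and> i < r} \<union> {(u r, u 1)} \<union>
       {(w i, w (i + 1)) | i. 1 \<le> i \<and> i < t} \<union> {(w t, w 1)} \<union>
       {(v i, v (i + 1)) | i. 1 \<le> i \<and> i < s} \<union>
       {(u 1, v 1), (v s, w 1)}"

definition dumbbell :: "nat \<Rightarrow> nat \<Rightarrow> nat \<Rightarrow> 'a pair_pre_digraph \<Rightarrow> bool" where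
  "dumbbell r s t D \<longleftrightarrow> (\<exists>u v w. dumbbell_labelling D r s t u v w)"

definition balanced_dumbbell :: "nat \<Rightarrow> 'a pair_pre_digraph \<Rightarrow> bool" where
  "balanced_dumbbell k D \<longleftrightarrow> (\<exists>r s t. dumbbell r s t D \<and> r = t \<and> r = k)"

definition contains_left_loop ::
  "(cantor \<Rightarrow> cantor) \<Rightarrow> cantor set pair_pre_digraph \<Rightarrow> bool" where
  "contains_left_loop h D \<longleftrightarrow>
     (\<exists>r s t u v w. dumbbell_labelling D r s t u v w \<and>
        (\<exists>a. a \<noteq> {} \<and> clopen a \<and> a \<subseteq> u 1 \<and> (h ^^ r) ` a = a))"

definition contains_right_loop ::
  "(cantor \<Rightarrow> cantor) \<Rightarrow> cantor set pair_pre_digraph \<Rightarrow> bool" where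
  "contains_right_loop h D \<longleftrightarrow>
     (\<exists>r s t u v w. dumbbell_labelling D r s t u v w \<and>
        (\<exists>a. a \<noteq> {} \<and> clopen a \<and> a \<subseteq> w 1 \<and> (h ^^ t) ` a = a))"

end

theory Submission
  imports Defs
begin

text \<open>
  For each \<open>m\<close> call a homeomorphism \<open>h\<close> looped at scale \<open>m\<close> if it has a partition as in the definition of
  \<open>S\<close> for this \<open>m\<close>; thus \<open>S\<close> consists of the homeomorphisms that are looped at all scales.

  \<^emph>\<open>\<open>S\<close> is comeager.\<close>  Being looped at scale \<open>m\<close> is decided by the images under \<open>h\<close> of finitely many clopen
  sets, and so it is an open condition (\<open>looped_at_open\<close>).  It is also dense (\<open>looped_at_dense\<close>).  Cut the space
  into the sets \<open>a \<inter> h\<^sup>-\<^sup>1(b)\<close>, where \<open>a\<close> and \<open>b\<close> are small cylinders.  In the finite graph of these pieces each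
  vertex has a successor and a predecessor.  Iterating a choice of successors forwards and a choice of
  predecessors backwards leads from any vertex into cycles, whose lengths divide \<open>q!\<close> for suitable \<open>q\<close>; so each
  vertex lies on the image of a balanced dumbbell of plate weight \<open>q!\<close>.  Since all nonempty clopen sets are
  homeomorphic, a homeomorphism near \<open>h\<close> realises the disjoint union of these dumbbells
  (\<open>realize_graph\<close>), and loops can be planted in the plates at the same time.  By the Baire category argument
  \<open>open_dense_Inter_nonempty\<close>, \<open>S\<close> is not empty.

  \<^emph>\<open>\<open>S\<close> is a conjugacy class.\<close>  It is invariant under conjugation because homeomorphisms are uniformly
  continuous.  Two members \<open>h\<close> and \<open>g\<close> are conjugate by a back-and-forth argument.  It builds partitions
  \<open>R\<^sub>0, R\<^sub>1, R\<^sub>2, \<dots>\<close>, alternately for \<open>h\<close> and for \<open>g\<close>, and maps \<open>\<theta>\<^sub>n\<close> from \<open>R\<^sub>n\<^sub>+\<^sub>1\<close> to \<open>R\<^sub>n\<close> that take the edges of the one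
  graph onto the edges of the other and satisfy \<open>a \<subseteq> \<theta>\<^sub>n (\<theta>\<^sub>n\<^sub>+\<^sub>1 a)\<close>.  In the limit the maps with odd and those
  with even index define two mutually inverse homeomorphisms that intertwine \<open>h\<close> and \<open>g\<close> (\<open>limit_map\<close>).

  The heart of the matter is the next step of this construction (\<open>link_extend\<close>): given a graph map \<open>\<phi>\<close> from a
  partition \<open>Q\<close> for \<open>g\<close> onto a partition \<open>P\<close> for \<open>h\<close>, find a finer partition of \<open>h\<close> whose graph maps onto that of \<open>Q\<close>
  over \<open>P\<close>.  Each dumbbell of a fine partition projects into one plate of a dumbbell of \<open>P\<close>, or it crosses such a
  dumbbell from the left plate to the right one.  Three facts make it possible to lift these projections to \<open>Q\<close>
  so that every dumbbell of \<open>Q\<close> is covered.  Dumbbells of fine partitions that cross a given one stay in its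
  plates for a long time before and after the crossing (\<open>crossing_lines_long\<close>), and therefore can be mapped onto
  any crossing dumbbell of \<open>Q\<close>.  There are many of them, as each uses only one piece of a cell of the bar
  (\<open>many_crossing_lines\<close>).  And the loops provide arbitrarily long dumbbells inside the plates as well
  (\<open>many_long_lines_in_invariant_set\<close>).

  Throughout, a dumbbell is unrolled into a walk \<open>c\<close> over the integers that is periodic far to the left and far to
  the right.  Graph maps defined on a dumbbell then are walks with the same periodicity, and all shifts of phase
  become shifts of the integers.
\<close>

section \<open>Coordinates and clopen sets\<close>

text \<open>
  For \<open>k \<ge> 1\<close> this says that \<open>x\<close> and \<open>y\<close> have distance less than \<open>1/k\<close>; it replaces the metric from here on.
\<close>

definition agree :: "nat \<Rightarrow> cantor \<Rightarrow> cantor \<Rightarrow> bool" where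
  "agree k x y \<longleftrightarrow> (\<forall>i<k. x i = y i)"

text \<open>
  For \<open>k \<ge> 1\<close> this says that the mesh is less than \<open>1/k\<close>.
\<close>

definition resolves :: "nat \<Rightarrow> cantor set set \<Rightarrow> bool" where
  "resolves k P \<longleftrightarrow> (\<forall>a\<in>P. \<forall>x\<in>a. \<forall>y\<in>a. agree k x y)"

definition decides :: "nat \<Rightarrow> cantor set \<Rightarrow> bool" where
  "decides k a \<longleftrightarrow> (\<forall>x y. agree k x y \<longrightarrow> (x \<in> a \<longleftrightarrow> y \<in> a))"

lemma agree_refl [simp]: "agree k x x"
  and agree_sym: "agree k x y \<Longrightarrow> agree k y x"
  and agree_trans: "agree k x y \<Longrightarrow> agree k y z \<Longrightarrow> agree k x z"
  and agree_mono: "agree k x y \<Longrightarrow> l \<le> k \<Longrightarrow> agree l x y"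
  by (auto simp: agree_def)

lemma agree_all_imp_eq: "(\<And>k. agree k x y) \<Longrightarrow> x = y"
  by (auto simp: agree_def fun_eq_iff)

lemma cdist_less_iff_agree: "1 \<le> m \<Longrightarrow> cdist x y < 1 / real m \<longleftrightarrow> agree m x y"
  using cdist_less_iff [of x y "m - 1"] by (auto simp: agree_def Suc_le_eq less_Suc_eq_le)

lemma resolves_mono: "resolves k P \<Longrightarrow> l \<le> k \<Longrightarrow> resolves l P"
  unfolding resolves_def by (blast intro: agree_mono)

lemma decides_mono: "decides k a \<Longrightarrow> k \<le> l \<Longrightarrow> decides l a"
  unfolding decides_def by (blast intro: agree_mono)

lemma decides_cell:
  assumes "resolves k P" "decides k a" "b \<in> P" "b \<inter> a \<noteq> {}"
  shows "b \<subseteq> a"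
  using assms unfolding resolves_def decides_def by blast

text \<open>
  The metric takes no values strictly between \<open>1/(m + 1)\<close> and \<open>1/m\<close>; hence a supremum of values below \<open>1/m\<close>
  stays below \<open>1/m\<close>.
\<close>

lemma mesh_less_iff_resolves:
  assumes P: "clopen_partition P" and m: "1 \<le> m"
  shows "mesh P < 1 / real m \<longleftrightarrow> resolves m P"
proof -
  have fin: "finite P" and ne: "P \<noteq> {}" and cell: "\<And>a. a \<in> P \<Longrightarrow> a \<noteq> {}"
    using P by (auto simp: clopen_partition_def partition_on_def)
  have "cdiameter a < 1 / real m \<longleftrightarrow> (\<forall>x\<in>a. \<forall>y\<in>a. agree m x y)" if "a \<in> P" for a
  proof
    assume d: "cdiameter a < 1 / real m"
    show "\<forall>x\<in>a. \<forall>y\<in>a. agree m x y"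
    proof (intro ballI)
      fix x y assume "x \<in> a" "y \<in> a"
      then have "cdist x y \<le> cdiameter a"
        unfolding cdiameter_def by (intro cSup_upper) (auto intro!: bdd_aboveI [of _ 1] simp: cdist_le_1)
      with d show "agree m x y" using cdist_less_iff_agree [OF m, of x y] by simp
    qed
  next
    assume a: "\<forall>x\<in>a. \<forall>y\<in>a. agree m x y"
    have "cdist x y \<le> 1 / real (Suc m)" if "x \<in> a" "y \<in> a" for x y
    proof (cases "x = y")
      case False
      then obtain j where j: "x j \<noteq> y j" by auto
      then have "x (LEAST n. x n \<noteq> y n) \<noteq> y (LEAST n. x n \<noteq> y n)" by (rule LeastI)
      then have "m \<le> (LEAST n. x n \<noteq> y n)"
        using a that unfolding agree_def by (meson not_less)
      then show ?thesis using False by (simp add: cdist_def divide_simps)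
    qed (simp add: cdist_def)
    then have "cdiameter a \<le> 1 / real (Suc m)"
      unfolding cdiameter_def using cell [OF that] by (intro cSup_least) blast+
    also have "\<dots> < 1 / real m" using m by (simp add: divide_simps)
    finally show "cdiameter a < 1 / real m" .
  qed
  moreover have "mesh P < 1 / real m \<longleftrightarrow> (\<forall>a\<in>P. cdiameter a < 1 / real m)"
    unfolding mesh_def using fin ne by simp
  ultimately show ?thesis unfolding resolves_def by blast
qed

lemma clopen_simps [simp, intro]:
  "clopen {}" "clopen UNIV"
  "clopen a \<Longrightarrow> clopen b \<Longrightarrow> clopen (a \<inter> b)"
  "clopen a \<Longrightarrow> clopen b \<Longrightarrow> clopen (a \<union> b)"
  "clopen a \<Longrightarrow> clopen b \<Longrightarrow> clopen (a - b)"
  "clopen a \<Longrightarrow> clopen (- a)"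
  by (auto simp: clopen_def closed_def [symmetric] open_Diff closed_Diff)

lemma clopen_UN: "finite I \<Longrightarrow> (\<And>i. i \<in> I \<Longrightarrow> clopen (A i)) \<Longrightarrow> clopen (\<Union>i\<in>I. A i)"
  by (auto simp: clopen_def)

lemma clopen_vimage: "continuous_on UNIV f \<Longrightarrow> clopen a \<Longrightarrow> clopen (f -` a)"
  by (auto simp: clopen_def open_vimage closed_vimage)

lemma continuous_coordinate: "continuous_on UNIV (\<lambda>x :: cantor. x i)"
  by (rule continuous_on_product_coordinates)

lemma clopen_coordinate: "clopen {x. x i}"
proof -
  have eq: "{x :: cantor. x i} = (\<lambda>x. x i) -` {True}" by auto
  show ?thesis
    unfolding eq clopen_def
    by (intro conjI open_vimage closed_vimage continuous_coordinate) (auto simp: open_discrete)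
qed

lemma compact_cantor: "compact (UNIV :: cantor set)"
proof -
  have "compact (UNIV :: bool set)" by (simp add: finite_imp_compact)
  then have "compact_space (euclidean :: bool topology)"
    by (simp add: compact_space_def compactin_euclidean_iff)
  then have "compact_space (product_topology (\<lambda>_. euclidean :: bool topology) (UNIV :: nat set))"
    by (simp add: compact_space_product_topology)
  then show ?thesis
    by (simp add: euclidean_product_topology compact_space_def compactin_euclidean_iff)
qed

lemma decides_agree: "decides k {y. agree k x y}"
  by (simp add: decides_def) (meson agree_sym agree_trans)

lemma open_iff_agree: "open U \<longleftrightarrow> (\<forall>x\<in>U. \<exists>k. \<forall>y. agree k x y \<longrightarrow> y \<in> U)"
proof -
  have "(\<exists>r>0. \<forall>y. cdist x y < r \<longrightarrow> y \<in> U) \<longleftrightarrow> (\<exists>k. \<forall>y. agree k x y \<longrightarrow> y \<in> U)" for x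
  proof
    assume "\<exists>r>0. \<forall>y. cdist x y < r \<longrightarrow> y \<in> U"
    then obtain r where r: "r > 0" "\<And>y. cdist x y < r \<Longrightarrow> y \<in> U" by blast
    obtain k where k: "1 / real (Suc k) < r" using r(1) nat_approx_posE by blast
    have "y \<in> U" if "agree (Suc k) x y" for y
      using that cdist_less_iff_agree [of "Suc k" x y] k r(2) by fastforce
    then show "\<exists>k. \<forall>y. agree k x y \<longrightarrow> y \<in> U" by blast
  next
    assume "\<exists>k. \<forall>y. agree k x y \<longrightarrow> y \<in> U"
    then obtain k where k: "\<And>y. agree k x y \<Longrightarrow> y \<in> U" by blast
    have "y \<in> U" if "cdist x y < 1 / real (Suc k)" for y
      using that cdist_less_iff_agree [of "Suc k" x y] k agree_mono [of "Suc k" x y k] by simp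
    then show "\<exists>r>0. \<forall>y. cdist x y < r \<longrightarrow> y \<in> U" by (intro exI [of _ "1 / real (Suc k)"]) simp
  qed
  then show ?thesis unfolding open_cantor_iff by simp
qed

lemma clopen_if_decides: "decides k a \<Longrightarrow> clopen a"
  unfolding clopen_def closed_def open_iff_agree decides_def by blast

lemma clopen_agree: "clopen {y. agree k x y}"
  by (rule clopen_if_decides [OF decides_agree])

text \<open>
  By compactness, finitely many coordinates decide membership in a clopen set.
\<close>

lemma clopen_decides:
  assumes "clopen a"
  obtains k where "decides k a"
proof -
  have "\<exists>k. \<forall>y. agree k x y \<longrightarrow> (y \<in> a \<longleftrightarrow> x \<in> a)" for x
    using assms unfolding clopen_def closed_def open_iff_agree by (cases "x \<in> a") auto
  then obtain \<kappa> where \<kappa>: "\<And>x y. agree (\<kappa> x) x y \<Longrightarrow> y \<in> a \<longleftrightarrow> x \<in> a" by metis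
  have op: "open {y. agree (\<kappa> x) x y}" for x using clopen_agree unfolding clopen_def by blast
  have cover: "UNIV \<subseteq> (\<Union>x\<in>UNIV. {y. agree (\<kappa> x) x y})" by auto
  obtain F where F: "finite F" "UNIV \<subseteq> (\<Union>x\<in>F. {y. agree (\<kappa> x) x y})"
    by (rule compactE_image [OF compact_cantor op cover]) auto
  define k where "k = Max (\<kappa> ` F)"
  have "decides k a"
    unfolding decides_def
  proof (intro allI impI)
    fix y z assume yz: "agree k y z"
    obtain x where x: "x \<in> F" "agree (\<kappa> x) x y" using F(2) by blast
    have "\<kappa> x \<le> k" using x(1) F(1) by (simp add: k_def)
    then have "agree (\<kappa> x) x z" using x(2) yz agree_mono agree_trans by blast
    then show "y \<in> a \<longleftrightarrow> z \<in> a" using \<kappa> x(2) by blast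
  qed
  then show ?thesis by (rule that)
qed

lemma finite_clopen_decides:
  assumes "finite A" "\<And>a. a \<in> A \<Longrightarrow> clopen a"
  obtains k where "\<And>a. a \<in> A \<Longrightarrow> decides k a"
proof -
  have "\<exists>k. \<forall>a\<in>A. decides k a" using assms
  proof (induction A rule: finite_induct)
    case (insert b A)
    then obtain k where "\<forall>a\<in>A. decides k a" by blast
    moreover obtain l where "decides l b" using insert.prems clopen_decides by blast
    ultimately have "\<forall>a\<in>insert b A. decides (max k l) a" by (auto intro: decides_mono)
    then show ?case by blast
  qed simp
  then show ?thesis using that by blast
qed

lemma continuous_on_iff_agree:
  "continuous_on UNIV f \<longleftrightarrow> (\<forall>k. \<exists>l. \<forall>x y. agree l x y \<longrightarrow> agree k (f x) (f y))"
  for f :: "cantor \<Rightarrow> cantor"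
proof
  assume f: "continuous_on UNIV f"
  show "\<forall>k. \<exists>l. \<forall>x y. agree l x y \<longrightarrow> agree k (f x) (f y)"
  proof
    fix k
    have "clopen a" if a: "a \<in> (\<lambda>i. f -` {x. x i}) ` {..<k}" for a
      using a clopen_vimage [OF f clopen_coordinate] by auto
    then obtain l where "\<And>a. a \<in> (\<lambda>i. f -` {x. x i}) ` {..<k} \<Longrightarrow> decides l a"
      using finite_clopen_decides [of "(\<lambda>i. f -` {x. x i}) ` {..<k}"] by auto
    then show "\<exists>l. \<forall>x y. agree l x y \<longrightarrow> agree k (f x) (f y)"
      by (intro exI [of _ l]) (auto simp: decides_def agree_def)
  qed
next
  assume *: "\<forall>k. \<exists>l. \<forall>x y. agree l x y \<longrightarrow> agree k (f x) (f y)"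
  have "open (f -` U)" if "open U" for U
    unfolding open_iff_agree
  proof
    fix x assume "x \<in> f -` U"
    then obtain k where "\<And>y. agree k (f x) y \<Longrightarrow> y \<in> U"
      using \<open>open U\<close> unfolding open_iff_agree by blast
    then show "\<exists>k. \<forall>y. agree k x y \<longrightarrow> y \<in> f -` U" using * by (metis vimageI)
  qed
  then show "continuous_on UNIV f" by (simp add: continuous_on_open_vimage)
qed

section \<open>Homeomorphisms and partitions\<close>

text \<open>
  The inverse function gets a name of its own, because the notation \<open>inv\<close> stands for inverses in a group.
\<close>

abbreviation inverse_map :: "('a \<Rightarrow> 'b) \<Rightarrow> 'b \<Rightarrow> 'a" where
  "inverse_map h \<equiv> inv_into UNIV h"

lemma homeosI:
  assumes "continuous_on UNIV f" "continuous_on UNIV g" "\<And>x. g (f x) = x" "\<And>x. f (g x) = x"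
  shows "f \<in> homeos"
proof -
  have "surj f" "surj g" using assms(3,4) by (metis surjI)+
  then have "homeomorphism UNIV UNIV f g" using assms by (simp add: homeomorphism_def)
  then show ?thesis by (auto simp: homeos_def)
qed

lemma homeosE:
  assumes "h \<in> homeos"
  obtains g where "continuous_on UNIV g" "\<And>x. g (h x) = x" "\<And>x. h (g x) = x"
proof -
  obtain g where "homeomorphism UNIV UNIV h g" using assms by (auto simp: homeos_def)
  then show ?thesis using that [of g] by (simp add: homeomorphism_def)
qed

lemma homeos_bij: assumes "h \<in> homeos" shows "bij h"
proof -
  obtain g where "\<And>x. g (h x) = x" "\<And>x. h (g x) = x" using homeosE [OF assms] by metis
  then show ?thesis by (intro bij_betw_byWitness [where f' = g]) simp_all
qed

lemma homeos_continuous: "h \<in> homeos \<Longrightarrow> continuous_on UNIV h"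
  by (auto simp: homeos_def homeomorphism_def)

lemma homeos_inv: assumes "h \<in> homeos" shows "inverse_map h \<in> homeos"
proof -
  obtain g where g: "homeomorphism UNIV UNIV h g" using assms by (auto simp: homeos_def)
  then have "inverse_map h = g" by (auto simp: homeomorphism_def intro: inv_equality)
  then show ?thesis using homeomorphism_symD [OF g] by (auto simp: homeos_def)
qed

lemma homeos_comp: "f \<in> homeos \<Longrightarrow> g \<in> homeos \<Longrightarrow> f \<circ> g \<in> homeos"
  unfolding homeos_def by (blast intro: homeomorphism_compose)

lemma homeos_inv_simps:
  assumes "h \<in> homeos"
  shows "inverse_map h (h x) = x" "h (inverse_map h x) = x" "inverse_map (inverse_map h) = h"
  using homeos_bij [OF assms] by (auto simp: bij_def surj_f_inv_f inv_inv_eq)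

lemma clopen_image: assumes "h \<in> homeos" "clopen a" shows "clopen (h ` a)"
proof -
  have "h ` a = inverse_map h -` a" using homeos_bij [OF assms(1)] by (simp add: bij_vimage_eq_inv_image inv_inv_eq bij_imp_bij_inv)
  then show ?thesis using clopen_vimage homeos_continuous homeos_inv assms by metis
qed

lemma clopen_homeo_vimage: "h \<in> homeos \<Longrightarrow> clopen a \<Longrightarrow> clopen (h -` a)"
  by (simp add: clopen_vimage homeos_continuous)

lemma partition_cell:
  assumes "clopen_partition P"
  obtains a where "a \<in> P" "x \<in> a"
  using assms unfolding clopen_partition_def partition_on_def by blast

lemma partition_cell_eq:
  assumes "clopen_partition P" "a \<in> P" "b \<in> P" "x \<in> a" "x \<in> b"
  shows "a = b"
  using assms unfolding clopen_partition_def partition_on_def disjoint_def by blast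

lemma partition_nonempty: "clopen_partition P \<Longrightarrow> a \<in> P \<Longrightarrow> a \<noteq> {}"
  by (auto simp: clopen_partition_def partition_on_def)

lemma partition_clopen: "clopen_partition P \<Longrightarrow> a \<in> P \<Longrightarrow> clopen a"
  by (auto simp: clopen_partition_def)

lemma partition_finite: "clopen_partition P \<Longrightarrow> finite P"
  by (auto simp: clopen_partition_def)

lemma clopen_partitionI:
  assumes "finite P" "\<And>a. a \<in> P \<Longrightarrow> clopen a \<and> a \<noteq> {}" "\<And>x. \<exists>a\<in>P. x \<in> a"
    "\<And>a b x. a \<in> P \<Longrightarrow> b \<in> P \<Longrightarrow> x \<in> a \<Longrightarrow> x \<in> b \<Longrightarrow> a = b"
  shows "clopen_partition P"
  unfolding clopen_partition_def partition_on_def disjoint_def using assms by blast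

section \<open>Clopen sets are all alike\<close>

text \<open>
  The Cantor space has no isolated points.
\<close>

lemma clopen_halves:
  assumes "clopen a" "a \<noteq> {}"
  obtains b c where "clopen b" "clopen c" "b \<noteq> {}" "c \<noteq> {}" "b \<union> c = a" "b \<inter> c = {}"
proof -
  obtain k where k: "decides k a" using clopen_decides assms(1) by blast
  obtain x where x: "x \<in> a" using assms(2) by blast
  have "agree k x (x(k := v))" for v by (simp add: agree_def)
  then have "x(k := v) \<in> a" for v using x k unfolding decides_def by blast
  then have "x(k := True) \<in> a \<inter> {x. x k}" "x(k := False) \<in> a - {x. x k}" by simp_all
  then show ?thesis
    using that [of "a \<inter> {x. x k}" "a - {x. x k}"] assms(1) clopen_coordinate by blast
qed

lemma clopen_split:
  assumes "finite J" "J \<noteq> {}" "clopen a" "a \<noteq> {}"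
  shows "\<exists>U. (\<forall>j\<in>J. clopen (U j) \<and> U j \<noteq> {}) \<and> disjoint_family_on U J \<and> (\<Union>j\<in>J. U j) = a"
  using assms
proof (induction J arbitrary: a rule: finite_ne_induct)
  case (singleton j)
  then show ?case by (intro exI [of _ "\<lambda>_. a"]) (auto simp: disjoint_family_on_def)
next
  case (insert j J)
  obtain b c where bc: "clopen b" "clopen c" "b \<noteq> {}" "c \<noteq> {}" "b \<union> c = a" "b \<inter> c = {}"
    using clopen_halves insert.prems by metis
  obtain U where U: "\<forall>j\<in>J. clopen (U j) \<and> U j \<noteq> {}" "disjoint_family_on U J" "(\<Union>j\<in>J. U j) = b"
    using insert.IH [OF bc(1,3)] by blast
  show ?case
    using U bc insert.hyps by (intro exI [of _ "U(j := c)"]) (auto simp: disjoint_family_on_def)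
qed

lemma homeomorphic_disjoint_union:
  fixes a b c d :: "cantor set"
  assumes "a homeomorphic c" "b homeomorphic d" "clopen a" "clopen b" "clopen c" "clopen d"
    "a \<inter> b = {}" "c \<inter> d = {}"
  shows "(a \<union> b) homeomorphic (c \<union> d)"
proof -
  obtain f f' where f: "homeomorphism a c f f'" using assms(1) by (auto simp: homeomorphic_def)
  obtain g g' where g: "homeomorphism b d g g'" using assms(2) by (auto simp: homeomorphic_def)
  define k where "k = (\<lambda>x. if x \<in> a then f x else g x)"
  define k' where "k' = (\<lambda>x. if x \<in> c then f' x else g' x)"
  have ab: "x \<in> b \<Longrightarrow> x \<notin> a" and cd: "x \<in> d \<Longrightarrow> x \<notin> c" for x using assms(7,8) by auto
  have "continuous_on (a \<union> b) k"
    unfolding k_def using f g assms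
    by (intro continuous_on_cases) (auto simp: clopen_def homeomorphism_def)
  moreover have "continuous_on (c \<union> d) k'"
    unfolding k'_def using f g assms
    by (intro continuous_on_cases) (auto simp: clopen_def homeomorphism_def)
  moreover have "k ` a = f ` a" "k ` b = g ` b" "k' ` c = f' ` c" "k' ` d = g' ` d"
    using ab cd by (auto simp: k_def k'_def cong: image_cong_simp)
  moreover have "k' (k x) = x" if "x \<in> a \<union> b" for x
    using that f g ab cd unfolding k_def k'_def homeomorphism_def by auto
  moreover have "k (k' y) = y" if "y \<in> c \<union> d" for y
    using that f g ab cd unfolding k_def k'_def homeomorphism_def by auto
  ultimately have "homeomorphism (a \<union> b) (c \<union> d) k k'"
    using f g unfolding homeomorphism_def by (simp add: image_Un)
  then show ?thesis by (auto simp: homeomorphic_def)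
qed

definition prepend :: "bool \<Rightarrow> cantor \<Rightarrow> cantor" where
  "prepend b x = (\<lambda>i. case i of 0 \<Rightarrow> b | Suc j \<Rightarrow> x j)"

lemma homeomorphic_prepend: "a homeomorphic (prepend b ` a)"
proof -
  have "continuous_on UNIV (prepend b)"
    unfolding continuous_on_iff_agree
    by (rule allI, rule_tac x = k in exI) (auto simp: agree_def prepend_def split: nat.split)
  moreover have "continuous_on UNIV (\<lambda>x :: cantor. \<lambda>i. x (Suc i))"
    unfolding continuous_on_iff_agree
    by (rule allI, rule_tac x = "Suc k" in exI) (auto simp: agree_def)
  moreover have "(\<lambda>i. prepend b x (Suc i)) = x" for x by (simp add: prepend_def)
  ultimately have "homeomorphism a (prepend b ` a) (prepend b) (\<lambda>x i. x (Suc i))"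
    unfolding homeomorphism_def by (auto intro: continuous_on_subset simp: image_iff)
  then show ?thesis by (auto simp: homeomorphic_def)
qed

text \<open>
  Induction on the number of deciding coordinates.  The first coordinate divides \<open>a\<close> into two halves; each of
  them is empty or, by the induction hypothesis, a copy of the whole space, and two disjoint copies form
  another copy.
\<close>

lemma homeomorphic_UNIV_if_decides:
  "decides k a \<Longrightarrow> a \<noteq> {} \<Longrightarrow> a homeomorphic (UNIV :: cantor set)"
proof (induction k arbitrary: a)
  case 0
  then have "a = UNIV" by (auto simp: decides_def agree_def)
  then show ?case by (simp add: homeomorphic_refl)
next
  case (Suc k)
  define a0 where "a0 = (\<lambda>v. {y. prepend v y \<in> a})"
  have dec: "decides k (a0 v)" for v
    unfolding decides_def
  proof (intro allI impI)
    fix x y assume "agree k x y"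
    then have "agree (Suc k) (prepend v x) (prepend v y)"
      by (auto simp: agree_def prepend_def split: nat.split)
    then show "x \<in> a0 v \<longleftrightarrow> y \<in> a0 v" using Suc.prems(1) by (auto simp: a0_def decides_def)
  qed
  have eq: "x = prepend (x 0) (\<lambda>i. x (Suc i))" for x
    by (rule ext) (simp add: prepend_def split: nat.split)
  have mem: "x \<in> prepend v ` b \<longleftrightarrow> x 0 = v \<and> (\<lambda>i. x (Suc i)) \<in> b" for x v b
    using eq [of x] by (auto simp: prepend_def image_iff)
  have split: "a = prepend True ` a0 True \<union> prepend False ` a0 False"
    using eq by (auto simp: mem a0_def) (metis (full_types))+
  have hom: "prepend v ` a0 v homeomorphic (UNIV :: cantor set)" if "a0 v \<noteq> {}" for v
    using Suc.IH [OF dec that] homeomorphic_prepend homeomorphic_sym homeomorphic_trans by blast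
  have deciding: "decides (Suc k) (prepend v ` b)" if "decides k b" for v b k
    unfolding decides_def mem
  proof (intro allI impI)
    fix x y assume xy: "agree (Suc k) x y"
    then have "agree k (\<lambda>i. x (Suc i)) (\<lambda>i. y (Suc i))" "x 0 = y 0" by (auto simp: agree_def)
    then show "(x 0 = v \<and> (\<lambda>i. x (Suc i)) \<in> b) = (y 0 = v \<and> (\<lambda>i. y (Suc i)) \<in> b)"
      using that unfolding decides_def by blast
  qed
  have univ: "(UNIV :: cantor set) = prepend True ` UNIV \<union> prepend False ` UNIV"
    by (auto simp: mem)
  have uh: "prepend v ` UNIV homeomorphic (UNIV :: cantor set)" for v
    using homeomorphic_prepend homeomorphic_sym by blast
  show ?case
  proof (cases "a0 True = {} \<or> a0 False = {}")
    case True
    then show ?thesis using split hom Suc.prems(2) by (cases "a0 True = {}") auto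
  next
    case False
    have "(prepend True ` a0 True \<union> prepend False ` a0 False) homeomorphic
        (prepend True ` UNIV \<union> prepend False ` UNIV)"
    proof (rule homeomorphic_disjoint_union)
      have "prepend v ` a0 v homeomorphic prepend v ` UNIV" if "a0 v \<noteq> {}" for v
        by (rule homeomorphic_trans [OF hom [OF that] homeomorphic_sym [THEN iffD1, OF uh]])
      then show "prepend True ` a0 True homeomorphic prepend True ` UNIV"
        "prepend False ` a0 False homeomorphic prepend False ` UNIV" using False by auto
      have "decides k UNIV" by (simp add: decides_def)
      then show "clopen (prepend True ` a0 True)" "clopen (prepend False ` a0 False)"
        "clopen (range (prepend True))" "clopen (range (prepend False))"
        using deciding dec clopen_if_decides by blast+
    qed (auto simp: prepend_def fun_eq_iff split: nat.splits)
    then show ?thesis using split univ by simp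
  qed
qed

lemma clopen_homeomorphic:
  assumes "clopen a" "a \<noteq> {}" "clopen b" "b \<noteq> {}"
  shows "a homeomorphic b"
  using assms homeomorphic_UNIV_if_decides clopen_decides homeomorphic_sym homeomorphic_trans
  by metis

text \<open>
  Any matching between the cells of two finite clopen partitions is induced by a homeomorphism, as there is
  only one nonempty clopen set up to homeomorphism.
\<close>

lemma glue_homeo:
  assumes F: "finite F"
    and U: "\<And>f. f \<in> F \<Longrightarrow> clopen (U f) \<and> U f \<noteq> {}" "disjoint_family_on U F" "(\<Union>f\<in>F. U f) = UNIV"
    and V: "\<And>f. f \<in> F \<Longrightarrow> clopen (V f) \<and> V f \<noteq> {}" "disjoint_family_on V F" "(\<Union>f\<in>F. V f) = UNIV"
  obtains h where "h \<in> homeos" "\<And>f. f \<in> F \<Longrightarrow> h ` U f = V f"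
proof -
  have "\<exists>p p'. homeomorphism (U f) (V f) p p'" if "f \<in> F" for f
    using clopen_homeomorphic [of "U f" "V f"] U(1) V(1) that by (simp add: homeomorphic_def)
  then obtain p p' where p: "\<And>f. f \<in> F \<Longrightarrow> homeomorphism (U f) (V f) (p f) (p' f)" by metis
  define iu where "iu = (\<lambda>x. THE f. f \<in> F \<and> x \<in> U f)"
  define iv where "iv = (\<lambda>x. THE f. f \<in> F \<and> x \<in> V f)"
  have iu: "iu x = f" if "f \<in> F" "x \<in> U f" for x f
    unfolding iu_def using that U(2) by (intro the_equality) (auto simp: disjoint_family_on_def)
  have iv: "iv x = f" if "f \<in> F" "x \<in> V f" for x f
    unfolding iv_def using that V(2) by (intro the_equality) (auto simp: disjoint_family_on_def)
  define h where "h = (\<lambda>x. p (iu x) x)"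
  define h' where "h' = (\<lambda>x. p' (iv x) x)"
  have h: "h x = p f x" if "f \<in> F" "x \<in> U f" for x f using iu that by (simp add: h_def)
  have h': "h' x = p' f x" if "f \<in> F" "x \<in> V f" for x f using iv that by (simp add: h'_def)
  have img: "h ` U f = V f" if "f \<in> F" for f
  proof -
    have "h ` U f = p f ` U f" using h [OF that] by (rule image_cong [OF refl])
    then show ?thesis using p [OF that] by (simp add: homeomorphism_def)
  qed
  have "continuous_on (\<Union>f\<in>F. U f) h"
    using F U p h
    by (intro continuous_on_closed_Union) (auto simp: clopen_def homeomorphism_def cong: continuous_on_cong)
  moreover have "continuous_on (\<Union>f\<in>F. V f) h'"
    using F V p h'
    by (intro continuous_on_closed_Union) (auto simp: clopen_def homeomorphism_def cong: continuous_on_cong)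
  moreover have "h' (h x) = x" for x
  proof -
    obtain f where f: "f \<in> F" "x \<in> U f" using U(3) by blast
    then have "h x \<in> V f" using img by blast
    then show ?thesis using f h h' p [OF f(1)] by (simp add: homeomorphism_def)
  qed
  moreover have "h (h' y) = y" for y
  proof -
    obtain f where f: "f \<in> F" "y \<in> V f" using V(3) by blast
    then have "h' y \<in> U f" using h' p [OF f(1)] by (auto simp: homeomorphism_def)
    then show ?thesis using f h h' p [OF f(1)] by (simp add: homeomorphism_def)
  qed
  ultimately have "h \<in> homeos" using U(3) V(3) by (intro homeosI [of h h']) auto
  then show ?thesis using img that by blast
qed

section \<open>Dumbbells as periodic walks\<close>

text \<open>
  A dumbbell whose plates have weight \<open>N\<close> and whose bar has \<open>s\<close> vertices, unrolled over the integers.  The bar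
  occupies the positions \<open>1, \<dots>, s\<close>; the nonpositive positions run periodically through the left plate, with
  \<open>u\<^sub>1\<close> at position 0; the positions after \<open>s\<close> run through the right plate, with \<open>w\<^sub>1\<close> at position \<open>s + 1\<close>.  The edge
  from \<open>u\<^sub>1\<close> to the bar is the step from 0 to 1, and the other edge from \<open>u\<^sub>1\<close> is the step from \<open>- N\<close> to \<open>1 - N\<close>.
\<close>

definition line :: "int \<Rightarrow> (int \<Rightarrow> 'a) \<Rightarrow> int \<Rightarrow> bool" where
  "line N c s \<longleftrightarrow> 1 \<le> s \<and> (\<forall>j\<le>0. c (j - N) = c j) \<and> (\<forall>j>s. c (j + N) = c j)"

text \<open>
  The coincidences between positions that periodicity forces.
\<close>

definition same_place :: "int \<Rightarrow> int \<Rightarrow> int \<Rightarrow> int \<Rightarrow> bool" where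
  "same_place N s j j' \<longleftrightarrow> j = j' \<or> (j \<le> 0 \<and> j' \<le> 0 \<or> s < j \<and> s < j') \<and> N dvd j - j'"

text \<open>
  A graph that is the disjoint union of dumbbells, one for each line in \<open>I\<close>.  The edges are the steps of the
  lines, and by the last clause vertices coincide only where periodicity forces it.
\<close>

definition dumbbells :: "'a set \<Rightarrow> ('a \<times> 'a) set \<Rightarrow> int \<Rightarrow> ((int \<Rightarrow> 'a) \<times> int) set \<Rightarrow> bool" where
  "dumbbells V E N I \<longleftrightarrow> 1 \<le> N \<and> (\<forall>(c, s)\<in>I. line N c s) \<and>
     V = (\<Union>(c, s)\<in>I. range c) \<and>
     E = (\<Union>(c, s)\<in>I. range (\<lambda>j. (c j, c (j + 1)))) \<and>
     (\<forall>(c, s)\<in>I. \<forall>(c', s')\<in>I. \<forall>j j'. c j = c' j' \<longrightarrow> c = c' \<and> s = s' \<and> same_place N s j j')"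

lemma line_left_mult: "line N c s \<Longrightarrow> j \<le> 0 \<Longrightarrow> 1 \<le> N \<Longrightarrow> c (j - N * int k) = c j"
proof (induction k)
  case (Suc k)
  have "0 \<le> N * int k" using Suc.prems by simp
  then have "j - N * int k \<le> 0" using Suc.prems by linarith
  then have "c (j - N * int k - N) = c (j - N * int k)" using Suc.prems(1) by (simp add: line_def)
  moreover have "j - N * int (Suc k) = j - N * int k - N" by (simp add: algebra_simps)
  ultimately show ?case using Suc.IH [OF Suc.prems] by metis
qed simp

lemma line_right_mult: "line N c s \<Longrightarrow> s < j \<Longrightarrow> 1 \<le> N \<Longrightarrow> c (j + N * int k) = c j"
proof (induction k)
  case (Suc k)
  have "0 \<le> N * int k" using Suc.prems by simp
  then have "s < j + N * int k" using Suc.prems by linarith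
  then have "c (j + N * int k + N) = c (j + N * int k)" using Suc.prems(1) by (simp add: line_def)
  moreover have "j + N * int (Suc k) = j + N * int k + N" by (simp add: algebra_simps)
  ultimately show ?case using Suc.IH [OF Suc.prems] by metis
qed simp

lemma dvd_diff_cases:
  assumes "N dvd j - j'" "1 \<le> (N::int)"
  obtains k where "j' = j - N * int k" | k where "j = j' - N * int k"
proof -
  obtain q where q: "j - j' = N * q" using assms(1) by (auto simp: dvd_def)
  show ?thesis
  proof (cases "0 \<le> q")
    case True
    then show ?thesis using q that(1) [of "nat q"] by simp
  next
    case False
    then show ?thesis using q that(2) [of "nat (- q)"] by (simp add: algebra_simps)
  qed
qed

lemma same_place_imp_eq:
  assumes c: "line N c s" and N: "1 \<le> N" and sp: "same_place N s j j'"
  shows "c j = c j'"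
proof (cases "j = j'")
  case False
  then have d: "N dvd j - j'" and side: "j \<le> 0 \<and> j' \<le> 0 \<or> s < j \<and> s < j'"
    using sp by (auto simp: same_place_def)
  from d N show ?thesis
  proof (cases rule: dvd_diff_cases)
    case (1 k)
    then have "j = j' + N * int k" by simp
    then show ?thesis using side 1 line_left_mult [OF c _ N, of j k] line_right_mult [OF c _ N, of j' k] by auto
  next
    case (2 k)
    then have "j' = j + N * int k" by simp
    then show ?thesis using side 2 line_left_mult [OF c _ N, of j' k] line_right_mult [OF c _ N, of j k] by auto
  qed
qed simp

lemma same_place_refl [simp]: "same_place N s j j"
  by (simp add: same_place_def)

lemma same_place_sym: "same_place N s i j \<Longrightarrow> same_place N s j i"
  by (auto simp: same_place_def dvd_diff_commute)

lemma same_place_trans: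
  assumes "1 \<le> s" "same_place N s i j" "same_place N s j k"
  shows "same_place N s i k"
proof -
  have "N dvd i - k" if "N dvd i - j" "N dvd j - k" using dvd_add [OF that] by simp
  then show ?thesis using assms by (auto simp: same_place_def)
qed

text \<open>
  A set that represents each vertex of a dumbbell by exactly one position.
\<close>

definition places :: "int \<Rightarrow> int \<Rightarrow> int set" where
  "places N s = {- N..- 1} \<union> {1..s} \<union> {s + 1..s + N}"

definition place :: "int \<Rightarrow> int \<Rightarrow> int \<Rightarrow> int" where
  "place N s j = (if j \<le> 0 then j mod N - N else if j \<le> s then j else s + 1 + (j - s - 1) mod N)"

context
  fixes N s :: int
  assumes N: "1 \<le> N" and s: "1 \<le> s"
begin

lemma place_side: "place N s j \<in> places N s \<and> (place N s j \<le> 0 \<longleftrightarrow> j \<le> 0) \<and> (s < place N s j \<longleftrightarrow> s < j)"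
proof -
  define l r where "l = j mod N" and "r = (j - s - 1) mod N"
  have "0 \<le> l" "l < N" "0 \<le> r" "r < N" using N by (simp_all add: l_def r_def)
  then show ?thesis using s by (auto simp: place_def places_def simp flip: l_def r_def)
qed

lemma place_same: "same_place N s (place N s j) j"
proof -
  have "N dvd j mod N - j" "N dvd (j - s - 1) mod N - (j - s - 1)" by (simp_all add: mod_eq_dvd_iff [symmetric])
  then have "N dvd j mod N - j - N" "N dvd s + 1 + (j - s - 1) mod N - j"
    using dvd_diff [of N "j mod N - j" N] by (simp_all add: algebra_simps)
  then have "N dvd place N s j - j" by (auto simp: place_def algebra_simps)
  moreover have "0 < j \<Longrightarrow> j \<le> s \<Longrightarrow> place N s j = j" by (simp add: place_def)
  ultimately show ?thesis using place_side [of j] unfolding same_place_def by fastforce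
qed

lemma places_unique: "i \<in> places N s \<Longrightarrow> j \<in> places N s \<Longrightarrow> same_place N s i j \<Longrightarrow> i = j"
  using N s zdvd_not_zless [of "i - j" N] zdvd_not_zless [of "j - i" N]
  by (cases i j rule: linorder_cases) (auto simp: same_place_def places_def dvd_diff_commute)

lemma place_eq_iff: "place N s i = place N s j \<longleftrightarrow> same_place N s i j"
proof
  assume "place N s i = place N s j"
  then show "same_place N s i j"
    using place_same [of i] place_same [of j] same_place_sym same_place_trans [OF s] by metis
next
  assume "same_place N s i j"
  then have "same_place N s (place N s i) (place N s j)"
    using place_same [of i] place_same [of j] same_place_sym same_place_trans [OF s] by metis
  then show "place N s i = place N s j" using places_unique place_side by blast
qed

lemma place_id: "j \<in> places N s \<Longrightarrow> place N s j = j"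
  using places_unique place_side place_same by blast

lemma line_place: "line N (place N s) s"
  using N s unfolding line_def by (auto simp: place_eq_iff same_place_def)

end

text \<open>
  The steps from finitely many positions exhaust all edges.  Position 0 must not be replaced by \<open>- N\<close> here:
  both carry the vertex \<open>u\<^sub>1\<close>, but their successors differ.
\<close>

lemma line_reduce:
  assumes c: "line N c s" and N: "1 \<le> N"
  obtains j' where "- N \<le> j'" "j' \<le> s + N" "c j' = c j" "c (j' + 1) = c (j + 1)"
proof (cases "j = 0")
  case True
  then show ?thesis using that [of 0] N c by (simp add: line_def)
next
  case False
  have s: "1 \<le> s" using c by (simp add: line_def)
  have sp: "same_place N s (place N s j) j" by (rule place_same [OF N s])
  then have "same_place N s (place N s j + 1) (j + 1)"
    using False place_side [OF N s, of j] by (auto simp: same_place_def places_def)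
  then show ?thesis
    using that [of "place N s j"] sp same_place_imp_eq [OF c N] place_side [OF N s, of j] N s
    by (auto simp: places_def)
qed

lemma dumbbells_D:
  assumes "dumbbells V E N I"
  shows "1 \<le> N"
    and "(c, s) \<in> I \<Longrightarrow> line N c s"
    and "(c, s) \<in> I \<Longrightarrow> c j \<in> V"
    and "(c, s) \<in> I \<Longrightarrow> (c j, c (j + 1)) \<in> E"
    and "(c, s) \<in> I \<Longrightarrow> (c', s') \<in> I \<Longrightarrow> c j = c' j' \<Longrightarrow> c = c' \<and> s = s' \<and> same_place N s j j'"
  using assms unfolding dumbbells_def by (fast | simp)+

lemma dumbbells_vertexE:
  assumes "dumbbells V E N I" "a \<in> V"
  obtains c s j where "(c, s) \<in> I" "a = c j"
  using assms unfolding dumbbells_def by blast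

lemma dumbbells_edgeE:
  assumes "dumbbells V E N I" "(a, b) \<in> E"
  obtains c s j where "(c, s) \<in> I" "a = c j" "b = c (j + 1)"
  using assms unfolding dumbbells_def by blast

lemma dumbbells_edge_fromE:
  assumes "dumbbells V E N I" "(c, s) \<in> I" "(c j, b) \<in> E"
  obtains i where "c i = c j" "b = c (i + 1)" "same_place N s i j"
proof -
  obtain c' s' i where i: "(c', s') \<in> I" "c j = c' i" "b = c' (i + 1)"
    using dumbbells_edgeE [OF assms(1,3)] by metis
  then have "c = c'" using dumbbells_D(5) [OF assms(1,2)] by blast
  then show ?thesis using that [of i] i dumbbells_D(5) [OF assms(1,2,2), of i j] by simp
qed

lemma dumbbells_edge_toE:
  assumes "dumbbells V E N I" "(c, s) \<in> I" "(a, c j) \<in> E"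
  obtains i where "c i = c j" "a = c (i - 1)" "same_place N s i j"
proof -
  obtain c' s' i where i: "(c', s') \<in> I" "a = c' i" "c j = c' (i + 1)"
    using dumbbells_edgeE [OF assms(1,3)] by metis
  then have "c = c'" using dumbbells_D(5) [OF assms(1,2)] by blast
  then show ?thesis using that [of "i + 1"] i dumbbells_D(5) [OF assms(1,2,2), of "i + 1" j] by simp
qed

text \<open>
  Only \<open>u\<^sub>1\<close>, which sits at nonpositive positions, has two successors.
\<close>

lemma dumbbells_succ_unique:
  assumes D: "dumbbells V E N I" "(c, s) \<in> I" and E: "(c j, b) \<in> E" and j: "1 \<le> j"
  shows "b = c (j + 1)"
proof -
  obtain i where i: "c i = c j" "b = c (i + 1)" "same_place N s i j"
    using dumbbells_edge_fromE [OF D E] by metis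
  have "same_place N s (i + 1) (j + 1)" using i(3) j by (auto simp: same_place_def)
  then show ?thesis using same_place_imp_eq dumbbells_D(1,2) D i(2) by metis
qed

text \<open>
  Only \<open>w\<^sub>1\<close>, which sits at positions after \<open>s\<close>, has two predecessors.
\<close>

lemma dumbbells_pred_unique:
  assumes D: "dumbbells V E N I" "(c, s) \<in> I" and E: "(a, c j) \<in> E" and j: "j \<le> s"
  shows "a = c (j - 1)"
proof -
  obtain i where i: "c i = c j" "a = c (i - 1)" "same_place N s i j"
    using dumbbells_edge_toE [OF D E] by metis
  have "same_place N s (i - 1) (j - 1)" using i(3) j by (auto simp: same_place_def)
  then show ?thesis using same_place_imp_eq dumbbells_D(1,2) D i(2) by metis
qed

section \<open>Weak components\<close>

abbreviation weakly :: "('a \<times> 'a) set \<Rightarrow> ('a \<times> 'a) set" where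
  "weakly E \<equiv> (E \<union> E\<inverse>)\<^sup>*"

lemma rtrancl_on_eq:
  assumes "R \<subseteq> V \<times> V" "a \<in> V"
  shows "(a, b) \<in> rtrancl_on V R \<longleftrightarrow> (a, b) \<in> R\<^sup>*"
proof
  assume "(a, b) \<in> R\<^sup>*"
  then show "(a, b) \<in> rtrancl_on V R"
    by induction (use assms in \<open>auto intro: rtrancl_on_into_rtrancl_on\<close>)
qed (rule rtrancl_on_rtranclI)

lemma connected_with_proj:
  assumes "parcs D \<subseteq> pverts D \<times> pverts D"
  shows "Digraph_Component.connected (with_proj D) \<longleftrightarrow>
    pverts D \<noteq> {} \<and> (\<forall>a\<in>pverts D. \<forall>b\<in>pverts D. (a, b) \<in> weakly (parcs D))"
proof -
  have "parcs (mk_symmetric (with_proj D)) = parcs D \<union> (parcs D)\<inverse>"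
    by (auto simp: parcs_mk_symmetric)
  moreover have "parcs D \<union> (parcs D)\<inverse> \<subseteq> pverts D \<times> pverts D" using assms by auto
  ultimately show ?thesis
    by (auto simp: Digraph_Component.connected_def strongly_connected_def reachable_def rtrancl_on_eq)
qed

lemma wf_with_proj: "wf_digraph (with_proj D) \<longleftrightarrow> parcs D \<subseteq> pverts D \<times> pverts D"
  by (auto simp: wf_digraph_def)

lemma subgraph_with_proj:
  "subgraph (with_proj D) (with_proj G) \<longleftrightarrow>
     pverts D \<subseteq> pverts G \<and> parcs D \<subseteq> parcs G \<and>
     parcs G \<subseteq> pverts G \<times> pverts G \<and> parcs D \<subseteq> pverts D \<times> pverts D"
  by (auto simp: subgraph_def wf_with_proj compatibleI_with_proj)

lemma subgraph_of_with_proj: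
  assumes "subgraph H (with_proj G)"
  obtains D where "H = with_proj D"
proof -
  have "H = with_proj \<lparr>pverts = verts H, parcs = arcs H\<rparr>"
    using assms by (cases H) (simp add: subgraph_def compatible_def with_proj_def)
  then show ?thesis using that by blast
qed

lemma with_proj_inject: "with_proj D = with_proj D' \<longleftrightarrow> D = D'"
  by (cases D; cases D') (simp add: with_proj_def)

definition weak_component :: "'a pair_pre_digraph \<Rightarrow> 'a \<Rightarrow> 'a pair_pre_digraph" where
  "weak_component G a = (let W = {b. (a, b) \<in> weakly (parcs G)} in \<lparr>pverts = W, parcs = parcs G \<inter> W \<times> W\<rparr>)"

lemma weakly_sym: "(a, b) \<in> weakly E \<Longrightarrow> (b, a) \<in> weakly E"
proof -
  have "sym (E \<union> E\<inverse>)" by (auto simp: sym_def)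
  then show "(a, b) \<in> weakly E \<Longrightarrow> (b, a) \<in> weakly E" using sym_rtrancl by (metis symD)
qed

context
  fixes G :: "'a pair_pre_digraph"
  assumes G: "parcs G \<subseteq> pverts G \<times> pverts G"
begin

lemma weak_component_subgraph:
  assumes a: "a \<in> pverts G"
  shows "subgraph (with_proj (weak_component G a)) (with_proj G)"
proof -
  have "b \<in> pverts G" if "(a, b) \<in> weakly (parcs G)" for b
    using that by induction (use a G in auto)
  then show ?thesis using G by (auto simp: subgraph_with_proj weak_component_def Let_def)
qed

lemma weak_component_connected:
  assumes a: "a \<in> pverts G"
  shows "Digraph_Component.connected (with_proj (weak_component G a))"
proof -
  let ?W = "{b. (a, b) \<in> weakly (parcs G)}"
  let ?E = "parcs G \<inter> ?W \<times> ?W"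
  have *: "(a, b) \<in> weakly ?E" if "(a, b) \<in> weakly (parcs G)" for b
    using that
  proof induction
    case (step b d)
    then have "(a, d) \<in> weakly (parcs G)" by (meson rtrancl.rtrancl_into_rtrancl)
    then have "(b, d) \<in> ?E \<union> ?E\<inverse>" using step by auto
    then show ?case using step.IH by (meson rtrancl.rtrancl_into_rtrancl)
  qed simp
  have "(b, d) \<in> weakly ?E" if "b \<in> ?W" "d \<in> ?W" for b d
    using rtrancl_trans [OF weakly_sym [OF *] *] that by simp
  moreover have "parcs (weak_component G a) \<subseteq> pverts (weak_component G a) \<times> pverts (weak_component G a)"
    by (auto simp: weak_component_def Let_def)
  ultimately show ?thesis
    unfolding connected_with_proj [OF \<open>parcs (weak_component G a) \<subseteq> _\<close>] by (auto simp: weak_component_def Let_def)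
qed

lemma connected_subgraph_weak_component:
  assumes sub: "subgraph (with_proj D) (with_proj G)"
    and con: "Digraph_Component.connected (with_proj D)" and a: "a \<in> pverts D"
  shows "subgraph (with_proj D) (with_proj (weak_component G a))"
proof -
  have D: "parcs D \<subseteq> pverts D \<times> pverts D" "parcs D \<subseteq> parcs G"
    using sub by (auto simp: subgraph_with_proj)
  have "(a, b) \<in> weakly (parcs G)" if "b \<in> pverts D" for b
  proof -
    have "(a, b) \<in> weakly (parcs D)" using con a that connected_with_proj [OF D(1)] by blast
    moreover have "parcs D \<union> (parcs D)\<inverse> \<subseteq> parcs G \<union> (parcs G)\<inverse>" using D(2) by auto
    ultimately show ?thesis using rtrancl_mono by blast
  qed
  then show ?thesis using D by (auto simp: subgraph_with_proj weak_component_def Let_def)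
qed

lemma component_weak_component:
  assumes a: "a \<in> pverts G"
  shows "component (weak_component G a) G"
  unfolding component_def pre_digraph.max_subgraph_def
proof (intro conjI allI impI notI)
  show "subgraph (with_proj (weak_component G a)) (with_proj G)" "Digraph_Component.connected (with_proj (weak_component G a))"
    using weak_component_subgraph weak_component_connected a by auto
  fix H assume H: "H \<noteq> with_proj (weak_component G a) \<and> subgraph (with_proj (weak_component G a)) H"
    "subgraph H (with_proj G) \<and> Digraph_Component.connected H"
  obtain D where D: "H = with_proj D" using H subgraph_of_with_proj by blast
  have le: "subgraph (with_proj (weak_component G a)) (with_proj D)" using H D by simp
  have "a \<in> pverts (weak_component G a)" by (simp add: weak_component_def Let_def)
  then have "a \<in> pverts D" using le by (auto simp: subgraph_with_proj)
  then have "subgraph (with_proj D) (with_proj (weak_component G a))" using connected_subgraph_weak_component H D by blast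
  then have "D = weak_component G a" using le by (intro pair_pre_digraph.equality) (auto simp: subgraph_with_proj)
  then show False using H D by blast
qed

text \<open>
  A connected subgraph is contained in the weak component of each of its vertices; maximality makes them equal.
\<close>

lemma component_eq_weak_component:
  assumes D: "component D G" and a: "a \<in> pverts D"
  shows "D = weak_component G a"
proof -
  have sub: "subgraph (with_proj D) (with_proj G)" and con: "Digraph_Component.connected (with_proj D)"
    and max: "\<And>H. H \<noteq> with_proj D \<Longrightarrow> subgraph (with_proj D) H \<Longrightarrow>
        \<not> (subgraph H (with_proj G) \<and> Digraph_Component.connected H)"
    using D unfolding component_def pre_digraph.max_subgraph_def by blast+
  have "a \<in> pverts G" using a sub by (auto simp: subgraph_with_proj)
  then have "with_proj (weak_component G a) = with_proj D"
    using max [of "with_proj (weak_component G a)"] weak_component_subgraph weak_component_connected connected_subgraph_weak_component [OF sub con a]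
    by blast
  then show ?thesis by (simp add: with_proj_inject)
qed

lemma component_nonempty:
  assumes "component D G"
  obtains a where "a \<in> pverts D" "a \<in> pverts G"
proof -
  have "subgraph (with_proj D) (with_proj G)" "Digraph_Component.connected (with_proj D)"
    using assms unfolding component_def pre_digraph.max_subgraph_def by blast+
  then have "pverts D \<noteq> {}" "pverts D \<subseteq> pverts G"
    by (auto simp: Digraph_Component.connected_def strongly_connected_def subgraph_with_proj)
  then show ?thesis using that by blast
qed

end

definition dumbbell_line :: "int \<Rightarrow> 'a pair_pre_digraph \<Rightarrow> (int \<Rightarrow> 'a) \<Rightarrow> int \<Rightarrow> bool" where
  "dumbbell_line N D c s \<longleftrightarrow> line N c s \<and> pverts D = range c \<and>
     parcs D = range (\<lambda>j. (c j, c (j + 1))) \<and> (\<forall>j j'. c j = c j' \<longrightarrow> same_place N s j j')"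

lemma int_step_invariant:
  assumes "P (k::int)" "\<And>j. P j \<Longrightarrow> P (j + 1)" "\<And>j. P j \<Longrightarrow> P (j - 1)"
  shows "P j"
  by (induction j rule: int_induct [of _ k]) (use assms in auto)

text \<open>
  A line is connected, and no edge leads into it or out of it; so it exhausts the weak component of each of its
  vertices.
\<close>

lemma dumbbells_component:
  assumes D: "dumbbells V E N I" and comp: "component D \<lparr>pverts = V, parcs = E\<rparr>"
  obtains c s where "(c, s) \<in> I" "dumbbell_line N D c s"
proof -
  let ?G = "\<lparr>pverts = V, parcs = E\<rparr>"
  have EV: "parcs ?G \<subseteq> pverts ?G \<times> pverts ?G"
    using dumbbells_edgeE [OF D] dumbbells_D(3) [OF D] by auto metis+
  obtain a where a: "a \<in> pverts D" "a \<in> pverts ?G" using component_nonempty [OF EV comp] by blast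
  then have "a \<in> V" by simp
  then obtain c s k where c: "(c, s) \<in> I" "a = c k" using dumbbells_vertexE [OF D] by metis
  have Dw: "D = weak_component ?G a" using component_eq_weak_component [OF EV comp a(1)] .
  have "(a, c j) \<in> weakly E" for j
  proof (induction j rule: int_step_invariant [where k = k])
    case 1 then show ?case using c by simp
  next
    case (2 j)
    then show ?case using dumbbells_D(4) [OF D c(1), of j] by (meson UnI1 rtrancl.rtrancl_into_rtrancl)
  next
    case (3 j)
    have "(c j, c (j - 1)) \<in> E\<inverse>" using dumbbells_D(4) [OF D c(1), of "j - 1"] by simp
    then show ?case using 3 by (meson UnI2 rtrancl.rtrancl_into_rtrancl)
  qed
  moreover have "b \<in> range c" if "(a, b) \<in> weakly E" for b
    using that
  proof induction
    case base then show ?case using c by simp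
  next
    case (step b d)
    then obtain j where j: "b = c j" by blast
    show ?case
      using step.hyps j dumbbells_edge_fromE [OF D c(1)] dumbbells_edge_toE [OF D c(1)]
      by (metis Un_iff converse_iff rangeI)
  qed
  ultimately have V: "{b. (a, b) \<in> weakly E} = range c" by blast
  have "E \<inter> range c \<times> range c = range (\<lambda>j. (c j, c (j + 1)))"
  proof (intro equalityI subsetI)
    fix e assume "e \<in> E \<inter> range c \<times> range c"
    then obtain j b where e: "e = (c j, b)" "(c j, b) \<in> E" by auto
    obtain i where "c i = c j" "b = c (i + 1)" using dumbbells_edge_fromE [OF D c(1) e(2)] by metis
    then show "e \<in> range (\<lambda>j. (c j, c (j + 1)))" using e(1) by (auto simp: image_iff intro!: exI [of _ i])
  next
    fix e assume "e \<in> range (\<lambda>j. (c j, c (j + 1)))"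
    then show "e \<in> E \<inter> range c \<times> range c" using dumbbells_D(4) [OF D c(1)] by auto
  qed
  then have "dumbbell_line N D c s"
    unfolding dumbbell_line_def using Dw V dumbbells_D(2,5) [OF D] c(1)
    by (auto simp: weak_component_def Let_def)
  then show ?thesis using that c(1) by blast
qed

lemma dumbbells_if_components:
  assumes N: "1 \<le> N" and EV: "E \<subseteq> V \<times> V"
    and comp: "\<And>D. component D \<lparr>pverts = V, parcs = E\<rparr> \<Longrightarrow> \<exists>c s. dumbbell_line N D c s"
  obtains I where "dumbbells V E N I"
    "\<And>c s. (c, s) \<in> I \<Longrightarrow> \<exists>D. component D \<lparr>pverts = V, parcs = E\<rparr> \<and> dumbbell_line N D c s"
proof -
  let ?G = "\<lparr>pverts = V, parcs = E\<rparr>"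
  have EV': "parcs ?G \<subseteq> pverts ?G \<times> pverts ?G" using EV by simp
  obtain cc ss where cs: "\<And>D. component D ?G \<Longrightarrow> dumbbell_line N D (cc D) (ss D)"
    using comp by metis
  define I where "I = {(cc D, ss D) | D. component D ?G}"
  have edge: "D = D'" if "component D ?G" "component D' ?G" "x \<in> pverts D" "x \<in> pverts D'" for D D' x
    using that component_eq_weak_component [OF EV'] by metis
  have verts: "\<exists>D. component D ?G \<and> a \<in> pverts D" if "a \<in> V" for a
  proof -
    have "a \<in> pverts (weak_component ?G a)" by (simp add: weak_component_def Let_def)
    then show ?thesis using component_weak_component [OF EV'] that by (metis pair_pre_digraph.select_convs(1))
  qed
  have sub: "pverts D \<subseteq> V \<and> parcs D \<subseteq> E" if D: "component D ?G" for D
    using D unfolding component_def pre_digraph.max_subgraph_def subgraph_with_proj by simp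
  have arcs: "(a, b) \<in> parcs D" if D: "component D ?G" and "a \<in> pverts D" "(a, b) \<in> E" for D a b
  proof -
    have "D = weak_component ?G a" using component_eq_weak_component [OF EV' D] that by blast
    then show ?thesis using that by (auto simp: weak_component_def Let_def)
  qed
  have "dumbbells V E N I"
    unfolding dumbbells_def
  proof (intro conjI)
    show "\<forall>(c, s)\<in>I. line N c s" using cs by (auto simp: I_def dumbbell_line_def)
    show "V = (\<Union>(c, s)\<in>I. range c)"
    proof (intro equalityI subsetI)
      fix a assume "a \<in> V"
      then obtain D where D: "component D ?G" "a \<in> pverts D" using verts by blast
      then have "a \<in> range (cc D)" using cs by (simp add: dumbbell_line_def)
      then show "a \<in> (\<Union>(c, s)\<in>I. range c)" using D(1) by (auto simp: I_def)
    next
      fix a assume "a \<in> (\<Union>(c, s)\<in>I. range c)"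
      then obtain D where D: "component D ?G" "a \<in> range (cc D)" by (auto simp: I_def)
      then have "a \<in> pverts D" using cs by (simp add: dumbbell_line_def)
      then show "a \<in> V" using sub D(1) by blast
    qed
    show "E = (\<Union>(c, s)\<in>I. range (\<lambda>j. (c j, c (j + 1))))"
    proof (intro equalityI subsetI)
      fix e assume e: "e \<in> E"
      then obtain D where D: "component D ?G" "fst e \<in> pverts D" using verts EV by fastforce
      then have "e \<in> parcs D" using arcs e by (metis prod.collapse)
      then have "e \<in> range (\<lambda>j. (cc D j, cc D (j + 1)))" using cs D by (simp add: dumbbell_line_def)
      then show "e \<in> (\<Union>(c, s)\<in>I. range (\<lambda>j. (c j, c (j + 1))))"
        using D(1) by (auto simp: I_def)
    next
      fix e assume "e \<in> (\<Union>(c, s)\<in>I. range (\<lambda>j. (c j, c (j + 1))))"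
      then obtain D where D: "component D ?G" "e \<in> range (\<lambda>j. (cc D j, cc D (j + 1)))"
        by (auto simp: I_def)
      then have "e \<in> parcs D" using cs by (simp add: dumbbell_line_def)
      then show "e \<in> E" using sub D(1) by blast
    qed
    have sep: "c = c' \<and> s = s' \<and> same_place N s j j'"
      if in_I: "(c, s) \<in> I" "(c', s') \<in> I" and eq: "c j = c' j'" for c s c' s' j j'
    proof -
      obtain D D' where D: "component D ?G" "c = cc D" "s = ss D"
        "component D' ?G" "c' = cc D'" "s' = ss D'" using in_I by (auto simp: I_def)
      have "c j \<in> pverts D" "c' j' \<in> pverts D'"
        using cs [OF D(1)] cs [OF D(4)] D(2,5) by (auto simp: dumbbell_line_def)
      then have "D = D'" using edge D(1,4) eq by metis
      then show ?thesis using D eq cs [OF D(1)] by (auto simp: dumbbell_line_def)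
    qed
    then show "\<forall>(c, s)\<in>I. \<forall>(c', s')\<in>I. \<forall>j j'. c j = c' j' \<longrightarrow> c = c' \<and> s = s' \<and> same_place N s j j'"
      by blast
  qed (rule N)
  moreover have "\<exists>D. component D ?G \<and> dumbbell_line N D c s" if "(c, s) \<in> I" for c s
    using that cs by (auto simp: I_def)
  ultimately show ?thesis by (rule that)
qed

section \<open>Labelled dumbbells\<close>

text \<open>
  The label \<open>u\<^sub>i\<close> sits at a negative position, so that \<open>u\<^sub>1, \<dots>, u\<^sub>N\<close> is a path of the line; the position \<open>- N\<close> of \<open>u\<^sub>1\<close> is
  the same place as position 0.
\<close>

definition labels :: "nat \<Rightarrow> nat \<Rightarrow> (int \<Rightarrow> 'a) \<Rightarrow> (nat \<Rightarrow> 'a) \<Rightarrow> (nat \<Rightarrow> 'a) \<Rightarrow> (nat \<Rightarrow> 'a) \<Rightarrow> bool" where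
  "labels N s c u v w \<longleftrightarrow> (\<forall>i\<in>{1..N}. u i = c (int i - 1 - int N) \<and> w i = c (int s + int i)) \<and>
     (\<forall>i\<in>{1..s}. v i = c (int i))"

lemma image_shift_int: "(\<lambda>i. d + int i) ` {1..k} = {d + 1..d + int k}"
proof (intro equalityI subsetI)
  fix j assume "j \<in> {d + 1..d + int k}"
  then have "nat (j - d) \<in> {1..k}" "j = d + int (nat (j - d))" by auto
  then show "j \<in> (\<lambda>i. d + int i) ` {1..k}" by blast
qed auto

lemma image_labels:
  assumes L: "labels N s c u v w" and c: "line (int N) c (int s)" and N: "1 \<le> N"
  shows "u ` {1..N} = c ` {- int N..- 1}" "v ` {1..s} = c ` {1..int s}"
    "w ` {1..N} = c ` {int s + 1..int s + int N}"
    and "c ` places (int N) (int s) = range c"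
proof -
  have im: "(\<lambda>i. c (d + int i)) ` {1..k} = c ` {d + 1..d + int k}" for d k
    unfolding image_shift_int [symmetric] by (simp add: image_image)
  have "u ` {1..N} = (\<lambda>i. c (- 1 - int N + int i)) ` {1..N}"
    using L by (intro image_cong) (auto simp: labels_def algebra_simps)
  then show "u ` {1..N} = c ` {- int N..- 1}" using im [of "- 1 - int N" N] by simp
  have "v ` {1..s} = (\<lambda>i. c (0 + int i)) ` {1..s}" using L by (intro image_cong) (auto simp: labels_def)
  then show "v ` {1..s} = c ` {1..int s}" using im [of 0 s] by simp
  have "w ` {1..N} = (\<lambda>i. c (int s + int i)) ` {1..N}" using L by (intro image_cong) (auto simp: labels_def)
  then show "w ` {1..N} = c ` {int s + 1..int s + int N}" using im [of "int s" N] by simp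
  have Ns: "1 \<le> int N" "1 \<le> int s" using N c by (simp_all add: line_def)
  have "c j \<in> c ` places (int N) (int s)" for j
    using same_place_imp_eq [OF c Ns(1) place_same [OF Ns]] place_side [OF Ns, of j] by (metis imageI)
  then show "c ` places (int N) (int s) = range c" by blast
qed

lemma arcs_labels:
  assumes L: "labels N s c u v w" and c: "line (int N) c (int s)" and N: "1 \<le> N"
  shows "{(u i, u (i + 1)) | i. 1 \<le> i \<and> i < N} \<union> {(u N, u 1)} \<union>
       {(w i, w (i + 1)) | i. 1 \<le> i \<and> i < N} \<union> {(w N, w 1)} \<union>
       {(v i, v (i + 1)) | i. 1 \<le> i \<and> i < s} \<union>
       {(u 1, v 1), (v s, w 1)} = range (\<lambda>j. (c j, c (j + 1)))" (is "?L = ?R")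
proof -
  have N': "1 \<le> int N" and s: "1 \<le> s" using N c by (auto simp: line_def)
  have u: "u i = c (int i - 1 - int N)" and w: "w i = c (int s + int i)" if "1 \<le> i" "i \<le> N" for i
    using L that by (auto simp: labels_def)
  have v: "v i = c (int i)" if "1 \<le> i" "i \<le> s" for i using L that by (auto simp: labels_def)
  have c0: "c (- int N) = c 0" and cs: "c (int s + 1 + int N) = c (int s + 1)"
    using c unfolding line_def by (metis diff_0 order_refl, metis less_add_one)
  have uN: "(u N, u 1) = (c (- 1), c (- 1 + 1))" using u [of N] u [of 1] N c0 by simp
  have wN: "(w N, w 1) = (c (int s + int N), c (int s + int N + 1))"
    using w [of N] w [of 1] N cs by (simp add: algebra_simps)
  have u1: "(u 1, v 1) = (c 0, c (0 + 1))" using u [of 1] v [of 1] N s c0 by simp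
  have vs: "(v s, w 1) = (c (int s), c (int s + 1))" using w [of 1] v [of s] N s by simp
  have ui: "(u i, u (i + 1)) = (c (int i - 1 - int N), c (int i - 1 - int N + 1))" if "1 \<le> i" "i < N" for i
    using u [of i] u [of "i + 1"] that by (simp add: algebra_simps)
  have wi: "(w i, w (i + 1)) = (c (int s + int i), c (int s + int i + 1))" if "1 \<le> i" "i < N" for i
    using w [of i] w [of "i + 1"] that by (simp add: algebra_simps)
  have vi: "(v i, v (i + 1)) = (c (int i), c (int i + 1))" if "1 \<le> i" "i < s" for i
    using v [of i] v [of "i + 1"] that by (simp add: algebra_simps)
  show ?thesis
  proof (intro equalityI subsetI)
    fix e assume "e \<in> ?L"
    then consider i where "1 \<le> i" "i < N" "e = (u i, u (i + 1))" | "e = (u N, u 1)"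
      | i where "1 \<le> i" "i < N" "e = (w i, w (i + 1))" | "e = (w N, w 1)"
      | i where "1 \<le> i" "i < s" "e = (v i, v (i + 1))" | "e = (u 1, v 1)" | "e = (v s, w 1)"
      by blast
    then show "e \<in> ?R"
      by cases (simp only: uN wN u1 vs ui wi vi; rule rangeI)+
  next
    fix e assume "e \<in> ?R"
    then obtain j0 where "e = (c j0, c (j0 + 1))" by auto
    then obtain j where j: "- int N \<le> j" "j \<le> int s + int N" "e = (c j, c (j + 1))"
      using line_reduce [OF c N', of j0] by metis
    consider "j < - 1" | "j = - 1" | "j = 0" | "0 < j" "j < int s" | "j = int s"
      | "int s < j" "j < int s + int N" | "j = int s + int N" using j by linarith
    then show "e \<in> ?L"
    proof cases
      case 1
      then have "e = (u (nat (j + 1 + int N)), u (nat (j + 1 + int N) + 1))"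
        using ui [of "nat (j + 1 + int N)"] j by simp
      moreover have "1 \<le> nat (j + 1 + int N)" "nat (j + 1 + int N) < N" using 1 j by auto
      ultimately show ?thesis by blast
    next
      case 4
      then have "e = (v (nat j), v (nat j + 1))" using vi [of "nat j"] j by simp
      moreover have "1 \<le> nat j" "nat j < s" using 4 by auto
      ultimately show ?thesis by blast
    next
      case 6
      then have "e = (w (nat (j - int s)), w (nat (j - int s) + 1))"
        using wi [of "nat (j - int s)"] j by simp
      moreover have "1 \<le> nat (j - int s)" "nat (j - int s) < N" using 6 by auto
      ultimately show ?thesis by blast
    qed (use j uN wN u1 vs in simp_all)
  qed
qed

lemma inj_on_places_iff:
  assumes c: "line N c s" and N: "1 \<le> N"
  shows "inj_on c (places N s) \<longleftrightarrow> (\<forall>j j'. c j = c j' \<longrightarrow> same_place N s j j')"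
proof -
  have s: "1 \<le> s" using c by (simp add: line_def)
  have cp: "c (place N s j) = c j" for j by (rule same_place_imp_eq [OF c N place_same [OF N s]])
  show ?thesis
  proof
    assume inj: "inj_on c (places N s)"
    show "\<forall>j j'. c j = c j' \<longrightarrow> same_place N s j j'"
    proof (intro allI impI)
      fix j j' assume "c j = c j'"
      then have "place N s j = place N s j'" using inj_onD [OF inj] cp place_side [OF N s] by simp
      then show "same_place N s j j'" using place_eq_iff [OF N s] by blast
    qed
  next
    assume "\<forall>j j'. c j = c j' \<longrightarrow> same_place N s j j'"
    then show "inj_on c (places N s)" using places_unique [OF N s] by (meson inj_onI)
  qed
qed

text \<open>
  The positions of the three kinds of labels make up the set of all places.
\<close>

lemma inj_labels:
  assumes L: "labels N s c u v w" and c: "line (int N) c (int s)" and N: "1 \<le> N"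
  shows "(inj_on u {1..N} \<and> inj_on v {1..s} \<and> inj_on w {1..N} \<and>
     u ` {1..N} \<inter> v ` {1..s} = {} \<and> u ` {1..N} \<inter> w ` {1..N} = {} \<and> v ` {1..s} \<inter> w ` {1..N} = {})
     \<longleftrightarrow> inj_on c (places (int N) (int s))"
proof -
  have inj: "inj_on f {1..k} \<longleftrightarrow> inj_on c {d + 1..d + int k}"
    if "\<And>i. i \<in> {1..k} \<Longrightarrow> f i = c (d + int i)" for f d k
  proof -
    have "inj_on f {1..k} \<longleftrightarrow> inj_on (c \<circ> (\<lambda>i. d + int i)) {1..k}" using that by (intro inj_on_cong) simp
    also have "\<dots> \<longleftrightarrow> inj_on c ((\<lambda>i. d + int i) ` {1..k})"
      by (rule comp_inj_on_iff [symmetric]) (simp add: inj_on_def)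
    also have "(\<lambda>i. d + int i) ` {1..k} = {d + 1..d + int k}" by (rule image_shift_int)
    finally show ?thesis .
  qed
  have "inj_on u {1..N} \<longleftrightarrow> inj_on c {- int N..- 1}"
    using inj [of N u "- 1 - int N"] L by (simp add: labels_def algebra_simps)
  moreover have "inj_on v {1..s} \<longleftrightarrow> inj_on c {1..int s}" using inj [of s v 0] L by (simp add: labels_def)
  moreover have "inj_on w {1..N} \<longleftrightarrow> inj_on c {int s + 1..int s + int N}"
    using inj [of N w "int s"] L by (simp add: labels_def)
  moreover have "{- int N..- 1} - {1..int s} = {- int N..- 1}" "{1..int s} - {- int N..- 1} = {1..int s}"
    "({- int N..- 1} \<union> {1..int s}) - {int s + 1..int s + int N} = {- int N..- 1} \<union> {1..int s}"
    "{int s + 1..int s + int N} - ({- int N..- 1} \<union> {1..int s}) = {int s + 1..int s + int N}"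
    by auto
  ultimately show ?thesis
    unfolding places_def inj_on_Un image_labels(1-3) [OF L c N] by (simp add: image_Un Int_Un_distrib2) blast
qed

lemma labelling_iff_line:
  assumes L: "labels N s c u v w" and c: "line (int N) c (int s)" and N: "1 \<le> N"
  shows "dumbbell_labelling D N s N u v w \<longleftrightarrow> dumbbell_line (int N) D c (int s)"
proof -
  have s: "1 \<le> s" using c by (simp add: line_def)
  have "u ` {1..N} \<union> v ` {1..s} \<union> w ` {1..N} = range c"
    unfolding image_labels(1-3) [OF L c N] image_labels(4) [OF L c N, symmetric] places_def by (simp add: image_Un)
  then show ?thesis
    using inj_labels [OF L c N] inj_on_places_iff [OF c] c s N
    unfolding dumbbell_labelling_def dumbbell_line_def arcs_labels [OF L c N] by simp argo
qed

lemma balanced_dumbbell_iff_line: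
  assumes N: "1 \<le> N"
  shows "balanced_dumbbell N D \<longleftrightarrow> (\<exists>c s. dumbbell_line (int N) D c s)"
proof
  assume "balanced_dumbbell N D"
  then obtain s u v w where l: "dumbbell_labelling D N s N u v w"
    by (auto simp: balanced_dumbbell_def dumbbell_def)
  \<comment> \<open>Position 0 carries \<open>u\<^sub>1\<close> and position \<open>s + 1\<close> carries \<open>w\<^sub>1\<close>; the labels start at 1, and residues at 0.\<close>
  define c where "c = (\<lambda>j::int. if j \<le> 0 then u (nat (j mod int N) + 1) else if j \<le> int s then v (nat j)
      else w (nat ((j - int s - 1) mod int N) + 1))"
  have s: "1 \<le> s" using l by (simp add: dumbbell_labelling_def)
  have "(j + int N - int s - 1) mod int N = (j - int s - 1) mod int N" for j
    by (metis add_diff_eq diff_add_eq mod_add_self2 diff_diff_eq)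
  then have c: "line (int N) c (int s)" using s N unfolding line_def c_def by auto
  have "labels N s c u v w"
    unfolding labels_def
  proof (intro conjI ballI)
    fix i assume i: "i \<in> {1..N}"
    have "(int i - 1 - int N) mod int N = (int i - 1) mod int N" by (rule minus_mod_self2)
    also have "\<dots> = int i - 1" using i by (intro mod_pos_pos_trivial) auto
    finally have "(int i - 1 - int N) mod int N = int i - 1" .
    then show "u i = c (int i - 1 - int N)" using i by (auto simp: c_def nat_diff_distrib)
    have "(int i - 1) mod int N = int i - 1" using i by (auto intro: mod_pos_pos_trivial)
    then show "w i = c (int s + int i)" using i by (auto simp: c_def nat_diff_distrib)
  qed (auto simp: c_def)
  then show "\<exists>c s. dumbbell_line (int N) D c s" using labelling_iff_line c N l by blast
next
  assume "\<exists>c s. dumbbell_line (int N) D c s"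
  then obtain c s where l: "dumbbell_line (int N) D c s" by blast
  then have c: "line (int N) c (int (nat s))" "int (nat s) = s" by (auto simp: dumbbell_line_def line_def)
  have "labels N (nat s) c (\<lambda>i. c (int i - 1 - int N)) (\<lambda>i. c (int i)) (\<lambda>i. c (int (nat s) + int i))"
    by (simp add: labels_def)
  then show "balanced_dumbbell N D"
    using labelling_iff_line [OF _ c(1) N] l c(2) unfolding balanced_dumbbell_def dumbbell_def by metis
qed

section \<open>Loops\<close>

definition moves :: "(cantor \<Rightarrow> cantor) \<Rightarrow> cantor set set \<Rightarrow> (cantor set \<times> cantor set) set" where
  "moves h P = {(a, b). a \<in> P \<and> b \<in> P \<and> h ` a \<inter> b \<noteq> {}}"

text \<open>
  An invariant set in the left plate amounts to a left loop: it is the union of the images of its part in \<open>u\<^sub>1\<close>,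
  which returns to itself after one round.  The formulation by invariance is independent of a labelling.
\<close>

definition left_loop :: "(cantor \<Rightarrow> cantor) \<Rightarrow> (int \<Rightarrow> cantor set) \<Rightarrow> bool" where
  "left_loop h c \<longleftrightarrow> (\<exists>A. A \<noteq> {} \<and> clopen A \<and> h ` A = A \<and> A \<subseteq> (\<Union>j\<in>{..0}. c j))"

definition right_loop :: "(cantor \<Rightarrow> cantor) \<Rightarrow> (int \<Rightarrow> cantor set) \<Rightarrow> int \<Rightarrow> bool" where
  "right_loop h c s \<longleftrightarrow> (\<exists>A. A \<noteq> {} \<and> clopen A \<and> h ` A = A \<and> A \<subseteq> (\<Union>j\<in>{s<..}. c j))"

lemma movesI: "a \<in> P \<Longrightarrow> b \<in> P \<Longrightarrow> x \<in> a \<Longrightarrow> h x \<in> b \<Longrightarrow> (a, b) \<in> moves h P"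
  by (auto simp: moves_def)

lemma movesE:
  assumes "(a, b) \<in> moves h P"
  obtains x where "a \<in> P" "b \<in> P" "x \<in> a" "h x \<in> b"
  using assms by (auto simp: moves_def)

lemma Gr_eq: "Gr h P = \<lparr>pverts = P, parcs = moves h P\<rparr>"
  by (simp add: Gr_def moves_def)

lemma clopen_funpow_image: "h \<in> homeos \<Longrightarrow> clopen a \<Longrightarrow> clopen ((h ^^ n) ` a)"
proof (induction n)
  case (Suc n)
  have "clopen (h ` (h ^^ n) ` a)" by (rule clopen_image [OF Suc.prems(1) Suc.IH [OF Suc.prems]])
  then show ?case by (simp add: image_comp)
qed simp

lemma image_orbit_union:
  assumes "1 \<le> r" "(h ^^ r) ` a = a"
  shows "h ` (\<Union>i<r. (h ^^ i) ` a) = (\<Union>i<r. (h ^^ i) ` a)"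
proof -
  have "h ` (\<Union>i<r. (h ^^ i) ` a) = (\<Union>i<r. (h ^^ Suc i) ` a)"
    by (simp add: image_UN image_comp)
  also have "\<dots> = (\<Union>i\<in>Suc ` {..<r}. (h ^^ i) ` a)" by (simp only: UN_simps)
  also have "Suc ` {..<r} = insert r ({..<r} - {0})"
    unfolding image_Suc_lessThan using assms(1) by auto
  also have "(\<Union>i\<in>insert r ({..<r} - {0}). (h ^^ i) ` a) = (\<Union>i\<in>insert 0 ({..<r} - {0}). (h ^^ i) ` a)"
    unfolding UN_insert assms(2) by simp
  also have "insert 0 ({..<r} - {0}) = {..<r}" using assms(1) by auto
  finally show ?thesis .
qed

lemma labelling_facts:
  assumes l: "dumbbell_labelling D r s t u v w"
  shows "1 \<le> r" "1 \<le> s" "1 \<le> t" "r = 1 \<Longrightarrow> (u 1, u 1) \<in> parcs D" "1 < r \<Longrightarrow> (u 1, u 2) \<in> parcs D"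
    "(u 1, v 1) \<in> parcs D" "(v s, w 1) \<in> parcs D" "(w t, w 1) \<in> parcs D"
    "i \<in> {1..r} \<Longrightarrow> j \<in> {1..s} \<Longrightarrow> u i \<noteq> v j" "i \<in> {1..t} \<Longrightarrow> j \<in> {1..s} \<Longrightarrow> w i \<noteq> v j"
proof -
  note l = l [unfolded dumbbell_labelling_def]
  have arcs: "parcs D =
       {(u i, u (i + 1)) | i. 1 \<le> i \<and> i < r} \<union> {(u r, u 1)} \<union>
       {(w i, w (i + 1)) | i. 1 \<le> i \<and> i < t} \<union> {(w t, w 1)} \<union>
       {(v i, v (i + 1)) | i. 1 \<le> i \<and> i < s} \<union>
       {(u 1, v 1), (v s, w 1)}"
    using l by (elim conjE)
  show "r = 1 \<Longrightarrow> (u 1, u 1) \<in> parcs D" "(u 1, v 1) \<in> parcs D" "(v s, w 1) \<in> parcs D" "(w t, w 1) \<in> parcs D"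
    unfolding arcs by simp_all
  have "(u 1, u (1 + 1)) \<in> parcs D" if "1 < r" unfolding arcs using that by blast
  moreover have "1 + 1 = (2::nat)" by simp
  ultimately show "1 < r \<Longrightarrow> (u 1, u 2) \<in> parcs D" by metis
  have "u ` {1..r} \<inter> v ` {1..s} = {}" using l by (elim conjE)
  moreover have "v ` {1..s} \<inter> w ` {1..t} = {}" using l by (elim conjE)
  ultimately show "i \<in> {1..r} \<Longrightarrow> j \<in> {1..s} \<Longrightarrow> u i \<noteq> v j" "i \<in> {1..t} \<Longrightarrow> j \<in> {1..s} \<Longrightarrow> w i \<noteq> v j"
    by (metis IntI empty_iff imageI)+
  show "1 \<le> r" using l by (elim conjE)
  show "1 \<le> s" using l by (elim conjE)
  show "1 \<le> t" using l by (elim conjE)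
qed

lemma contains_left_loopI:
  "dumbbell_labelling D r s t u v w \<Longrightarrow> a \<noteq> {} \<Longrightarrow> clopen a \<Longrightarrow> a \<subseteq> u 1 \<Longrightarrow> (h ^^ r) ` a = a \<Longrightarrow>
     contains_left_loop h D"
  unfolding contains_left_loop_def by (intro exI conjI)

lemma contains_right_loopI:
  "dumbbell_labelling D r s t u v w \<Longrightarrow> a \<noteq> {} \<Longrightarrow> clopen a \<Longrightarrow> a \<subseteq> w 1 \<Longrightarrow> (h ^^ t) ` a = a \<Longrightarrow>
     contains_right_loop h D"
  unfolding contains_right_loop_def by (intro exI conjI)

lemma cells_same_place:
  assumes P: "clopen_partition P" and D: "dumbbells P E N I" and c: "(c, s) \<in> I"
    and x: "x \<in> c j" "x \<in> c i"
  shows "same_place N s j i"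
  using partition_cell_eq [OF P, of "c j" "c i" x] dumbbells_D(3,5) [OF D] c x by blast

context
  fixes h P N I c s
  assumes h: "h \<in> homeos" and P: "clopen_partition P" and D: "dumbbells P (moves h P) N I"
    and c: "(c, s) \<in> I"
begin

text \<open>
  Points follow lines backwards up to the end of the bar, since \<open>c j\<close> has a single predecessor for \<open>j \<le> s\<close>; in the
  same way they follow lines forwards from the beginning of the bar.
\<close>

lemma point_back: assumes "h x \<in> c j" "j \<le> s" shows "x \<in> c (j - 1)"
proof -
  obtain b where b: "b \<in> P" "x \<in> b" using partition_cell [OF P] by blast
  then have "(b, c j) \<in> moves h P" using assms dumbbells_D(3) [OF D c] by (blast intro: movesI)
  then show ?thesis using dumbbells_pred_unique [OF D c] assms b by blast
qed

lemma point_forth: assumes "x \<in> c j" "1 \<le> j" shows "h x \<in> c (j + 1)"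
proof -
  obtain b where b: "b \<in> P" "h x \<in> b" using partition_cell [OF P] by blast
  then have "(c j, b) \<in> moves h P" using assms dumbbells_D(3) [OF D c] by (blast intro: movesI)
  then show ?thesis using dumbbells_succ_unique [OF D c] assms b by blast
qed

lemma funpow_back: "(h ^^ i) x \<in> c j \<Longrightarrow> j \<le> s \<Longrightarrow> x \<in> c (j - int i)"
proof (induction i arbitrary: j)
  case (Suc i)
  then have "(h ^^ i) x \<in> c (j - 1)" using point_back by simp
  then have "x \<in> c (j - 1 - int i)" using Suc.IH Suc.prems(2) by simp
  moreover have "j - 1 - int i = j - int (Suc i)" by simp
  ultimately show ?case by metis
qed simp

lemma funpow_forth: "x \<in> c j \<Longrightarrow> 1 \<le> j \<Longrightarrow> (h ^^ i) x \<in> c (j + int i)"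
proof (induction i)
  case (Suc i)
  then have "h ((h ^^ i) x) \<in> c (j + int i + 1)" by (intro point_forth) auto
  moreover have "j + int i + 1 = j + int (Suc i)" by simp
  ultimately show ?case by (metis comp_apply funpow.simps(2))
qed simp

lemma left_invariant_step:
  assumes A: "h ` A = A" "A \<subseteq> (\<Union>j\<in>{..0}. c j)" and j: "j \<le> 0"
  shows "h ` (A \<inter> c (j - 1)) = A \<inter> c j"
proof (intro equalityI subsetI)
  have s: "1 \<le> s" using dumbbells_D(2) [OF D c] by (simp add: line_def)
  fix y assume "y \<in> h ` (A \<inter> c (j - 1))"
  then obtain x where x: "x \<in> A" "x \<in> c (j - 1)" "y = h x" by blast
  then have y: "y \<in> A" using A(1) by blast
  then obtain i where i: "i \<le> 0" "y \<in> c i" using A(2) by blast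
  then have "x \<in> c (i - 1)" using point_back x s by simp
  then have "same_place N s (i - 1) (j - 1)" using cells_same_place [OF P D c] x by blast
  then have "same_place N s i j" using i(1) j s by (auto simp: same_place_def)
  then have "c i = c j" using same_place_imp_eq dumbbells_D(1,2) [OF D] c by blast
  then show "y \<in> A \<inter> c j" using i y by simp
next
  have s: "1 \<le> s" using dumbbells_D(2) [OF D c] by (simp add: line_def)
  fix y assume y: "y \<in> A \<inter> c j"
  then obtain x where "x \<in> A" "y = h x" using A(1) by blast
  then show "y \<in> h ` (A \<inter> c (j - 1))" using point_back [of x j] y j s by auto
qed

lemma left_invariant_steps:
  assumes A: "h ` A = A" "A \<subseteq> (\<Union>j\<in>{..0}. c j)" and j: "j \<le> 0"
  shows "(h ^^ k) ` (A \<inter> c (j - int k)) = A \<inter> c j"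
  using j
proof (induction k arbitrary: j)
  case (Suc k)
  have "(h ^^ Suc k) ` (A \<inter> c (j - int (Suc k))) = h ` (h ^^ k) ` (A \<inter> c (j - 1 - int k))"
    by (simp add: image_comp algebra_simps)
  then show ?case using Suc.IH [of "j - 1"] Suc.prems left_invariant_step [OF A Suc.prems] by simp
qed simp

lemma right_invariant_step:
  assumes A: "h ` A = A" "A \<subseteq> (\<Union>j\<in>{s<..}. c j)" and j: "s < j"
  shows "h ` (A \<inter> c j) = A \<inter> c (j + 1)"
proof (intro equalityI subsetI)
  have s: "1 \<le> s" using dumbbells_D(2) [OF D c] by (simp add: line_def)
  fix y assume "y \<in> h ` (A \<inter> c j)"
  then obtain x where x: "x \<in> A" "x \<in> c j" "y = h x" by blast
  then have "y \<in> A" "y \<in> c (j + 1)" using A(1) point_forth j s by auto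
  then show "y \<in> A \<inter> c (j + 1)" by simp
next
  have s: "1 \<le> s" using dumbbells_D(2) [OF D c] by (simp add: line_def)
  fix y assume y: "y \<in> A \<inter> c (j + 1)"
  then obtain x where x: "x \<in> A" "y = h x" using A(1) by blast
  then obtain i where i: "s < i" "x \<in> c i" using A(2) by blast
  then have "y \<in> c (i + 1)" using point_forth x s by simp
  then have "same_place N s (i + 1) (j + 1)" using cells_same_place [OF P D c] y by blast
  then have "same_place N s i j" using i(1) j s by (auto simp: same_place_def)
  then have "c i = c j" using same_place_imp_eq dumbbells_D(1,2) [OF D] c by blast
  then show "y \<in> h ` (A \<inter> c j)" using i x by auto
qed

lemma right_invariant_steps:
  assumes A: "h ` A = A" "A \<subseteq> (\<Union>j\<in>{s<..}. c j)" and j: "s < j"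
  shows "(h ^^ k) ` (A \<inter> c j) = A \<inter> c (j + int k)"
proof (induction k)
  case (Suc k)
  have "(h ^^ Suc k) ` (A \<inter> c j) = h ` (h ^^ k) ` (A \<inter> c j)" by (simp add: image_comp)
  also have "\<dots> = h ` (A \<inter> c (j + int k))" by (simp only: Suc.IH)
  also have "\<dots> = A \<inter> c (j + int k + 1)" using right_invariant_step [OF A, of "j + int k"] j by simp
  finally show ?case by (simp add: add_ac)
qed simp

text \<open>
  In every labelling \<open>u\<^sub>1\<close> is the vertex with two successors, so that a loop given with any labelling lies in the
  left plate of the line.  Its orbit remains there, because no edge enters the left plate from outside.
\<close>

lemma left_loop_iff:
  assumes n: "N = int n" and L: "dumbbell_line N G c s"
  shows "contains_left_loop h G \<longleftrightarrow> left_loop h c"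
proof
  have N: "1 \<le> N" and ln: "line N c s" using dumbbells_D(1,2) [OF D] c by auto
  have s: "1 \<le> s" using ln by (simp add: line_def)
  {
    assume "contains_left_loop h G"
    then obtain r s' t u v w a where l: "dumbbell_labelling G r s' t u v w"
      and a: "a \<noteq> {}" "clopen a" "a \<subseteq> u 1" "(h ^^ r) ` a = a"
      unfolding contains_left_loop_def by (elim exE conjE) (rule that)
    note lf = labelling_facts [OF l]
    define z where "z = (if r = 1 then u 1 else u 2)"
    have r: "1 \<le> r" "1 \<le> s'" using lf by blast+
    have z: "(u 1, z) \<in> parcs G" "z \<noteq> v 1"
      using lf(4,5) lf(9) [of 1 1] lf(9) [of 2 1] r unfolding z_def by auto
    have arcs: "parcs G = range (\<lambda>j. (c j, c (j + 1)))" using L by (simp add: dumbbell_line_def)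
    obtain i where i: "(u 1, z) = (c i, c (i + 1))" using z(1) unfolding arcs by blast
    obtain j where j: "(u 1, v 1) = (c j, c (j + 1))" using lf(6) unfolding arcs by blast
    have ij: "u 1 = c i" "u 1 = c j" "c (i + 1) \<noteq> c (j + 1)" using i j z(2) by auto
    then have "same_place N s i j" using L by (simp add: dumbbell_line_def)
    moreover have "\<not> same_place N s (i + 1) (j + 1)" using same_place_imp_eq [OF ln N] ij(3) by blast
    ultimately have "i \<le> 0" using s by (auto simp: same_place_def)
    then have a0: "a \<subseteq> (\<Union>j\<in>{..0}. c j)" using a(3) ij(1) by auto
    define A where "A = (\<Union>i<r. (h ^^ i) ` a)"
    have "A \<subseteq> (\<Union>j\<in>{..0}. c j)"
    proof
      fix x assume "x \<in> A"
      then obtain i y where i: "i < r" "y \<in> a" "x = (h ^^ i) y" by (auto simp: A_def)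
      then have "(h ^^ (r - i)) x = (h ^^ r) y" by (simp add: funpow_add [THEN fun_cong, unfolded comp_apply, symmetric])
      then have "(h ^^ (r - i)) x \<in> a" using i(2) a(4) by auto
      then obtain j where "j \<le> 0" "(h ^^ (r - i)) x \<in> c j" using a0 by blast
      then have "x \<in> c (j - int (r - i))" using funpow_back s by simp
      then show "x \<in> (\<Union>j\<in>{..0}. c j)" using \<open>j \<le> 0\<close> by (intro UN_I [of "j - int (r - i)"]) auto
    qed
    moreover have "h ` A = A" unfolding A_def by (rule image_orbit_union [OF r(1) a(4)])
    moreover have "clopen A" unfolding A_def by (intro clopen_UN clopen_funpow_image h a) auto
    moreover have "(h ^^ 0) ` a \<subseteq> A" unfolding A_def using r(1) by (intro UN_upper) auto
    then have "A \<noteq> {}" using a(1) by auto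
    ultimately show "left_loop h c" unfolding left_loop_def by blast
  }
  assume "left_loop h c"
  then obtain A where A: "A \<noteq> {}" "clopen A" "h ` A = A" "A \<subseteq> (\<Union>j\<in>{..0}. c j)"
    by (auto simp: left_loop_def)
  have c0: "c (- int n) = c 0" using ln n unfolding line_def by (metis diff_0 order_refl)
  have "labels n (nat s) c (\<lambda>i. c (int i - 1 - int n)) (\<lambda>i. c (int i)) (\<lambda>i. c (int (nat s) + int i))"
    by (simp add: labels_def)
  then have "dumbbell_labelling G n (nat s) n (\<lambda>i. c (int i - 1 - int n)) (\<lambda>i. c (int i))
      (\<lambda>i. c (int (nat s) + int i))"
    using labelling_iff_line [of n "nat s" c] L ln n s N by auto
  moreover obtain j where j: "j \<le> 0" "A \<inter> c j \<noteq> {}" using A(1,4) by blast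
  have "(h ^^ nat (- j)) ` (A \<inter> c (0 - int (nat (- j)))) = A \<inter> c 0"
    using left_invariant_steps [OF A(3,4)] by blast
  then have "A \<inter> c 0 \<noteq> {}" using j by auto
  moreover have "(h ^^ n) ` (A \<inter> c (0 - int n)) = A \<inter> c 0"
    using left_invariant_steps [OF A(3,4)] by blast
  moreover have "clopen (A \<inter> c 0)"
    using A(2) partition_clopen [OF P] dumbbells_D(3) [OF D c] by blast
  ultimately show "contains_left_loop h G"
    using c0 by (intro contains_left_loopI [where a = "A \<inter> c 0"]) auto
qed

text \<open>
  The mirror image: \<open>w\<^sub>1\<close> is the vertex with two predecessors, and no edge leaves the right plate.
\<close>

lemma right_loop_iff:
  assumes n: "N = int n" and L: "dumbbell_line N G c s"
  shows "contains_right_loop h G \<longleftrightarrow> right_loop h c s"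
proof
  have N: "1 \<le> N" and ln: "line N c s" using dumbbells_D(1,2) [OF D] c by auto
  have s: "1 \<le> s" using ln by (simp add: line_def)
  {
    assume "contains_right_loop h G"
    then obtain r s' t u v w a where l: "dumbbell_labelling G r s' t u v w"
      and a: "a \<noteq> {}" "clopen a" "a \<subseteq> w 1" "(h ^^ t) ` a = a"
      unfolding contains_right_loop_def by (elim exE conjE) (rule that)
    note lf = labelling_facts [OF l]
    have r: "1 \<le> t" "1 \<le> s'" using lf by blast+
    have arcs: "parcs G = range (\<lambda>j. (c j, c (j + 1)))" using L by (simp add: dumbbell_line_def)
    obtain i where i: "(w t, w 1) = (c i, c (i + 1))" using lf(8) unfolding arcs by blast
    obtain j where j: "(v s', w 1) = (c j, c (j + 1))" using lf(7) unfolding arcs by blast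
    have ij: "w 1 = c (i + 1)" "w 1 = c (j + 1)" "c i \<noteq> c j" using i j lf(10) [of t s'] r by auto
    then have "same_place N s (i + 1) (j + 1)" using L by (simp add: dumbbell_line_def)
    moreover have "\<not> same_place N s i j" using same_place_imp_eq [OF ln N] ij(3) by blast
    ultimately have "s < i + 1" using s by (auto simp: same_place_def)
    then have a0: "a \<subseteq> (\<Union>j\<in>{s<..}. c j)" using a(3) ij(1) by (metis UN_upper greaterThan_iff order_trans)
    define A where "A = (\<Union>i<t. (h ^^ i) ` a)"
    have "A \<subseteq> (\<Union>j\<in>{s<..}. c j)"
    proof
      fix x assume "x \<in> A"
      then obtain i y where i: "i < t" "y \<in> a" "x = (h ^^ i) y" by (auto simp: A_def)
      then obtain j where j: "s < j" "y \<in> c j" using a0 by blast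
      then have "x \<in> c (j + int i)" using funpow_forth s i(3) by simp
      then show "x \<in> (\<Union>j\<in>{s<..}. c j)" using j(1) by (intro UN_I [of "j + int i"]) auto
    qed
    moreover have "h ` A = A" unfolding A_def by (rule image_orbit_union [OF r(1) a(4)])
    moreover have "clopen A" unfolding A_def by (intro clopen_UN clopen_funpow_image h a) auto
    moreover have "(h ^^ 0) ` a \<subseteq> A" unfolding A_def using r(1) by (intro UN_upper) auto
    then have "A \<noteq> {}" using a(1) by auto
    ultimately show "right_loop h c s" unfolding right_loop_def by blast
  }
  assume "right_loop h c s"
  then obtain A where A: "A \<noteq> {}" "clopen A" "h ` A = A" "A \<subseteq> (\<Union>j\<in>{s<..}. c j)"
    by (auto simp: right_loop_def)
  have cs: "c (s + 1 + int n) = c (s + 1)" using ln n unfolding line_def by (metis less_add_one)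
  have "labels n (nat s) c (\<lambda>i. c (int i - 1 - int n)) (\<lambda>i. c (int i)) (\<lambda>i. c (int (nat s) + int i))"
    by (simp add: labels_def)
  then have "dumbbell_labelling G n (nat s) n (\<lambda>i. c (int i - 1 - int n)) (\<lambda>i. c (int i))
      (\<lambda>i. c (int (nat s) + int i))"
    using labelling_iff_line [of n "nat s" c] L ln n s N by auto
  moreover obtain j where j: "s < j" "A \<inter> c j \<noteq> {}" using A(1,4) by blast
  \<comment> \<open>Enough steps forward to arrive at a position congruent to \<open>s + 1\<close>.\<close>
  have "(h ^^ nat (s + 1 + N * j - j)) ` (A \<inter> c j) = A \<inter> c (j + int (nat (s + 1 + N * j - j)))"
    using right_invariant_steps [OF A(3,4) j(1)] by blast
  then have ne: "A \<inter> c (j + int (nat (s + 1 + N * j - j))) \<noteq> {}" using j by auto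
  have "1 * j \<le> N * j" using N j(1) s by (intro mult_right_mono) auto
  then have "0 \<le> s + 1 + N * j - j" "0 \<le> j" using s j(1) by linarith+
  then have "j + int (nat (s + 1 + N * j - j)) = s + 1 + N * int (nat j)"
    by simp
  then have "A \<inter> c (s + 1) \<noteq> {}" using ne line_right_mult [OF ln _ N, of "s + 1" "nat j"] by simp
  moreover have "(h ^^ n) ` (A \<inter> c (s + 1)) = A \<inter> c (s + 1 + int n)"
    using right_invariant_steps [OF A(3,4)] by simp
  moreover have "clopen (A \<inter> c (s + 1))"
    using A(2) partition_clopen [OF P] dumbbells_D(3) [OF D c] by blast
  ultimately show "contains_right_loop h G"
    using cs s by (intro contains_right_loopI [where a = "A \<inter> c (s + 1)"]) auto
qed

end

definition looped :: "(cantor \<Rightarrow> cantor) \<Rightarrow> cantor set set \<Rightarrow> int \<Rightarrow> ((int \<Rightarrow> cantor set) \<times> int) set \<Rightarrow> bool" where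
  "looped h P N I \<longleftrightarrow> clopen_partition P \<and> dumbbells P (moves h P) N I \<and>
     (\<forall>(c, s)\<in>I. left_loop h c \<and> right_loop h c s)"

lemma looped_iff_components:
  assumes h: "h \<in> homeos" and P: "clopen_partition P" and n: "1 \<le> n"
  shows "(\<forall>D. component D (Gr h P) \<longrightarrow>
      balanced_dumbbell n D \<and> contains_left_loop h D \<and> contains_right_loop h D) \<longleftrightarrow>
    (\<exists>I. looped h P (int n) I)"
proof
  assume *: "\<forall>D. component D (Gr h P) \<longrightarrow>
      balanced_dumbbell n D \<and> contains_left_loop h D \<and> contains_right_loop h D"
  have "1 \<le> int n" "moves h P \<subseteq> P \<times> P" using n by (auto simp: moves_def)
  then obtain I where I: "dumbbells P (moves h P) (int n) I"
    "\<And>c s. (c, s) \<in> I \<Longrightarrow> \<exists>D. component D (Gr h P) \<and> dumbbell_line (int n) D c s"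
    using dumbbells_if_components [of "int n" "moves h P" P] * balanced_dumbbell_iff_line [OF n]
    unfolding Gr_eq by metis
  have "left_loop h c \<and> right_loop h c s" if c: "(c, s) \<in> I" for c s
    using left_loop_iff [OF h P I(1) c refl] right_loop_iff [OF h P I(1) c refl] I(2) [OF c] * by blast
  then show "\<exists>I. looped h P (int n) I" using I(1) P by (auto simp: looped_def)
next
  assume "\<exists>I. looped h P (int n) I"
  then obtain I where I: "dumbbells P (moves h P) (int n) I"
    and loops: "\<And>c s. (c, s) \<in> I \<Longrightarrow> left_loop h c \<and> right_loop h c s" by (auto simp: looped_def)
  show "\<forall>D. component D (Gr h P) \<longrightarrow>
      balanced_dumbbell n D \<and> contains_left_loop h D \<and> contains_right_loop h D"
  proof (intro allI impI)
    fix D assume "component D (Gr h P)"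
    then obtain c s where c: "(c, s) \<in> I" "dumbbell_line (int n) D c s"
      using dumbbells_component [OF I] unfolding Gr_eq by metis
    then show "balanced_dumbbell n D \<and> contains_left_loop h D \<and> contains_right_loop h D"
      using left_loop_iff [OF h P I c(1) refl c(2)] right_loop_iff [OF h P I c(1) refl c(2)]
        loops [OF c(1)] balanced_dumbbell_iff_line [OF n] by blast
  qed
qed

section \<open>Open conditions\<close>

text \<open>
  The condition on \<open>h\<close> that the definition of \<open>S\<close> imposes for one value of \<open>m\<close>.
\<close>

definition looped_at :: "nat \<Rightarrow> (cantor \<Rightarrow> cantor) \<Rightarrow> bool" where
  "looped_at m h \<longleftrightarrow> (\<exists>P q I. resolves m P \<and> 1 \<le> q \<and> m dvd q \<and> looped h P (fact q) I)"

lemma loopedD: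
  assumes "looped h P N I"
  shows "clopen_partition P" "dumbbells P (moves h P) N I"
    "(c, s) \<in> I \<Longrightarrow> left_loop h c" "(c, s) \<in> I \<Longrightarrow> right_loop h c s"
  using assms by (auto simp: looped_def)

lemma dumbbells_finite:
  assumes D: "dumbbells V E N I" and V: "finite V"
  shows "finite I"
proof -
  have "inj_on (\<lambda>(c, s). c 1) I"
    using dumbbells_D(5) [OF D] by (auto intro!: inj_onI)
  moreover have "(\<lambda>(c, s). c 1) ` I \<subseteq> V" using dumbbells_D(3) [OF D] by auto
  ultimately show ?thesis using V inj_on_finite by blast
qed

text \<open>
  Finitely many coordinates decide the sets \<open>h ` a\<close>.  If \<open>h' x\<close> and \<open>h x\<close> agree in these coordinates for all \<open>x\<close>, then
  \<open>h' x\<close> lies in \<open>h ` a\<close> exactly if \<open>h x\<close> does, that is, if \<open>x\<close> lies in \<open>a\<close>.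
\<close>

lemma close_homeos_same_images:
  assumes h: "h \<in> homeos" and A: "finite A" "\<And>a. a \<in> A \<Longrightarrow> clopen a"
  obtains k where "\<And>h' a. h' \<in> homeos \<Longrightarrow> (\<And>x. agree k (h x) (h' x)) \<Longrightarrow> a \<in> A \<Longrightarrow> h' ` a = h ` a"
proof -
  have "finite ((`) h ` A)" "\<And>b. b \<in> (`) h ` A \<Longrightarrow> clopen b"
    using A clopen_image h by auto
  then obtain k where k: "\<And>b. b \<in> (`) h ` A \<Longrightarrow> decides k b" using finite_clopen_decides by metis
  have "h' ` a = h ` a" if h': "h' \<in> homeos" and ag: "\<And>x. agree k (h x) (h' x)" and a: "a \<in> A" for h' a
  proof -
    have iff: "h' x \<in> h ` a \<longleftrightarrow> x \<in> a" for x
    proof -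
      have "h' x \<in> h ` a \<longleftrightarrow> h x \<in> h ` a" using k a ag unfolding decides_def by blast
      also have "\<dots> \<longleftrightarrow> x \<in> a" using homeos_bij [OF h] by (simp add: bij_is_inj inj_image_mem_iff)
      finally show ?thesis .
    qed
    have "surj h'" using homeos_bij [OF h'] by (simp add: bij_is_surj)
    then have "h ` a \<subseteq> h' ` a" using iff by (metis imageI subsetI surjD)
    then show ?thesis using iff by blast
  qed
  then show ?thesis using that by blast
qed

text \<open>
  The images of the cells and of the invariant sets that witness the loops determine everything.
\<close>

lemma looped_at_open:
  assumes h: "h \<in> homeos" and st: "looped_at m h"
  obtains k where "\<And>h'. h' \<in> homeos \<Longrightarrow> (\<And>x. agree k (h x) (h' x)) \<Longrightarrow> looped_at m h'"
proof -
  obtain P q I where q: "resolves m P" "1 \<le> q" "m dvd q" and g: "looped h P (fact q) I"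
    using st by (auto simp: looped_at_def)
  note P = loopedD(1) [OF g] and D = loopedD(2) [OF g]
  define loop where "loop h A R \<longleftrightarrow> A \<noteq> {} \<and> clopen A \<and> h ` A = A \<and> A \<subseteq> R"
    for h :: "cantor \<Rightarrow> cantor" and A R
  have "\<forall>l\<in>I. \<exists>A. loop h A (\<Union>j\<in>{..0}. fst l j)" "\<forall>l\<in>I. \<exists>B. loop h B (\<Union>j\<in>{snd l<..}. fst l j)"
    using loopedD(3,4) [OF g] by (auto simp: left_loop_def right_loop_def loop_def)
  then obtain A B where A: "\<And>l. l \<in> I \<Longrightarrow> loop h (A l) (\<Union>j\<in>{..0}. fst l j)"
    and B: "\<And>l. l \<in> I \<Longrightarrow> loop h (B l) (\<Union>j\<in>{snd l<..}. fst l j)"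
    by metis
  have "finite (P \<union> A ` I \<union> B ` I)"
    using partition_finite [OF P] dumbbells_finite [OF D] by simp
  moreover have "clopen a" if "a \<in> P \<union> A ` I \<union> B ` I" for a
    using that A B partition_clopen [OF P] by (auto simp: loop_def)
  ultimately obtain k where k: "\<And>h' a. h' \<in> homeos \<Longrightarrow> (\<And>x. agree k (h x) (h' x)) \<Longrightarrow>
      a \<in> P \<union> A ` I \<union> B ` I \<Longrightarrow> h' ` a = h ` a"
    using close_homeos_same_images [OF h] by metis
  have "looped_at m h'" if h': "h' \<in> homeos" "\<And>x. agree k (h x) (h' x)" for h'
  proof -
    have im: "h' ` a = h ` a" if "a \<in> P \<union> A ` I \<union> B ` I" for a using k [OF h' that] .
    have "moves h' P = moves h P" using im by (auto simp: moves_def)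
    moreover have "left_loop h' c \<and> right_loop h' c s" if c: "(c, s) \<in> I" for c s
    proof -
      have "h' ` A (c, s) = A (c, s)" "h' ` B (c, s) = B (c, s)"
        using im [of "A (c, s)"] im [of "B (c, s)"] A [OF c] B [OF c] c by (auto simp: loop_def)
      then show ?thesis
        using A [OF c] B [OF c] unfolding left_loop_def right_loop_def loop_def fst_conv snd_conv by metis
    qed
    ultimately have "looped h' P (fact q) I" using P D by (auto simp: looped_def)
    then show ?thesis using q by (auto simp: looped_at_def)
  qed
  then show ?thesis using that by blast
qed

section \<open>Realising a graph by a homeomorphism\<close>

text \<open>
  Each cell \<open>B w\<close> is cut into pieces, one for each \<open>f\<close> over \<open>w\<close>; surjectivity of \<open>src\<close> ensures that no cell is
  missed.
\<close>

lemma clopen_split_over: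
  assumes F: "finite F" and src: "src ` F = W"
    and B: "\<And>w. w \<in> W \<Longrightarrow> clopen (B w) \<and> B w \<noteq> {}" "disjoint_family_on B W"
  shows "\<exists>U. (\<forall>f\<in>F. clopen (U f) \<and> U f \<noteq> {} \<and> U f \<subseteq> B (src f)) \<and> disjoint_family_on U F \<and>
    (\<Union>f\<in>F. U f) = (\<Union>w\<in>W. B w)"
proof -
  define splits where "splits w U \<longleftrightarrow> (\<forall>f\<in>{f \<in> F. src f = w}. clopen (U f) \<and> U f \<noteq> {}) \<and>
      disjoint_family_on U {f \<in> F. src f = w} \<and> (\<Union>f\<in>{f \<in> F. src f = w}. U f) = B w" for w U
  have "\<exists>U. splits w U" if "w \<in> W" for w
    unfolding splits_def using that src F B(1) [OF that] by (intro clopen_split) auto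
  then obtain U where "\<And>w. w \<in> W \<Longrightarrow> splits w (U w)" by metis
  then have U: "(\<forall>f\<in>{f \<in> F. src f = w}. clopen (U w f) \<and> U w f \<noteq> {}) \<and>
      disjoint_family_on (U w) {f \<in> F. src f = w} \<and> (\<Union>f\<in>{f \<in> F. src f = w}. U w f) = B w"
    if "w \<in> W" for w
    using that unfolding splits_def by blast
  define V where "V = (\<lambda>f. U (src f) f)"
  have V: "clopen (V f) \<and> V f \<noteq> {} \<and> V f \<subseteq> B (src f)" if "f \<in> F" for f
  proof -
    have w: "src f \<in> W" using that src by blast
    have "clopen (U (src f) f) \<and> U (src f) f \<noteq> {}" using U [OF w] that by blast
    moreover have "U (src f) f \<subseteq> (\<Union>f'\<in>{f' \<in> F. src f' = src f}. U (src f) f')" using that by blast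
    ultimately show ?thesis using U [OF w] by (simp add: V_def)
  qed
  have "V f \<inter> V f' = {}" if "f \<in> F" "f' \<in> F" "f \<noteq> f'" for f f'
  proof (cases "src f = src f'")
    case True
    have "src f \<in> W" using that src by blast
    then have "disjoint_family_on (U (src f)) {f' \<in> F. src f' = src f}" using U by blast
    then show ?thesis using that True by (simp add: V_def disjoint_family_on_def)
  next
    case False
    have "src f \<in> W" "src f' \<in> W" using that src by auto
    then have "B (src f) \<inter> B (src f') = {}" using B(2) False by (simp add: disjoint_family_on_def)
    then show ?thesis using V that by blast
  qed
  then have "disjoint_family_on V F" by (simp add: disjoint_family_on_def)
  moreover have "(\<Union>f\<in>F. V f) = (\<Union>w\<in>W. B w)"
  proof (intro equalityI subsetI)
    fix x assume "x \<in> (\<Union>f\<in>F. V f)"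
    then show "x \<in> (\<Union>w\<in>W. B w)" using V src by blast
  next
    fix x assume "x \<in> (\<Union>w\<in>W. B w)"
    then obtain w where w: "w \<in> W" "x \<in> B w" by blast
    then have "x \<in> (\<Union>f\<in>{f \<in> F. src f = w}. U w f)" using U by blast
    then show "x \<in> (\<Union>f\<in>F. V f)" by (auto simp: V_def)
  qed
  ultimately show ?thesis using V by blast
qed

lemma disjoint_family_on_case_sum:
  assumes "disjoint_family_on f A" "disjoint_family_on g B"
    and "\<And>x y. x \<in> A \<Longrightarrow> y \<in> B \<Longrightarrow> f x \<inter> g y = {}"
  shows "disjoint_family_on (case_sum f g) (A <+> B)"
proof -
  have "g y \<inter> f x = {}" if "x \<in> A" "y \<in> B" for x y using assms(3) [OF that] by (simp add: Int_commute)
  then have "case_sum f g u \<inter> case_sum f g v = {}" if uv: "u \<in> A <+> B" "v \<in> A <+> B" "u \<noteq> v" for u v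
    using uv(1,2) by (elim PlusE) (use assms uv(3) in \<open>simp_all add: disjoint_family_on_def\<close>)
  then show ?thesis by (simp add: disjoint_family_on_def)
qed

text \<open>
  A finite graph with vertices \<open>W\<close>, edges \<open>F\<close> and without sources and sinks is the graph of a homeomorphism on any
  partition indexed by \<open>W\<close>.  Each cell is cut twice, once according to the outgoing and once according to the
  incoming edges; the two pieces that belong to the same edge are matched.  Before this, a clopen part \<open>A z\<close> of
  each cell with index in \<open>Z\<close> is set aside.  These parts are permuted along \<open>\<pi>\<close>, which later yields the loops.
\<close>

lemma realize_graph:
  assumes W: "finite W" and C: "\<And>w. w \<in> W \<Longrightarrow> clopen (C w) \<and> C w \<noteq> {}" "disjoint_family_on C W"
      "(\<Union>w\<in>W. C w) = UNIV"
    and F: "finite F" "src ` F = W" "tgt ` F = W"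
    and Z: "Z \<subseteq> W" "bij_betw \<pi> Z Z"
  obtains h A where "h \<in> homeos"
    "\<And>f. f \<in> F \<Longrightarrow> \<exists>x\<in>C (src f). h x \<in> C (tgt f)"
    "\<And>x. (\<exists>f\<in>F. x \<in> C (src f) \<and> h x \<in> C (tgt f)) \<or> (\<exists>z\<in>Z. x \<in> C z \<and> h x \<in> C (\<pi> z))"
    "\<And>z. z \<in> Z \<Longrightarrow> clopen (A z) \<and> A z \<noteq> {} \<and> A z \<subseteq> C z \<and> h ` A z = A (\<pi> z)"
proof -
  have "\<exists>A B. clopen A \<and> clopen B \<and> A \<noteq> {} \<and> B \<noteq> {} \<and> A \<union> B = C w \<and> A \<inter> B = {}" if "w \<in> W" for w
    using clopen_halves [of "C w"] C(1) [OF that] by metis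
  then obtain A B' where AB: "\<And>w. w \<in> W \<Longrightarrow> clopen (A w) \<and> clopen (B' w) \<and> A w \<noteq> {} \<and> B' w \<noteq> {} \<and>
      A w \<union> B' w = C w \<and> A w \<inter> B' w = {}"
    by metis
  \<comment> \<open>What remains of each cell is divided among the edges.\<close>
  define B where "B = (\<lambda>w. if w \<in> Z then B' w else C w)"
  have B: "clopen (B w) \<and> B w \<noteq> {}" "B w \<subseteq> C w" "w \<in> Z \<Longrightarrow> B w \<inter> A w = {}"
    "w \<in> Z \<Longrightarrow> B w \<union> A w = C w" "w \<notin> Z \<Longrightarrow> B w = C w" if "w \<in> W" for w
    using AB [OF that] C(1) [OF that] by (auto simp: B_def)
  have Cdis: "w = w'" if "x \<in> C w" "x \<in> C w'" "w \<in> W" "w' \<in> W" for x w w'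
    using C(2) that by (auto simp: disjoint_family_on_def)
  have Bdis: "disjoint_family_on B W"
    using B(2) C(2) unfolding disjoint_family_on_def by blast
  have "\<exists>U. (\<forall>f\<in>F. clopen (U f) \<and> U f \<noteq> {} \<and> U f \<subseteq> B (src f)) \<and> disjoint_family_on U F \<and>
    (\<Union>f\<in>F. U f) = (\<Union>w\<in>W. B w)"
    by (rule clopen_split_over [OF F(1,2) _ Bdis]) (rule B(1))
  then obtain U where UF: "\<forall>f\<in>F. clopen (U f) \<and> U f \<noteq> {} \<and> U f \<subseteq> B (src f)"
    and U': "disjoint_family_on U F" "(\<Union>f\<in>F. U f) = (\<Union>w\<in>W. B w)"
    by (elim exE conjE) (rule that)
  note U = bspec [OF UF] U'
  have "\<exists>V. (\<forall>f\<in>F. clopen (V f) \<and> V f \<noteq> {} \<and> V f \<subseteq> B (tgt f)) \<and> disjoint_family_on V F \<and>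
    (\<Union>f\<in>F. V f) = (\<Union>w\<in>W. B w)"
    by (rule clopen_split_over [OF F(1,3) _ Bdis]) (rule B(1))
  then obtain V where VF: "\<forall>f\<in>F. clopen (V f) \<and> V f \<noteq> {} \<and> V f \<subseteq> B (tgt f)"
    and V': "disjoint_family_on V F" "(\<Union>f\<in>F. V f) = (\<Union>w\<in>W. B w)"
    by (elim exE conjE) (rule that)
  note V = bspec [OF VF] V'
  have srcW: "src f \<in> W" "tgt f \<in> W" if "f \<in> F" for f using F(2,3) that by auto
  have \<pi>Z: "\<pi> z \<in> Z" if "z \<in> Z" for z using Z(2) that by (auto simp: bij_betw_def)
  define U' where "U' = case_sum U A"
  define V' where "V' = case_sum V (\<lambda>z. A (\<pi> z))"
  have cover: "(\<Union>w\<in>W. B w) \<union> (\<Union>z\<in>Z. A z) = UNIV"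
  proof -
    have "x \<in> (\<Union>w\<in>W. B w) \<union> (\<Union>z\<in>Z. A z)" for x
    proof -
      obtain w where w: "w \<in> W" "x \<in> C w" using C(3) by blast
      show ?thesis
      proof (cases "w \<in> Z")
        case True
        then have "x \<in> B w \<union> A w" using B(4) w by simp
        then show ?thesis using w True by blast
      next
        case False
        then have "x \<in> B w" using B(5) w by simp
        then show ?thesis using w by blast
      qed
    qed
    then show ?thesis by blast
  qed
  have UA: "U f \<inter> A z = {}" "V f \<inter> A z = {}" if "f \<in> F" "z \<in> Z" for f z
  proof -
    have "B w \<inter> A z = {}" if "w \<in> W" for w
      using Cdis [of _ z w] B(2,3) [OF that] AB [of z] \<open>z \<in> Z\<close> Z(1) that by blast
    then show "U f \<inter> A z = {}" "V f \<inter> A z = {}" using U(1) V(1) srcW that(1) by blast+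
  qed
  have Adis: "z = z'" if "x \<in> A z" "x \<in> A z'" "z \<in> Z" "z' \<in> Z" for x z z'
    using Cdis [of x z z'] AB that Z(1) by blast
  then have A\<pi>: "disjoint_family_on A Z" "disjoint_family_on (\<lambda>z. A (\<pi> z)) Z"
    using \<pi>Z Z(2) unfolding disjoint_family_on_def bij_betw_def inj_on_def by blast+
  have fin: "finite (F <+> Z)" by (simp add: F(1) finite_subset [OF Z(1) W])
  have U'1: "clopen (U' f) \<and> U' f \<noteq> {}" if "f \<in> F <+> Z" for f
    using that U(1) AB [OF subsetD [OF Z(1)]] by (cases f) (auto simp: U'_def)
  have V'1: "clopen (V' f) \<and> V' f \<noteq> {}" if "f \<in> F <+> Z" for f
    using that V(1) AB [OF subsetD [OF Z(1)]] \<pi>Z by (cases f) (auto simp: V'_def)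
  have U'2: "disjoint_family_on U' (F <+> Z)"
    unfolding U'_def by (rule disjoint_family_on_case_sum [OF U(2) A\<pi>(1) UA(1)])
  have V'2: "disjoint_family_on V' (F <+> Z)"
    unfolding V'_def by (rule disjoint_family_on_case_sum [OF V(2) A\<pi>(2) UA(2) [OF _ \<pi>Z]])
  have U'3: "(\<Union>f\<in>F <+> Z. U' f) = UNIV" using cover U(3) by (auto simp: U'_def Plus_def)
  have "(\<Union>z\<in>Z. A (\<pi> z)) = (\<Union>z\<in>\<pi> ` Z. A z)" by blast
  moreover have "\<pi> ` Z = Z" using Z(2) by (simp add: bij_betw_def)
  moreover have "(\<Union>f\<in>F <+> Z. V' f) = (\<Union>f\<in>F. V f) \<union> (\<Union>z\<in>Z. A (\<pi> z))"
    by (auto simp: V'_def Plus_def)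
  ultimately have V'3: "(\<Union>f\<in>F <+> Z. V' f) = UNIV" using cover V(3) by metis
  obtain h where h: "h \<in> homeos" "\<And>f. f \<in> F <+> Z \<Longrightarrow> h ` U' f = V' f"
    using glue_homeo [OF fin U'1 U'2 U'3 V'1 V'2 V'3] by blast
  have hF: "h ` U f = V f" if "f \<in> F" for f using h(2) [OF InlI [OF that]] by (simp add: U'_def V'_def)
  have hZ: "h ` A z = A (\<pi> z)" if "z \<in> Z" for z using h(2) [OF InrI [OF that]] by (simp add: U'_def V'_def)
  have U_C: "U f \<subseteq> C (src f)" "V f \<subseteq> C (tgt f)" if "f \<in> F" for f
    using U(1) V(1) B(2) srcW that by blast+
  have A_C: "A z \<subseteq> C z" if "z \<in> Z" for z using AB Z(1) that by blast
  show ?thesis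
  proof (rule that [OF h(1)])
    show "\<exists>x\<in>C (src f). h x \<in> C (tgt f)" if f: "f \<in> F" for f
    proof -
      obtain x where "x \<in> U f" using U(1) [OF f] by blast
      then show ?thesis using hF [OF f] U_C [OF f] by blast
    qed
    show "(\<exists>f\<in>F. x \<in> C (src f) \<and> h x \<in> C (tgt f)) \<or> (\<exists>z\<in>Z. x \<in> C z \<and> h x \<in> C (\<pi> z))" for x
    proof -
      have "x \<in> (\<Union>f\<in>F. U f) \<union> (\<Union>z\<in>Z. A z)" using cover U(3) by simp
      then consider f where "f \<in> F" "x \<in> U f" | z where "z \<in> Z" "x \<in> A z" by blast
      then show ?thesis
      proof cases
        case (1 f)
        then have "h x \<in> V f" using hF by blast
        then show ?thesis using U_C [OF 1(1)] 1 by blast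
      next
        case (2 z)
        then have "h x \<in> A (\<pi> z)" using hZ by blast
        then show ?thesis using A_C [OF 2(1)] A_C [OF \<pi>Z [OF 2(1)]] 2 by blast
      qed
    qed
    show "clopen (A z) \<and> A z \<noteq> {} \<and> A z \<subseteq> C z \<and> h ` A z = A (\<pi> z)" if "z \<in> Z" for z
      using AB [OF subsetD [OF Z(1) that]] A_C [OF that] hZ [OF that] by simp
  qed
qed

section \<open>Density\<close>

text \<open>
  By the pigeonhole principle the iterates become periodic before step \<open>card L\<close>, with a period of at most \<open>card L\<close>,
  which divides \<open>q!\<close>.
\<close>

lemma funpow_eventually_periodic:
  assumes L: "finite L" "f ` L \<subseteq> L" "l \<in> L" and q: "card L \<le> q" and i: "card L \<le> i"
  shows "(f ^^ (i + fact q)) l = (f ^^ i) l"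
proof -
  have in_L: "(f ^^ i) l \<in> L" for i by (induction i) (use L in auto)
  have "\<not> inj_on (\<lambda>i. (f ^^ i) l) {..card L}"
  proof
    assume "inj_on (\<lambda>i. (f ^^ i) l) {..card L}"
    then have "card {..card L} \<le> card L" using in_L L(1) by (intro card_inj_on_le) auto
    then show False by simp
  qed
  then obtain a b where ab: "a < b" "b \<le> card L" "(f ^^ a) l = (f ^^ b) l"
    unfolding inj_on_def by (metis atMost_iff linorder_neqE_nat)
  define p where "p = b - a"
  have per: "(f ^^ (j + p)) l = (f ^^ j) l" if "a \<le> j" for j
  proof -
    have "(f ^^ (j + p)) l = (f ^^ (j - a)) ((f ^^ b) l)"
      using that ab(1) by (simp add: p_def flip: funpow_add [THEN fun_cong, unfolded comp_apply])
    also have "\<dots> = (f ^^ (j - a)) ((f ^^ a) l)" using ab(3) by simp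
    also have "\<dots> = (f ^^ j) l" using that by (simp flip: funpow_add [THEN fun_cong, unfolded comp_apply])
    finally show ?thesis .
  qed
  have mult: "(f ^^ (i + p * k)) l = (f ^^ i) l" for k
  proof (induction k)
    case (Suc k)
    have "(f ^^ (i + p * k + p)) l = (f ^^ (i + p * k)) l" using ab i by (intro per) simp
    then show ?case using Suc by (simp add: algebra_simps)
  qed simp
  have "p dvd fact q" using ab q by (intro dvd_fact) (auto simp: p_def)
  then obtain k where "fact q = p * k" by (auto simp: dvd_def)
  then show ?thesis using mult [of k] by simp
qed

text \<open>
  The walk follows \<open>f\<close> after \<open>l\<close> and \<open>g\<close> before \<open>l\<close>; after \<open>card L\<close> steps in either direction it is periodic.  Hence
  \<open>l\<close> is placed in the middle of a bar with \<open>2 card L - 1\<close> vertices.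
\<close>

lemma walk_through:
  assumes L: "finite L" "l \<in> L" and fg: "f ` L \<subseteq> L" "g ` L \<subseteq> L"
    and R: "\<And>l. l \<in> L \<Longrightarrow> R l (f l)" "\<And>l. l \<in> L \<Longrightarrow> R (g l) l"
    and q: "card L \<le> q"
  obtains y where "line (fact q) y (2 * int (card L) - 1)" "\<And>j. R (y j) (y (j + 1))" "\<And>j. y j \<in> L"
    "y (int (card L)) = l"
proof -
  define n where "n = int (card L)"
  define x where "x = (\<lambda>j. if 0 \<le> j then (f ^^ nat j) l else (g ^^ nat (- j)) l)"
  have n: "1 \<le> n" using L by (auto simp: n_def card_gt_0_iff Suc_le_eq)
  have inf: "(f ^^ i) l \<in> L" and ing: "(g ^^ i) l \<in> L" for i by (induction i) (use L fg in auto)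
  have xL: "x j \<in> L" for j using inf ing by (simp add: x_def)
  have step: "R (x j) (x (j + 1))" for j
  proof (cases "0 \<le> j")
    case True
    then have "x (j + 1) = f (x j)" by (simp add: x_def nat_add_distrib)
    then show ?thesis using R(1) xL by simp
  next
    case False
    have "nat (- j) = Suc (nat (- (j + 1)))" using False by simp
    then have "x j = g ((g ^^ nat (- (j + 1))) l)" using False by (simp add: x_def)
    moreover have "(g ^^ nat (- (j + 1))) l = x (j + 1)" using False by (cases "j = - 1") (auto simp: x_def)
    ultimately show ?thesis using R(2) xL by simp
  qed
  have nat_fact: "nat (i + fact q) = nat i + fact q" if "0 \<le> i" for i :: int
  proof -
    have "nat (i + int k) = nat i + k" for k using that by (simp add: nat_add_distrib)
    from this [of "fact q"] show ?thesis by simp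
  qed
  define y where "y = (\<lambda>j. x (j - n))"
  have left: "y (j - fact q) = y j" if "j \<le> 0" for j
  proof -
    have "(g ^^ (nat (n - j) + fact q)) l = (g ^^ nat (n - j)) l"
      using funpow_eventually_periodic [OF L(1) fg(2) L(2) q, of "nat (n - j)"] that by (simp add: n_def)
    moreover have "nat (n - (j - fact q)) = nat (n - j) + fact q"
      using nat_fact [of "n - j"] n that by (simp add: algebra_simps)
    moreover have "y (j - fact q) = (g ^^ nat (n - (j - fact q))) l"
      using n that fact_ge_1 [of q, where 'a = int] by (simp add: y_def x_def algebra_simps del: fact_ge_1)
    moreover have "y j = (g ^^ nat (n - j)) l" using n that by (simp add: y_def x_def)
    ultimately show ?thesis by simp
  qed
  have right: "y (j + fact q) = y j" if "2 * n - 1 < j" for j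
  proof -
    have "(f ^^ (nat (j - n) + fact q)) l = (f ^^ nat (j - n)) l"
      using funpow_eventually_periodic [OF L(1) fg(1) L(2) q, of "nat (j - n)"] that by (simp add: n_def)
    moreover have "nat (j + fact q - n) = nat (j - n) + fact q"
      using nat_fact [of "j - n"] n that by (simp add: algebra_simps)
    moreover have "y (j + fact q) = (f ^^ nat (j + fact q - n)) l"
      using n that fact_ge_1 [of q, where 'a = int] by (simp add: y_def x_def del: fact_ge_1)
    moreover have "y j = (f ^^ nat (j - n)) l" using n that by (simp add: y_def x_def)
    ultimately show ?thesis by simp
  qed
  show ?thesis
  proof (rule that [of y])
    show "line (fact q) y (2 * int (card L) - 1)"
      using left right n by (simp add: line_def n_def [symmetric])
    show "R (y j) (y (j + 1))" for j using step [of "j - n"] by (simp add: y_def algebra_simps)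
    show "y j \<in> L" for j using xL by (simp add: y_def)
    show "y (int (card L)) = l" by (simp add: y_def x_def n_def)
  qed
qed

definition cylinders :: "nat \<Rightarrow> cantor set set" where
  "cylinders k = range (\<lambda>x. {y. agree k x y})"

lemma cylinders_partition: "clopen_partition (cylinders k)"
proof (rule clopen_partitionI)
  have "cylinders k \<subseteq> (\<lambda>S. {y. agree k (\<lambda>i. i \<in> S) y}) ` Pow {..<k}"
  proof
    fix a assume "a \<in> cylinders k"
    then obtain x where a: "a = {y. agree k x y}" by (auto simp: cylinders_def)
    have "agree k x y \<longleftrightarrow> agree k (\<lambda>i. i \<in> {i. i < k \<and> x i}) y" for y by (auto simp: agree_def)
    then show "a \<in> (\<lambda>S. {y. agree k (\<lambda>i. i \<in> S) y}) ` Pow {..<k}"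
      unfolding a by (intro image_eqI [of _ _ "{i. i < k \<and> x i}"]) auto
  qed
  then show "finite (cylinders k)" by (rule finite_subset) simp
  show "\<exists>a\<in>cylinders k. x \<in> a" for x unfolding cylinders_def using agree_refl by blast
  show "a = b" if ab: "a \<in> cylinders k" "b \<in> cylinders k" "x \<in> a" "x \<in> b" for a b x
  proof -
    obtain y z where yz: "a = {u. agree k y u}" "b = {u. agree k z u}" using ab(1,2) by (auto simp: cylinders_def)
    have "agree k y z" "agree k z y" using ab(3,4) yz agree_trans agree_sym by blast+
    then show ?thesis unfolding yz using agree_trans by blast
  qed
  show "clopen a \<and> a \<noteq> {}" if "a \<in> cylinders k" for a
  proof -
    obtain x where "a = {y. agree k x y}" using \<open>a \<in> cylinders k\<close> by (auto simp: cylinders_def)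
    then show ?thesis using clopen_agree agree_refl by blast
  qed
qed

lemma resolves_cylinders: "resolves k (cylinders k)"
  unfolding resolves_def cylinders_def using agree_sym agree_trans by blast

lemma moves_total:
  assumes P: "clopen_partition P" and h: "h \<in> homeos" and a: "a \<in> P"
  shows "\<exists>b. (a, b) \<in> moves h P" "\<exists>b. (b, a) \<in> moves h P"
proof -
  obtain x where x: "x \<in> a" using partition_nonempty [OF P a] by blast
  obtain b where "b \<in> P" "h x \<in> b" using partition_cell [OF P] by blast
  then show "\<exists>b. (a, b) \<in> moves h P" using x a by (blast intro: movesI)
  obtain b where "b \<in> P" "inverse_map h x \<in> b" using partition_cell [OF P] by blast
  then show "\<exists>b. (b, a) \<in> moves h P"
    using x a homeos_inv_simps(2) [OF h, of x] movesI [of b P a "inverse_map h x" h] by auto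
qed

text \<open>
  The graph to be covered by dumbbells has as its vertices the edges \<open>(a, b)\<close> of the graph of \<open>h\<close> on cylinders;
  the cell of \<open>(a, b)\<close> consists of the points of \<open>a\<close> that \<open>h\<close> takes into \<open>b\<close>.  A map \<open>h'\<close> that takes the cell of
  \<open>(a, b)\<close> into the cell of an edge starting at \<open>b\<close> has \<open>h x\<close> and \<open>h' x\<close> in the same cylinder \<open>b\<close>.
\<close>

lemma looped_at_dense:
  assumes h: "h \<in> homeos" and m: "1 \<le> m"
  obtains h' where "h' \<in> homeos" "looped_at m h'" "\<And>x. agree k (h x) (h' x)"
proof -
  define K where "K = max k m"
  define P0 where "P0 = cylinders K"
  have P0: "clopen_partition P0" "resolves K P0"
    by (simp_all add: P0_def cylinders_partition resolves_cylinders)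
  define L where "L = moves h P0"
  have "L \<subseteq> P0 \<times> P0" by (auto simp: L_def moves_def)
  then have finL: "finite L" using partition_finite [OF P0(1)] finite_subset by blast
  have LP: "fst l \<in> P0" "snd l \<in> P0" if "l \<in> L" for l using that by (auto simp: L_def moves_def)
  have "\<exists>l'\<in>L. snd l = fst l'" "\<exists>l'\<in>L. snd l' = fst l" if "l \<in> L" for l
    using moves_total [OF P0(1) h] LP [OF that] by (force simp: L_def)+
  then obtain f g where f: "\<And>l. l \<in> L \<Longrightarrow> f l \<in> L \<and> snd l = fst (f l)"
    and g: "\<And>l. l \<in> L \<Longrightarrow> g l \<in> L \<and> snd (g l) = fst l" by metis
  define n where "n = card L"
  define q where "q = m * n"
  define N :: int where "N = fact q"
  \<comment> \<open>The length of the bar of \<open>walk_through\<close>; position \<open>n\<close>, where each walk passes its vertex, is on the bar.\<close>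
  define s where "s = 2 * int n - 1"
  obtain a0 where "a0 \<in> P0" using partition_cell [OF P0(1)] by blast
  then have "L \<noteq> {}" using moves_total(1) [OF P0(1) h] by (auto simp: L_def)
  then have n: "1 \<le> n" using finL by (simp add: n_def Suc_le_eq card_gt_0_iff)
  then have q: "1 \<le> q" "n \<le> q" "m dvd q" using m by (auto simp: q_def)
  have N: "1 \<le> N" by (simp add: N_def fact_ge_1)
  have s: "1 \<le> s" "int n \<le> s" using n by (simp_all add: s_def)
  have "\<exists>y. line N y s \<and> (\<forall>j. snd (y j) = fst (y (j + 1))) \<and> (\<forall>j. y j \<in> L) \<and> y (int n) = l" if "l \<in> L" for l
  proof -
    have "f ` L \<subseteq> L" "g ` L \<subseteq> L" using f g by auto
    then show ?thesis
      using walk_through [OF finL that, of f g "\<lambda>l l'. snd l = fst l'" q] f g q(2)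
      unfolding N_def s_def n_def by metis
  qed
  then obtain Y where Y: "\<And>l. l \<in> L \<Longrightarrow> line N (Y l) s" "\<And>l j. l \<in> L \<Longrightarrow> snd (Y l j) = fst (Y l (j + 1))"
    "\<And>l j. l \<in> L \<Longrightarrow> Y l j \<in> L" "\<And>l. l \<in> L \<Longrightarrow> Y l (int n) = l"
    by metis
  define p where "p = place N s"
  have Yp: "Y l (p j) = Y l j" if "l \<in> L" for l j
    unfolding p_def by (rule same_place_imp_eq [OF Y(1) [OF that] N place_same [OF N s(1)]])
  have p_iff: "p i = p j \<longleftrightarrow> same_place N s i j" for i j unfolding p_def by (rule place_eq_iff [OF N s(1)])
  define R where "R = places N s"
  have p_id: "p j = j" if "j \<in> R" for j using place_id [OF N s(1)] that unfolding p_def R_def by blast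
  have p_side: "p j \<in> R \<and> (p j \<le> 0 \<longleftrightarrow> j \<le> 0) \<and> (s < p j \<longleftrightarrow> s < j)" for j
    unfolding p_def R_def by (rule place_side [OF N s(1)])
  have p_line: "line N p s" unfolding p_def by (rule line_place [OF N s(1)])
  have R_bounds: "- N \<le> r" "r \<le> s + N" "r \<noteq> 0" if "r \<in> R" for r
    using that N s(1) by (auto simp: R_def places_def)
  define W where "W = L \<times> R"
  have pR: "p j \<in> R" for j using p_side by blast
  have finW: "finite W" using finL by (simp add: W_def R_def places_def)
  define q_cell where "q_cell = (\<lambda>l. fst l \<inter> h -` snd l)"
  have q_cell: "clopen (q_cell l) \<and> q_cell l \<noteq> {}" if "l \<in> L" for l
    using that partition_clopen [OF P0(1)] clopen_homeo_vimage [OF h] LP [OF that]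
    by (auto simp: q_cell_def L_def moves_def)
  have q_dis: "disjoint_family_on q_cell L"
    unfolding disjoint_family_on_def
  proof (intro ballI impI)
    fix l l' assume l: "l \<in> L" "l' \<in> L" "l \<noteq> l'"
    show "q_cell l \<inter> q_cell l' = {}"
    proof (rule ccontr)
      assume "q_cell l \<inter> q_cell l' \<noteq> {}"
      then have "fst l = fst l' \<and> snd l = snd l'"
        using partition_cell_eq [OF P0(1)] LP l(1,2) unfolding q_cell_def by blast
      then show False using l(3) by (simp add: prod_eq_iff)
    qed
  qed
  have q_cover: "(\<Union>l\<in>L. q_cell l) = UNIV"
  proof -
    have "x \<in> (\<Union>l\<in>L. q_cell l)" for x
    proof -
      obtain a b where ab: "a \<in> P0" "x \<in> a" "b \<in> P0" "h x \<in> b" using partition_cell [OF P0(1)] by metis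
      then have "(a, b) \<in> L" by (auto simp: L_def intro: movesI)
      moreover have "x \<in> q_cell (a, b)" using ab by (simp add: q_cell_def)
      ultimately show ?thesis by blast
    qed
    then show ?thesis by blast
  qed
  have surj: "(\<lambda>(l, r). Y l r) ` W = L"
  proof (intro equalityI subsetI)
    fix l assume l: "l \<in> L"
    have "(l, int n) \<in> W" using l s N n by (simp add: W_def R_def places_def)
    then show "l \<in> (\<lambda>(l, r). Y l r) ` W" using Y(4) [OF l] by (auto intro!: image_eqI)
  qed (use Y(3) in \<open>auto simp: W_def\<close>)
  have "\<exists>C. (\<forall>w\<in>W. clopen (C w) \<and> C w \<noteq> {} \<and> C w \<subseteq> q_cell (case w of (l, r) \<Rightarrow> Y l r)) \<and>
      disjoint_family_on C W \<and> (\<Union>w\<in>W. C w) = (\<Union>l\<in>L. q_cell l)"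
    by (rule clopen_split_over [OF finW surj _ q_dis]) (rule q_cell)
  then obtain C where CF: "\<forall>w\<in>W. clopen (C w) \<and> C w \<noteq> {} \<and> C w \<subseteq> q_cell (case w of (l, r) \<Rightarrow> Y l r)"
    and Cdis: "disjoint_family_on C W" and "(\<Union>w\<in>W. C w) = (\<Union>l\<in>L. q_cell l)"
    by (elim exE conjE) (rule that)
  then have Ccover: "(\<Union>w\<in>W. C w) = UNIV" using q_cover by simp
  have C: "clopen (C w) \<and> C w \<noteq> {}" if "w \<in> W" for w using CF that by blast
  have Cinj: "w = w'" if "x \<in> C w" "x \<in> C w'" "w \<in> W" "w' \<in> W" for x w w'
    using Cdis that by (auto simp: disjoint_family_on_def)
  define c where "c = (\<lambda>l j. C (l, p j))"
  have pW: "(l, p j) \<in> W" if "l \<in> L" for l j using that pR by (simp add: W_def)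
  have c_q: "c l j \<subseteq> q_cell (Y l j)" if "l \<in> L" for l j
    using CF [rule_format, OF pW [OF that, of j]] Yp [OF that] by (simp add: c_def)
  \<comment> \<open>One edge for each position in this range, from its place to the place of the next position.\<close>
  define F where "F = L \<times> {- N..s + N}"
  define src where "src = (\<lambda>(l, j). (l :: cantor set \<times> cantor set, p j))"
  define tgt where "tgt = (\<lambda>(l, j). (l :: cantor set \<times> cantor set, p (j + 1)))"
  have finF: "finite F" using finL by (simp add: F_def)
  have srcF: "src ` F = W"
  proof (intro equalityI subsetI)
    fix w assume "w \<in> W"
    then obtain l r where w: "w = (l, r)" "l \<in> L" "r \<in> R" by (auto simp: W_def)
    then have "(l, r) \<in> F" "src (l, r) = w" using p_id R_bounds by (auto simp: F_def src_def)
    then show "w \<in> src ` F" by force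
  qed (use pW in \<open>auto simp: F_def src_def\<close>)
  have tgtF: "tgt ` F = W"
  proof (intro equalityI subsetI)
    fix w assume "w \<in> W"
    then obtain l r where w: "w = (l, r)" "l \<in> L" "r \<in> R" by (auto simp: W_def)
    \<comment> \<open>The edge into the place \<open>- N\<close>, that is \<open>u\<^sub>1\<close>, starts at the end \<open>- 1\<close> of the round.\<close>
    define j where "j = (if r = - N then - 1 else r - 1)"
    have "p 0 = p (- N)" using p_iff N by (simp add: same_place_def)
    then have "p (j + 1) = r" using p_id [OF w(3)] by (auto simp: j_def)
    moreover have "(l, j) \<in> F" using w R_bounds [OF w(3)] N s(1) by (auto simp: F_def j_def)
    ultimately show "w \<in> tgt ` F" using w(1) by (intro image_eqI [of _ _ "(l, j)"]) (simp_all add: tgt_def)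
  qed (use pW in \<open>auto simp: F_def tgt_def\<close>)
  define Z where "Z = {w \<in> W. snd w \<le> 0 \<or> s < snd w}"
  \<comment> \<open>The next place within the same plate; going back by \<open>N\<close> first avoids stepping from \<open>u\<^sub>1\<close> onto the bar.\<close>
  define nxt where "nxt = (\<lambda>r. if r \<le> 0 then p (r + 1 - N) else p (r + 1))"
  define \<pi> where "\<pi> = (\<lambda>(l :: cantor set \<times> cantor set, r). (l, nxt r))"
  have nxt_side: "nxt r \<le> 0" if "r \<le> 0" for r using p_side [of "r + 1 - N"] that N by (simp add: nxt_def)
  have nxt_side': "s < nxt r" if "s < r" for r using p_side [of "r + 1"] that s by (simp add: nxt_def)
  have \<pi>Z: "\<pi> ` Z \<subseteq> Z"
  proof
    fix w assume "w \<in> \<pi> ` Z"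
    then obtain l r where w: "w = (l, nxt r)" "l \<in> L" "r \<le> 0 \<or> s < r" by (auto simp: \<pi>_def Z_def W_def)
    have "nxt r \<in> R" using pR by (simp add: nxt_def)
    then show "w \<in> Z" using w nxt_side nxt_side' by (auto simp: Z_def W_def)
  qed
  have nxt_inj: "r = r'" if r: "r \<in> R" "r' \<in> R" "r \<le> 0 \<or> s < r" "r' \<le> 0 \<or> s < r'" and eq: "nxt r = nxt r'" for r r'
  proof -
    have side: "r \<le> 0 \<longleftrightarrow> r' \<le> 0"
      using r(3,4) nxt_side [of r] nxt_side [of r'] nxt_side' [of r] nxt_side' [of r'] eq s by fastforce
    then have "same_place N s (if r \<le> 0 then r + 1 - N else r + 1) (if r \<le> 0 then r' + 1 - N else r' + 1)"
      using eq p_iff by (auto simp: nxt_def split: if_splits)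
    then have "same_place N s r r'" using side r(3,4) s by (cases "r \<le> 0") (auto simp: same_place_def)
    then show ?thesis using p_iff p_id r(1,2) by metis
  qed
  have "inj_on \<pi> Z"
    using nxt_inj by (auto simp: \<pi>_def Z_def W_def intro!: inj_onI)
  moreover have "finite Z" using finW by (simp add: Z_def)
  ultimately have bij: "bij_betw \<pi> Z Z" using endo_inj_surj [OF _ \<pi>Z] by (simp add: bij_betw_def)
  have ZW: "Z \<subseteq> W" by (auto simp: Z_def)
  obtain h' A where h': "h' \<in> homeos"
    and arrow: "\<And>f. f \<in> F \<Longrightarrow> \<exists>x\<in>C (src f). h' x \<in> C (tgt f)"
    and point: "\<And>x. (\<exists>f\<in>F. x \<in> C (src f) \<and> h' x \<in> C (tgt f)) \<or> (\<exists>z\<in>Z. x \<in> C z \<and> h' x \<in> C (\<pi> z))"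
    and A: "\<And>z. z \<in> Z \<Longrightarrow> clopen (A z) \<and> A z \<noteq> {} \<and> A z \<subseteq> C z \<and> h' ` A z = A (\<pi> z)"
    by (rule realize_graph [OF finW C Cdis Ccover finF srcF tgtF ZW bij]) blast+
  have point': "\<exists>l\<in>L. \<exists>j. x \<in> c l j \<and> h' x \<in> c l (j + 1)" for x
    using point [of x]
  proof
    assume "\<exists>f\<in>F. x \<in> C (src f) \<and> h' x \<in> C (tgt f)"
    then show ?thesis unfolding F_def src_def tgt_def c_def by force
  next
    assume "\<exists>z\<in>Z. x \<in> C z \<and> h' x \<in> C (\<pi> z)"
    then obtain l r where lr: "(l, r) \<in> Z" "x \<in> C (l, r)" "h' x \<in> C (l, nxt r)" by (auto simp: \<pi>_def)
    have l: "l \<in> L" "r \<in> R" using lr(1) by (auto simp: Z_def W_def)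
    then have r: "p r = r" using p_id by blast
    show ?thesis
    proof (cases "r \<le> 0")
      case True
      then have "p (r - N) = r" using p_line r by (simp add: line_def)
      then have "x \<in> c l (r - N)" "h' x \<in> c l (r - N + 1)" using lr True by (simp_all add: c_def nxt_def algebra_simps)
      then show ?thesis using l by blast
    next
      case False
      then have "x \<in> c l r" "h' x \<in> c l (r + 1)" using lr r by (simp_all add: c_def nxt_def)
      then show ?thesis using l by blast
    qed
  qed
  have arrow': "\<exists>x\<in>c l j. h' x \<in> c l (j + 1)" if l: "l \<in> L" for l j
  proof -
    obtain j' where j': "- N \<le> j'" "j' \<le> s + N" "p j' = p j" "p (j' + 1) = p (j + 1)"
      using line_reduce [OF p_line N, of j] by metis
    then have "(l, j') \<in> F" using l by (simp add: F_def)
    from arrow [OF this] show ?thesis using j' by (simp add: src_def tgt_def c_def)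
  qed
  define P' where "P' = C ` W"
  define I where "I = (\<lambda>l. (c l, s)) ` L"
  have cP': "c l j \<in> P'" if "l \<in> L" for l j using pW [OF that] by (simp add: c_def P'_def)
  have P': "clopen_partition P'"
  proof (rule clopen_partitionI)
    show "\<exists>a\<in>P'. x \<in> a" for x using Ccover unfolding P'_def by blast
    show "a = b" if "a \<in> P'" "b \<in> P'" "x \<in> a" "x \<in> b" for a b x
      using that Cinj unfolding P'_def by blast
  qed (use finW C in \<open>auto simp: P'_def\<close>)
  have sep: "l = l' \<and> same_place N s j j'" if eq: "c l j = c l' j'" and l: "l \<in> L" "l' \<in> L" for l l' j j'
  proof -
    obtain x where "x \<in> C (l, p j)" using C [OF pW [OF l(1)]] by blast
    then have "(l, p j) = (l', p j')" using Cinj [of x] eq l pW unfolding c_def by blast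
    then show ?thesis using p_iff by simp
  qed
  have D: "dumbbells P' (moves h' P') N I"
    unfolding dumbbells_def
  proof (intro conjI)
    show "\<forall>(c, s)\<in>I. line N c s" using p_line by (auto simp: I_def line_def c_def)
    have "P' = (\<Union>l\<in>L. range (c l))"
    proof (intro equalityI subsetI)
      fix a assume "a \<in> P'"
      then obtain l r where "a = C (l, r)" "l \<in> L" "r \<in> R" by (auto simp: P'_def W_def)
      then have "a = c l r" using p_id by (simp add: c_def)
      then show "a \<in> (\<Union>l\<in>L. range (c l))" using \<open>l \<in> L\<close> by blast
    qed (use cP' in blast)
    then show "P' = (\<Union>(c, s)\<in>I. range c)" by (simp add: I_def)
    have "moves h' P' = (\<Union>l\<in>L. range (\<lambda>j. (c l j, c l (j + 1))))"
    proof (intro equalityI subsetI)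
      fix e assume "e \<in> moves h' P'"
      then obtain a b x where e: "e = (a, b)" "a \<in> P'" "b \<in> P'" "x \<in> a" "h' x \<in> b"
        by (metis movesE prod.exhaust)
      obtain l j where l: "l \<in> L" "x \<in> c l j" "h' x \<in> c l (j + 1)" using point' by blast
      then have "a = c l j" "b = c l (j + 1)" using partition_cell_eq [OF P'] e cP' by blast+
      then show "e \<in> (\<Union>l\<in>L. range (\<lambda>j. (c l j, c l (j + 1))))" using e(1) l(1) by blast
    next
      fix e assume "e \<in> (\<Union>l\<in>L. range (\<lambda>j. (c l j, c l (j + 1))))"
      then obtain l j where e: "l \<in> L" "e = (c l j, c l (j + 1))" by blast
      then obtain x where "x \<in> c l j" "h' x \<in> c l (j + 1)" using arrow' by blast
      then show "e \<in> moves h' P'" unfolding e(2) using cP' e(1) by (blast intro: movesI)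
    qed
    then show "moves h' P' = (\<Union>(c, s)\<in>I. range (\<lambda>j. (c j, c (j + 1))))" by (simp add: I_def)
    show "\<forall>(c, s)\<in>I. \<forall>(c', s')\<in>I. \<forall>j j'. c j = c' j' \<longrightarrow> c = c' \<and> s = s' \<and> same_place N s j j'"
      unfolding I_def by (simp, intro ballI allI impI, use sep in metis)
  qed (rule N)
  have loop: "\<exists>B. B \<noteq> {} \<and> clopen B \<and> h' ` B = B \<and> B \<subseteq> (\<Union>j\<in>S. c l j)"
    if l: "l \<in> L" and S: "r0 \<in> R \<inter> S" "\<And>r. r \<in> S \<Longrightarrow> nxt r \<in> S" "\<And>r. r \<in> S \<Longrightarrow> r \<le> 0 \<or> s < r" for l S r0
  proof -
    let ?Z = "{l} \<times> (R \<inter> S)"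
    have ZZ: "?Z \<subseteq> Z"
    proof
      fix z assume "z \<in> ?Z"
      then obtain r where "z = (l, r)" "r \<in> R" "r \<in> S" by blast
      then show "z \<in> Z" using l S(3) [of r] by (simp add: Z_def W_def)
    qed
    have "\<pi> ` ?Z \<subseteq> ?Z" using S(2) pR by (auto simp: \<pi>_def nxt_def)
    moreover have "inj_on \<pi> ?Z" using bij ZZ by (meson bij_betw_def inj_on_subset)
    moreover have "finite ?Z" by (simp add: R_def places_def)
    ultimately have im: "\<pi> ` ?Z = ?Z" using endo_inj_surj by blast
    define B where "B = (\<Union>z\<in>?Z. A z)"
    have "h' ` B = (\<Union>z\<in>?Z. A (\<pi> z))" unfolding B_def image_UN by (intro SUP_cong refl) (use A ZZ in blast)
    also have "\<dots> = (\<Union>z\<in>\<pi> ` ?Z. A z)" by blast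
    finally have "h' ` B = B" unfolding im B_def .
    moreover have "clopen B" unfolding B_def using A ZZ by (intro clopen_UN) (auto simp: R_def places_def)
    moreover have "A (l, r0) \<noteq> {}" "A (l, r0) \<subseteq> B" using A [of "(l, r0)"] ZZ S(1) by (auto simp: B_def)
    then have "B \<noteq> {}" by auto
    moreover have "B \<subseteq> (\<Union>j\<in>S. c l j)"
    proof
      fix x assume "x \<in> B"
      then obtain r where r: "r \<in> R" "r \<in> S" "x \<in> A (l, r)" by (auto simp: B_def)
      then have "x \<in> C (l, r)" using A [of "(l, r)"] ZZ by blast
      then have "x \<in> c l r" using p_id r(1) by (simp add: c_def)
      then show "x \<in> (\<Union>j\<in>S. c l j)" using r(2) by blast
    qed
    ultimately show ?thesis by blast
  qed
  have "left_loop h' (c l)" if "l \<in> L" for l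
    unfolding left_loop_def using loop [OF that, of "- 1" "{..0}"] nxt_side N s by (auto simp: R_def places_def)
  moreover have "right_loop h' (c l) s" if "l \<in> L" for l
    unfolding right_loop_def using loop [OF that, of "s + 1" "{s<..}"] nxt_side' N s by (auto simp: R_def places_def)
  ultimately have looped: "looped h' P' N I" using P' D by (auto simp: looped_def I_def)
  have near: "agree K (h x) (h' x)" for x
  proof -
    obtain l j where l: "l \<in> L" "x \<in> c l j" "h' x \<in> c l (j + 1)" using point' by blast
    have "h x \<in> snd (Y l j)" using c_q [OF l(1)] l(2) by (auto simp: q_cell_def)
    moreover have "h' x \<in> snd (Y l j)" using c_q [OF l(1)] l(3) Y(2) [OF l(1)] by (auto simp: q_cell_def)
    ultimately show ?thesis using P0(2) LP(2) Y(3) [OF l(1)] unfolding resolves_def by blast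
  qed
  have "agree K x y" if xy: "x \<in> a" "y \<in> a" "a \<in> P'" for x y a
  proof -
    obtain l r where a: "a = C (l, r)" "(l, r) \<in> W" using xy(3) by (auto simp: P'_def)
    then have "a \<subseteq> fst (Y l r)" "Y l r \<in> L" using CF Y(3) by (fastforce simp: q_cell_def W_def)+
    then show ?thesis using P0(2) LP(1) xy unfolding resolves_def by blast
  qed
  then have "resolves m P'" unfolding resolves_def using agree_mono K_def by (metis max.cobounded2)
  then have "looped_at m h'" unfolding looped_at_def using looped q N_def by blast
  moreover have "agree k (h x) (h' x)" for x using agree_mono [OF near, of k] by (simp add: K_def)
  ultimately show ?thesis using h' that by blast
qed

section \<open>The Baire category argument\<close>

lemma homeo_dist_less_iff: "1 \<le> k \<Longrightarrow> homeo_dist f g < 1 / real k \<longleftrightarrow> (\<forall>x. agree k (f x) (g x))"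
  using homeo_dist_attained [of f g] cdist_le_homeo_dist [of f _ g]
  by (metis cdist_less_iff_agree le_less_trans)

lemma homeo_topspace [simp]: "topspace homeo_topology = homeos"
  unfolding homeo_topology_def by (simp add: Metric_space.topspace_mtopology homeo_metric)

lemma openin_homeo_iff:
  "openin homeo_topology U \<longleftrightarrow>
     U \<subseteq> homeos \<and> (\<forall>h\<in>U. \<exists>k. \<forall>h'\<in>homeos. (\<forall>x. agree k (h x) (h' x)) \<longrightarrow> h' \<in> U)"
proof -
  interpret Metric_space homeos homeo_dist by (rule homeo_metric)
  have "(\<exists>r>0. mball h r \<subseteq> U) \<longleftrightarrow> (\<exists>k. \<forall>h'\<in>homeos. (\<forall>x. agree k (h x) (h' x)) \<longrightarrow> h' \<in> U)"
    if h: "h \<in> homeos" for h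
  proof
    assume "\<exists>r>0. mball h r \<subseteq> U"
    then obtain r where r: "r > 0" "mball h r \<subseteq> U" by blast
    obtain k where k: "1 / real (Suc k) < r" using r(1) nat_approx_posE by blast
    have "h' \<in> U" if "h' \<in> homeos" "\<forall>x. agree (Suc k) (h x) (h' x)" for h'
    proof -
      have "homeo_dist h h' < r" using homeo_dist_less_iff [of "Suc k" h h'] that(2) k by simp
      then show ?thesis using r(2) h that(1) by (auto simp: in_mball)
    qed
    then show "\<exists>k. \<forall>h'\<in>homeos. (\<forall>x. agree k (h x) (h' x)) \<longrightarrow> h' \<in> U" by blast
  next
    assume "\<exists>k. \<forall>h'\<in>homeos. (\<forall>x. agree k (h x) (h' x)) \<longrightarrow> h' \<in> U"
    then obtain k where k: "\<And>h'. h' \<in> homeos \<Longrightarrow> (\<forall>x. agree k (h x) (h' x)) \<Longrightarrow> h' \<in> U" by blast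
    have "mball h (1 / real (Suc k)) \<subseteq> U"
    proof
      fix h' assume "h' \<in> mball h (1 / real (Suc k))"
      then have "h' \<in> homeos" "\<forall>x. agree (Suc k) (h x) (h' x)"
        using homeo_dist_less_iff [of "Suc k" h h'] by (simp_all add: in_mball)
      then show "h' \<in> U" using k agree_mono by (metis le_SucI order_refl)
    qed
    then show "\<exists>r>0. mball h r \<subseteq> U" by (intro exI [of _ "1 / real (Suc k)"]) simp
  qed
  then show ?thesis
    unfolding homeo_topology_def openin_mtopology by blast
qed

lemma comeager_if_open_dense:
  assumes op: "\<And>m::nat. openin homeo_topology (G m)"
    and dense: "\<And>m h k. h \<in> homeos \<Longrightarrow> \<exists>h'\<in>G m. \<forall>x. agree k (h x) (h' x)"
  shows "comeager_in homeo_topology (\<Inter>m. G m)"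
proof -
  have sub: "G m \<subseteq> homeos" for m using op [of m] by (simp add: openin_homeo_iff)
  have "nowhere_dense_in homeo_topology (homeos - G m)" for m
  proof -
    have "closedin homeo_topology (homeos - G m)" using op [of m] by (simp add: closedin_def Diff_Diff_Int inf.absorb2 sub)
    then have cl: "homeo_topology closure_of (homeos - G m) = homeos - G m"
      by (simp add: closure_of_eq)
    have "homeo_topology interior_of (homeos - G m) = {}"
    proof (rule ccontr)
      assume "homeo_topology interior_of (homeos - G m) \<noteq> {}"
      then obtain U h where U: "openin homeo_topology U" "h \<in> U" "U \<subseteq> homeos - G m"
        by (metis all_not_in_conv interior_of_subset openin_interior_of)
      then obtain k where k: "\<And>h'. h' \<in> homeos \<Longrightarrow> \<forall>x. agree k (h x) (h' x) \<Longrightarrow> h' \<in> U"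
        unfolding openin_homeo_iff by blast
      have "h \<in> homeos" using U by blast
      then obtain h' where "h' \<in> G m" "\<forall>x. agree k (h x) (h' x)" using dense by blast
      then show False using k [of h'] U(3) sub by blast
    qed
    then show ?thesis unfolding nowhere_dense_in_def cl by simp
  qed
  moreover have "homeos - (\<Inter>m. G m) = \<Union>(range (\<lambda>m. homeos - G m))" by blast
  ultimately have "meager_in homeo_topology (homeos - (\<Inter>m. G m))"
    unfolding meager_in_def by (intro exI [of _ "range (\<lambda>m. homeos - G m)"]) auto
  moreover have "(\<Inter>m. G m) \<subseteq> homeos" using sub by blast
  ultimately show ?thesis by (simp add: comeager_in_def)
qed

lemma uniform_limit_continuous:
  fixes f :: "nat \<Rightarrow> cantor \<Rightarrow> cantor"
  assumes cont: "\<And>n. continuous_on UNIV (f n)"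
    and cauchy: "\<And>k. \<exists>n0. \<forall>n\<ge>n0. \<forall>n'\<ge>n0. \<forall>x. agree k (f n x) (f n' x)"
  obtains F :: "cantor \<Rightarrow> cantor" where "continuous_on UNIV F"
    "\<And>k. \<exists>n0. \<forall>n\<ge>n0. \<forall>x. agree k (F x) (f n x)"
proof -
  obtain \<nu> where \<nu>: "\<And>k n n' x. \<nu> k \<le> n \<Longrightarrow> \<nu> k \<le> n' \<Longrightarrow> agree k (f n x) (f n' x)" using cauchy by metis
  define F where "F = (\<lambda>x i. f (\<nu> (Suc i)) x i)"
  have F: "\<exists>n0. \<forall>n\<ge>n0. \<forall>x. agree k (F x) (f n x)" for k
  proof -
    define n0 where "n0 = Max (\<nu> ` {..k})"
    have n0: "\<nu> i \<le> n0" if "i \<le> k" for i using that by (simp add: n0_def)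
    have "F x i = f n x i" if "n0 \<le> n" "i < k" for n x i
      using \<nu> [of "Suc i" "\<nu> (Suc i)" n x] n0 [of "Suc i"] that by (simp add: F_def agree_def)
    then show ?thesis unfolding agree_def by blast
  qed
  have "\<exists>l. \<forall>x y. agree l x y \<longrightarrow> agree k (F x) (F y)" for k
  proof -
    obtain n where n: "\<And>x. agree k (F x) (f n x)" using F by blast
    obtain l where "\<And>x y. agree l x y \<Longrightarrow> agree k (f n x) (f n y)"
      using cont [of n] unfolding continuous_on_iff_agree by blast
    then show ?thesis using n agree_trans agree_sym by meson
  qed
  then have "continuous_on UNIV F" unfolding continuous_on_iff_agree by blast
  then show ?thesis using that F by blast
qed

lemma uniform_limit_inverse:
  fixes f g :: "nat \<Rightarrow> cantor \<Rightarrow> cantor"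
  assumes G: "continuous_on UNIV G" and lim: "\<And>k. \<exists>n0. \<forall>n\<ge>n0. \<forall>x. agree k (F x) (f n x)"
    "\<And>k. \<exists>n0. \<forall>n\<ge>n0. \<forall>x. agree k (G x) (g n x)" and inv: "\<And>n x. g n (f n x) = x"
  shows "G (F x) = x"
proof (rule agree_all_imp_eq)
  fix k
  obtain l where l: "\<And>x y. agree l x y \<Longrightarrow> agree k (G x) (G y)"
    using G unfolding continuous_on_iff_agree by blast
  obtain n1 n2 where n12: "\<And>n x. n1 \<le> n \<Longrightarrow> agree l (F x) (f n x)" "\<And>n x. n2 \<le> n \<Longrightarrow> agree k (G x) (g n x)"
    using lim by metis
  define n where "n = max n1 n2"
  have "agree k (G (F x)) (G (f n x))" using l n12(1) by (simp add: n_def)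
  moreover have "agree k (G (f n x)) (g n (f n x))" using n12(2) by (simp add: n_def)
  ultimately show "agree k (G (F x)) x" using inv agree_trans by metis
qed

text \<open>
  The metric on the group of homeomorphisms is not complete, so the approximating sequence has to converge
  together with the sequence of inverses.  That costs nothing: if \<open>h'\<close> is close enough to \<open>h\<close>, then by uniform
  continuity of the inverse of \<open>h\<close> the two inverses are close.  The two limits are inverse to each other.
\<close>

lemma open_dense_Inter_nonempty:
  assumes op: "\<And>m::nat. openin homeo_topology (G m)"
    and dense: "\<And>m h k. h \<in> homeos \<Longrightarrow> \<exists>h'\<in>G m. \<forall>x. agree k (h x) (h' x)"
  shows "(\<Inter>m. G m) \<noteq> {}"
proof -
  have sub: "G m \<subseteq> homeos" for m using op [of m] by (simp add: openin_homeo_iff)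
  \<comment> \<open>An approximation \<open>h\<close> comes with a number \<open>k\<close> of coordinates that are kept from then on.\<close>
  define near where "near n y z \<longleftrightarrow> (case y of (h, k) \<Rightarrow> case z of (h', k') \<Rightarrow>
      k \<le> k' \<and> (\<forall>x. agree k (h x) (h' x) \<and> agree k (inverse_map h x) (inverse_map h' x)) \<and>
      (\<forall>f\<in>homeos. (\<forall>x. agree k' (h' x) (f x)) \<longrightarrow> f \<in> G n))"
    for n :: nat and y z :: "(cantor \<Rightarrow> cantor) \<times> nat"
  have step: "\<exists>z. (fst z \<in> homeos \<and> Suc n \<le> snd z) \<and> near n y z" if y: "fst y \<in> homeos \<and> n \<le> snd y" for n y
  proof -
    obtain h k where hk: "y = (h, k)" "h \<in> homeos" "n \<le> k" using y by (cases y) auto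
    obtain l where l: "\<And>x y. agree l x y \<Longrightarrow> agree k (inverse_map h x) (inverse_map h y)"
      using homeos_continuous [OF homeos_inv [OF hk(2)]] unfolding continuous_on_iff_agree by blast
    obtain h' where h': "h' \<in> G n" "\<And>x. agree (max l k) (h x) (h' x)" using dense [OF hk(2)] by blast
    have h'H: "h' \<in> homeos" using h'(1) sub by blast
    have "agree k (inverse_map h x) (inverse_map h' x)" for x
    proof -
      have "agree l (h (inverse_map h' x)) x"
        using agree_mono [OF h'(2) [of "inverse_map h' x"], of l] homeos_inv_simps(2) [OF h'H] by simp
      from l [OF this] show ?thesis using homeos_inv_simps(1) [OF hk(2)] agree_sym by simp
    qed
    moreover have "agree k (h x) (h' x)" for x using agree_mono [OF h'(2)] by simp
    moreover obtain k0 where "\<And>f. f \<in> homeos \<Longrightarrow> \<forall>x. agree k0 (h' x) (f x) \<Longrightarrow> f \<in> G n"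
      using op [of n] h'(1) unfolding openin_homeo_iff by blast
    then have "f \<in> G n" if "f \<in> homeos" "\<forall>x. agree (max k0 (Suc k)) (h' x) (f x)" for f
      using that agree_mono by (meson max.cobounded1)
    ultimately have "near n y (h', max k0 (Suc k))" by (simp add: near_def hk(1))
    then show ?thesis using h'H hk(3) by (intro exI [of _ "(h', max k0 (Suc k))"]) auto
  qed
  have "id \<in> homeos" by (rule homeosI [of id id]) (auto simp: continuous_on_id)
  then have "\<exists>y. fst y \<in> homeos \<and> 0 \<le> snd (y :: (cantor \<Rightarrow> cantor) \<times> nat)" by (intro exI [of _ "(id, 0)"]) simp
  then obtain y where y: "\<And>n. (fst (y n) \<in> homeos \<and> n \<le> snd (y n)) \<and> near n (y n) (y (Suc n))"
    using dependent_nat_choice [of "\<lambda>n y. fst y \<in> homeos \<and> n \<le> snd y" near] step by blast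
  define f where "f = (\<lambda>n. fst (y n))"
  define k where "k = (\<lambda>n. snd (y n))"
  have fH: "f n \<in> homeos" and k: "n \<le> k n" and mono: "k n \<le> k (Suc n)"
    and close: "agree (k n) (f n x) (f (Suc n) x)" "agree (k n) (inverse_map (f n) x) (inverse_map (f (Suc n)) x)"
    and G: "\<And>h. h \<in> homeos \<Longrightarrow> (\<And>x. agree (k (Suc n)) (f (Suc n) x) (h x)) \<Longrightarrow> h \<in> G n" for n x
    using y [of n] by (auto simp: f_def k_def near_def split: prod.splits)
  have chain: "agree (k n) (g n x) (g n' x)"
    if "\<And>n x. agree (k n) (g n x) (g (Suc n) x)" "n \<le> n'" for g :: "nat \<Rightarrow> cantor \<Rightarrow> cantor" and n n' x
    using that(2)
  proof (induction n' rule: dec_induct)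
    case (step i)
    have "k n \<le> k i" using step.hyps(1) mono by (simp add: lift_Suc_mono_le)
    then show ?case using step.IH that(1) agree_mono agree_trans by meson
  qed simp
  have cauchy: "\<exists>n0. \<forall>n\<ge>n0. \<forall>n'\<ge>n0. \<forall>x. agree i (g n x) (g n' x)"
    if "\<And>n x. agree (k n) (g n x) (g (Suc n) x)" for g :: "nat \<Rightarrow> cantor \<Rightarrow> cantor" and i
    using chain [where g = g, OF that, of i] k [of i] agree_mono agree_sym agree_trans
    by (intro exI [of _ i]) meson
  obtain F where F: "continuous_on UNIV F" "\<And>k. \<exists>n0. \<forall>n\<ge>n0. \<forall>x. agree k (F x) (f n x)"
    using uniform_limit_continuous [of f] homeos_continuous [OF fH] cauchy [where g = f, OF close(1)] by metis
  obtain F' where F': "continuous_on UNIV F'" "\<And>k. \<exists>n0. \<forall>n\<ge>n0. \<forall>x. agree k (F' x) (inverse_map (f n) x)"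
    using uniform_limit_continuous [of "\<lambda>n. inverse_map (f n)"] homeos_continuous [OF homeos_inv [OF fH]]
      cauchy [where g = "\<lambda>n. inverse_map (f n)", OF close(2)] by metis
  have "F' (F x) = x" "F (F' x) = x" for x
    using uniform_limit_inverse [OF F'(1) F(2) F'(2)] uniform_limit_inverse [OF F(1) F'(2) F(2)]
      homeos_inv_simps(1,2) [OF fH] by auto
  then have FH: "F \<in> homeos" using homeosI F(1) F'(1) by blast
  have "F \<in> G n" for n
  proof (rule G [OF FH])
    fix x
    obtain n0 where n0: "\<forall>i\<ge>n0. \<forall>x. agree (k (Suc n)) (F x) (f i x)" using F(2) by blast
    have "agree (k (Suc n)) (f (Suc n) x) (f (max n0 (Suc n)) x)" using chain [where g = f, OF close(1)] by simp
    moreover have "agree (k (Suc n)) (F x) (f (max n0 (Suc n)) x)" using n0 by simp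
    ultimately show "agree (k (Suc n)) (f (Suc n) x) (F x)" using agree_sym agree_trans by blast
  qed
  then show ?thesis by blast
qed

definition looped_homeos :: "nat \<Rightarrow> (cantor \<Rightarrow> cantor) set" where
  "looped_homeos m = {h \<in> homeos. looped_at (Suc m) h}"

lemma looped_homeos_open: "openin homeo_topology (looped_homeos m)"
  unfolding openin_homeo_iff looped_homeos_def using looped_at_open by (metis (mono_tags, lifting) mem_Collect_eq subsetI)

lemma looped_homeos_dense:
  assumes h: "h \<in> homeos"
  shows "\<exists>h'\<in>looped_homeos m. \<forall>x. agree k (h x) (h' x)"
proof -
  obtain h' where "h' \<in> homeos" "looped_at (Suc m) h'" "\<And>x. agree k (h x) (h' x)"
    by (rule looped_at_dense [OF h, of "Suc m" k]) simp_all
  then show ?thesis by (auto simp: looped_homeos_def)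
qed

section \<open>Invariance under conjugation\<close>

lemma dumbbells_image:
  assumes D: "dumbbells V E N I" and inj: "inj \<phi>"
  shows "dumbbells (\<phi> ` V) (map_prod \<phi> \<phi> ` E) N ((\<lambda>(c, s). (\<phi> \<circ> c, s)) ` I)"
proof -
  have \<phi>: "\<phi> a = \<phi> b \<longleftrightarrow> a = b" for a b using inj by (rule inj_eq)
  have V: "V = (\<Union>(c, s)\<in>I. range c)" and E: "E = (\<Union>(c, s)\<in>I. range (\<lambda>j. (c j, c (j + 1))))"
    using D by (simp_all add: dumbbells_def)
  show ?thesis
    unfolding dumbbells_def
  proof (intro conjI)
    show "1 \<le> N" using dumbbells_D(1) [OF D] .
    have "line N (\<phi> \<circ> c) s" if "(c, s) \<in> I" for c s
      using dumbbells_D(2) [OF D that] by (simp add: line_def)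
    then show "\<forall>(c, s)\<in>(\<lambda>(c, s). (\<phi> \<circ> c, s)) ` I. line N c s" by auto
    show "\<phi> ` V = (\<Union>(c, s)\<in>(\<lambda>(c, s). (\<phi> \<circ> c, s)) ` I. range c)"
      unfolding V by (force simp: image_iff)
    show "map_prod \<phi> \<phi> ` E = (\<Union>(c, s)\<in>(\<lambda>(c, s). (\<phi> \<circ> c, s)) ` I. range (\<lambda>j. (c j, c (j + 1))))"
      unfolding E by (force simp: image_iff)
    have sep: "\<phi> \<circ> c = \<phi> \<circ> c' \<and> s = s' \<and> same_place N s j j'"
      if "(c, s) \<in> I" "(c', s') \<in> I" "\<phi> (c j) = \<phi> (c' j')" for c s c' s' j j'
    proof -
      have "c j = c' j'" using that(3) \<phi> by blast
      then have "c = c' \<and> s = s' \<and> same_place N s j j'" by (rule dumbbells_D(5) [OF D that(1,2)])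
      then show ?thesis by metis
    qed
    show "\<forall>(c, s)\<in>(\<lambda>(c, s). (\<phi> \<circ> c, s)) ` I. \<forall>(c', s')\<in>(\<lambda>(c, s). (\<phi> \<circ> c, s)) ` I.
        \<forall>j j'. c j = c' j' \<longrightarrow> c = c' \<and> s = s' \<and> same_place N s j j'"
    proof (rule ballI)
      fix l assume "l \<in> (\<lambda>(c, s). (\<phi> \<circ> c, s)) ` I"
      then obtain c s where l: "l = (\<phi> \<circ> c, s)" and c: "(c, s) \<in> I" by auto
      show "case l of (c, s) \<Rightarrow> \<forall>(c', s')\<in>(\<lambda>(c, s). (\<phi> \<circ> c, s)) ` I.
          \<forall>j j'. c j = c' j' \<longrightarrow> c = c' \<and> s = s' \<and> same_place N s j j'"
        unfolding l prod.case
      proof (rule ballI)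
        fix l' assume "l' \<in> (\<lambda>(c, s). (\<phi> \<circ> c, s)) ` I"
        then obtain c' s' where l': "l' = (\<phi> \<circ> c', s')" and c': "(c', s') \<in> I" by auto
        show "case l' of (c', s') \<Rightarrow>
            \<forall>j j'. (\<phi> \<circ> c) j = c' j' \<longrightarrow> \<phi> \<circ> c = c' \<and> s = s' \<and> same_place N s j j'"
          unfolding l' prod.case using sep [OF c c'] unfolding comp_apply by blast
      qed
    qed
  qed
qed

lemma conjugate_apply_image:
  assumes k: "k \<in> homeos"
  shows "(k \<circ> h \<circ> inverse_map k) ` k ` a = k ` h ` a"
  using homeos_inv_simps(1) [OF k] by (simp add: image_comp comp_def)

lemma looped_conjugate:
  assumes k: "k \<in> homeos" and g: "looped h P N I"
  shows "looped (k \<circ> h \<circ> inverse_map k) ((`) k ` P) N ((\<lambda>(c, s). ((`) k \<circ> c, s)) ` I)"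
proof -
  have injk: "inj k" and surjk: "surj k" using homeos_bij [OF k] by (auto simp: bij_def)
  note P = loopedD(1) [OF g]
  have "clopen_partition ((`) k ` P)"
  proof (rule clopen_partitionI)
    show "finite ((`) k ` P)" using partition_finite [OF P] by simp
    show "clopen a \<and> a \<noteq> {}" if "a \<in> (`) k ` P" for a
      using that partition_nonempty [OF P] clopen_image [OF k partition_clopen [OF P]] by auto
    show "\<exists>a\<in>(`) k ` P. y \<in> a" for y
    proof -
      obtain x where x: "y = k x" using surjk by (metis surjD)
      obtain a where "a \<in> P" "x \<in> a" using partition_cell [OF P] by blast
      then show ?thesis using x by blast
    qed
    show "a = b" if ab: "a \<in> (`) k ` P" "b \<in> (`) k ` P" "y \<in> a" "y \<in> b" for a b y
    proof -
      obtain a' b' where "a' \<in> P" "b' \<in> P" "a = k ` a'" "b = k ` b'" using ab(1,2) by blast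
      moreover from this obtain x where "x \<in> a'" "x \<in> b'" using ab(3,4) injk by (auto dest: injD)
      ultimately show ?thesis using partition_cell_eq [OF P] by blast
    qed
  qed
  moreover have "moves (k \<circ> h \<circ> inverse_map k) ((`) k ` P) = map_prod ((`) k) ((`) k) ` moves h P"
  proof -
    have iff: "(k \<circ> h \<circ> inverse_map k) ` k ` a \<inter> k ` b \<noteq> {} \<longleftrightarrow> h ` a \<inter> b \<noteq> {}" for a b
      unfolding conjugate_apply_image [OF k] by (simp add: image_Int [OF injk, symmetric])
    show ?thesis
    proof (intro equalityI subsetI)
      fix e assume "e \<in> moves (k \<circ> h \<circ> inverse_map k) ((`) k ` P)"
      then obtain a b where ab: "a \<in> P" "b \<in> P" "e = (k ` a, k ` b)"
        "(k \<circ> h \<circ> inverse_map k) ` k ` a \<inter> k ` b \<noteq> {}" unfolding moves_def by blast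
      then have "(a, b) \<in> moves h P" unfolding iff by (simp add: moves_def)
      then show "e \<in> map_prod ((`) k) ((`) k) ` moves h P" using ab(3) by force
    next
      fix e assume "e \<in> map_prod ((`) k) ((`) k) ` moves h P"
      then obtain a b where ab: "a \<in> P" "b \<in> P" "e = (k ` a, k ` b)" "h ` a \<inter> b \<noteq> {}"
        unfolding moves_def by auto
      then show "e \<in> moves (k \<circ> h \<circ> inverse_map k) ((`) k ` P)"
        using iff unfolding moves_def by blast
    qed
  qed
  moreover have "inj ((`) k)" by (rule injI) (simp add: inj_image_eq_iff [OF injk])
  then have "dumbbells ((`) k ` P) (map_prod ((`) k) ((`) k) ` moves h P) N ((\<lambda>(c, s). ((`) k \<circ> c, s)) ` I)"
    using dumbbells_image [OF loopedD(2) [OF g]] by blast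
  moreover have "left_loop (k \<circ> h \<circ> inverse_map k) ((`) k \<circ> c) \<and> right_loop (k \<circ> h \<circ> inverse_map k) ((`) k \<circ> c) s"
    if c: "(c, s) \<in> I" for c s
  proof -
    have *: "\<exists>B. B \<noteq> {} \<and> clopen B \<and> (k \<circ> h \<circ> inverse_map k) ` B = B \<and> B \<subseteq> (\<Union>j\<in>X. ((`) k \<circ> c) j)"
      if A: "A \<noteq> {}" "clopen A" "h ` A = A" "A \<subseteq> (\<Union>j\<in>X. c j)" for A X
    proof (intro exI [of _ "k ` A"] conjI)
      show "clopen (k ` A)" by (rule clopen_image [OF k A(2)])
      show "(k \<circ> h \<circ> inverse_map k) ` k ` A = k ` A" unfolding conjugate_apply_image [OF k] A(3) ..
      have "k ` A \<subseteq> k ` (\<Union>j\<in>X. c j)" using A(4) by (rule image_mono)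
      then show "k ` A \<subseteq> (\<Union>j\<in>X. ((`) k \<circ> c) j)" by (simp add: image_UN)
    qed (use A(1) in simp)
    obtain A B where "A \<noteq> {}" "clopen A" "h ` A = A" "A \<subseteq> (\<Union>j\<in>{..0}. c j)"
      "B \<noteq> {}" "clopen B" "h ` B = B" "B \<subseteq> (\<Union>j\<in>{s<..}. c j)"
      using loopedD(3,4) [OF g c] unfolding left_loop_def right_loop_def by metis
    then show ?thesis unfolding left_loop_def right_loop_def using * by metis
  qed
  ultimately show ?thesis unfolding looped_def by auto
qed

text \<open>
  Points that agree in \<open>l\<close> coordinates have images under \<open>k\<close> that agree in \<open>m\<close> coordinates.  A partition for \<open>h\<close>
  at scale \<open>m (l + 1)\<close> is fine enough, and its number \<open>q\<close> is still a multiple of \<open>m\<close>.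
\<close>

lemma looped_at_conjugate:
  assumes k: "k \<in> homeos" and st: "\<And>m. 1 \<le> m \<Longrightarrow> looped_at m h" and m: "1 \<le> m"
  shows "looped_at m (k \<circ> h \<circ> inverse_map k)"
proof -
  obtain l where l: "\<And>x y. agree l x y \<Longrightarrow> agree m (k x) (k y)"
    using homeos_continuous [OF k] unfolding continuous_on_iff_agree by blast
  have "1 \<le> m * Suc l" using m by simp
  then obtain P q I where P: "resolves (m * Suc l) P" "1 \<le> q" "m * Suc l dvd q" "looped h P (fact q) I"
    using st [of "m * Suc l"] unfolding looped_at_def by blast
  have "1 * Suc l \<le> m * Suc l" using m by (intro mult_right_mono) auto
  then have "resolves l P" using resolves_mono [OF P(1), of l] by simp
  then have "resolves m ((`) k ` P)" using l unfolding resolves_def by blast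
  moreover have "m dvd q" using P(3) dvd_mult_left by blast
  ultimately show ?thesis unfolding looped_at_def using looped_conjugate [OF k P(4)] P(2) by blast
qed

section \<open>Walks in unions of dumbbells\<close>

text \<open>
  The left plate traversed forever in both directions; it agrees with the line at all nonpositive positions.
\<close>

definition lcyc :: "int \<Rightarrow> (int \<Rightarrow> 'a) \<Rightarrow> int \<Rightarrow> 'a" where
  "lcyc N c j = c (j mod N - N)"

definition rcyc :: "int \<Rightarrow> int \<Rightarrow> (int \<Rightarrow> 'a) \<Rightarrow> int \<Rightarrow> 'a" where
  "rcyc N s c j = c (s + 1 + (j - s - 1) mod N)"

lemma lcyc_eqI:
  assumes "line N c s" "1 \<le> N" "i \<le> 0" "N dvd i - j"
  shows "lcyc N c j = c i"
  unfolding lcyc_def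
proof (rule same_place_imp_eq [OF assms(1,2)])
  have "j mod N < N" using assms(2) by simp
  moreover have "N dvd (j mod N - N) - i"
  proof -
    have "N dvd j mod N - j" by (simp add: mod_eq_dvd_iff [symmetric])
    then have "N dvd (j mod N - j) - (i - j) - N" by (rule dvd_diff [OF dvd_diff [OF _ assms(4)] dvd_refl])
    then show ?thesis by (simp add: algebra_simps)
  qed
  ultimately show "same_place N s (j mod N - N) i" using assms(3) by (simp add: same_place_def)
qed

lemma rcyc_eqI:
  assumes "line N c s" "1 \<le> N" "s < i" "N dvd i - j"
  shows "rcyc N s c j = c i"
  unfolding rcyc_def
proof (rule same_place_imp_eq [OF assms(1,2)])
  have "0 \<le> (j - s - 1) mod N" using assms(2) by simp
  moreover have "N dvd (s + 1 + (j - s - 1) mod N) - i"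
  proof -
    have "N dvd (j - s - 1) mod N - (j - s - 1)" by (simp add: mod_eq_dvd_iff [symmetric])
    then have "N dvd ((j - s - 1) mod N - (j - s - 1)) - (i - j)" by (rule dvd_diff [OF _ assms(4)])
    then show ?thesis by (simp add: algebra_simps)
  qed
  ultimately show "same_place N s (s + 1 + (j - s - 1) mod N) i" using assms(3) by (simp add: same_place_def)
qed

lemma lcyc_periodic: "N dvd i - j \<Longrightarrow> lcyc N c i = lcyc N c j"
  unfolding lcyc_def by (metis mod_eq_dvd_iff)

lemma rcyc_periodic: "N dvd i - j \<Longrightarrow> rcyc N s c i = rcyc N s c j"
proof -
  assume "N dvd i - j"
  then have "N dvd (i - s - 1) - (j - s - 1)" by simp
  then show ?thesis unfolding rcyc_def by (metis mod_eq_dvd_iff)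
qed

context
  fixes V E N I
  assumes D: "dumbbells V E N I"
begin

text \<open>
  On the bar a walk has no choice, neither forwards nor backwards: forwards from the bar all successors are
  unique, and backwards from the bar all predecessors are.
\<close>

lemma walk_through_bar:
  assumes x: "\<And>j. (x j, x (j + 1)) \<in> E" and c: "(c, s) \<in> I" and k: "1 \<le> k" "k \<le> s" "x i = c k"
  shows "x j = c (j - (i - k))"
proof -
  have up: "x (i + int n) = c (k + int n)" for n
  proof (induction n)
    case (Suc n)
    have "(c (k + int n), x (i + int n + 1)) \<in> E" using x [of "i + int n"] Suc by simp
    then have "x (i + int n + 1) = c (k + int n + 1)" using dumbbells_succ_unique [OF D c] k(1) by simp
    moreover have "i + int (Suc n) = i + int n + 1" "k + int (Suc n) = k + int n + 1" by simp_all
    ultimately show ?case by metis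
  qed (use k in simp)
  have down: "x (i - int n) = c (k - int n)" for n
  proof (induction n)
    case (Suc n)
    have "(x (i - int n - 1), c (k - int n)) \<in> E" using x [of "i - int n - 1"] Suc by simp
    then have "x (i - int n - 1) = c (k - int n - 1)" using dumbbells_pred_unique [OF D c] k(2) by simp
    moreover have "i - int (Suc n) = i - int n - 1" "k - int (Suc n) = k - int n - 1" by simp_all
    ultimately show ?case by metis
  qed (use k in simp)
  show ?thesis using up [of "nat (j - i)"] down [of "nat (i - j)"] by (cases "i \<le> j") (simp_all add: algebra_simps)
qed

text \<open>
  A walk that meets a bar crosses its dumbbell.  Any other walk stays in one plate, since the plates are joined
  only by the bar.
\<close>

lemma walk_cases:
  assumes x: "\<And>j. (x j, x (j + 1)) \<in> E"
  obtains (cross) c s p where "(c, s) \<in> I" "\<And>j. x j = c (j - p)"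
  | (left) c s p where "(c, s) \<in> I" "\<And>j. x j = lcyc N c (j - p)"
  | (right) c s p where "(c, s) \<in> I" "\<And>j. x j = rcyc N s c (j - p)"
proof (cases "\<exists>i c s k. (c, s) \<in> I \<and> 1 \<le> k \<and> k \<le> s \<and> x i = c k")
  case True
  then show ?thesis using walk_through_bar [of x] x cross by metis
next
  case False
  note N = dumbbells_D(1) [OF D]
  obtain c s k where c: "(c, s) \<in> I" "x 0 = c k"
    using dumbbells_edgeE [OF D x [of 0]] by metis
  note ln = dumbbells_D(2) [OF D c(1)]
  have s: "1 \<le> s" using ln by (simp add: line_def)
  have nobar: "x i \<noteq> c j" if "1 \<le> j" "j \<le> s" for i j using False c(1) that by blast
  have "k \<le> 0 \<or> s < k" using nobar [of k 0] c(2) by linarith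
  then show ?thesis
  proof
    assume k: "k \<le> 0"
    have "\<exists>j\<le>0. x i = c j \<and> N dvd j - (i + k)" for i
    proof (induction i rule: int_step_invariant [where k = 0])
      case 1 then show ?case using k c(2) by auto
    next
      case (2 i)
      then obtain j where j: "j \<le> 0" "x i = c j" "N dvd j - (i + k)" by blast
      then have "(c j, x (i + 1)) \<in> E" using x [of i] by simp
      then obtain i' where i': "c i' = c j" "x (i + 1) = c (i' + 1)" "same_place N s i' j"
        using dumbbells_edge_fromE [OF D c(1)] by metis
      have "i' \<noteq> 0" using nobar [of 1 "i + 1"] i'(2) s by auto
      then have "i' + 1 \<le> 0" using i'(3) j(1) s by (auto simp: same_place_def)
      moreover have "N dvd i' - j" using i'(3) by (auto simp: same_place_def)
      then have "N dvd (i' - j) + (j - (i + k))" using j(3) by (rule dvd_add)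
      then have "N dvd (i' + 1) - (i + 1 + k)" by (simp add: algebra_simps)
      ultimately show ?case using i'(2) by blast
    next
      case (3 i)
      then obtain j where j: "j \<le> 0" "x i = c j" "N dvd j - (i + k)" by blast
      then have "(x (i - 1), c j) \<in> E" using x [of "i - 1"] by simp
      then have "x (i - 1) = c (j - 1)" using dumbbells_pred_unique [OF D c(1)] j(1) s by simp
      moreover have "N dvd (j - 1) - (i - 1 + k)" using j(3) by (simp add: algebra_simps)
      moreover have "j - 1 \<le> 0" using j(1) by simp
      ultimately show ?case by blast
    qed
    then have "x i = lcyc N c (i - (- k))" for i using lcyc_eqI [OF ln N] by (metis diff_minus_eq_add)
    then show ?thesis using left c(1) by blast
  next
    assume k: "s < k"
    have "\<exists>j>s. x i = c j \<and> N dvd j - (i + k)" for i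
    proof (induction i rule: int_step_invariant [where k = 0])
      case 1 then show ?case using k c(2) by auto
    next
      case (2 i)
      then obtain j where j: "s < j" "x i = c j" "N dvd j - (i + k)" by blast
      then have "(c j, x (i + 1)) \<in> E" using x [of i] by simp
      then have "x (i + 1) = c (j + 1)" using dumbbells_succ_unique [OF D c(1)] j(1) s by simp
      moreover have "N dvd (j + 1) - (i + 1 + k)" using j(3) by (simp add: algebra_simps)
      moreover have "s < j + 1" using j(1) by simp
      ultimately show ?case by blast
    next
      case (3 i)
      then obtain j where j: "s < j" "x i = c j" "N dvd j - (i + k)" by blast
      then have "(x (i - 1), c j) \<in> E" using x [of "i - 1"] by simp
      then obtain i' where i': "c i' = c j" "x (i - 1) = c (i' - 1)" "same_place N s i' j"
        using dumbbells_edge_toE [OF D c(1)] by metis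
      have "i' \<noteq> s + 1" using nobar [of s "i - 1"] i'(2) s by auto
      then have "s < i' - 1" using i'(3) j(1) s by (auto simp: same_place_def)
      moreover have "N dvd i' - j" using i'(3) by (auto simp: same_place_def)
      then have "N dvd (i' - j) + (j - (i + k))" using j(3) by (rule dvd_add)
      then have "N dvd (i' - 1) - (i - 1 + k)" by (simp add: algebra_simps)
      ultimately show ?case using i'(2) by blast
    qed
    then have "x i = rcyc N s c (i - (- k))" for i using rcyc_eqI [OF ln N] by (metis diff_minus_eq_add)
    then show ?thesis using right c(1) by blast
  qed
qed

lemma left_walk:
  assumes x: "\<And>j. (x j, x (j + 1)) \<in> E" and c: "(c, s) \<in> I" and left: "\<And>j. \<exists>i\<le>0. x j = c i"
  shows "\<exists>p. \<forall>j. x j = lcyc N c (j - p)"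
proof -
  have pos: "c' = c \<and> i \<le> 0" if c': "(c', s') \<in> I" and eq: "x j = c' i" for c' s' i j
  proof -
    obtain i' where "i' \<le> 0" "c' i = c i'" using left [of j] eq by auto
    then show ?thesis
      using dumbbells_D(5) [OF D c' c, of i i'] dumbbells_D(2) [OF D c] by (auto simp: same_place_def line_def)
  qed
  show ?thesis
  proof (rule walk_cases [of x, OF x])
    fix c' s' p assume c': "(c', s') \<in> I" "\<And>j. x j = c' (j - p)"
    have "1 \<le> s'" using dumbbells_D(2) [OF D c'(1)] by (simp add: line_def)
    then show ?thesis using pos [OF c'(1), of "1 + p" 1] c'(2) by simp
  next
    fix c' s' p assume c': "(c', s') \<in> I" "\<And>j. x j = lcyc N c' (j - p)"
    then have "c' = c" using pos [OF c'(1), of 0] by (simp add: lcyc_def)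
    then show ?thesis using c'(2) by blast
  next
    fix c' s' p assume c': "(c', s') \<in> I" "\<And>j. x j = rcyc N s' c' (j - p)"
    have "1 \<le> s'" using dumbbells_D(2) [OF D c'(1)] by (simp add: line_def)
    moreover have "0 \<le> (0 - p - s' - 1) mod N" using dumbbells_D(1) [OF D] by simp
    ultimately show ?thesis using pos [OF c'(1), of 0] c'(2) [of 0] unfolding rcyc_def by fastforce
  qed
qed

lemma right_walk:
  assumes x: "\<And>j. (x j, x (j + 1)) \<in> E" and c: "(c, s) \<in> I" and right: "\<And>j. \<exists>i>s. x j = c i"
  shows "\<exists>p. \<forall>j. x j = rcyc N s c (j - p)"
proof -
  have pos: "c' = c \<and> s' = s \<and> s < i" if c': "(c', s') \<in> I" and eq: "x j = c' i" for c' s' i j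
  proof -
    obtain i' where i': "s < i'" "c i' = c' i" using right [of j] eq by auto
    then show ?thesis
      using dumbbells_D(5) [OF D c c' i'(2)] dumbbells_D(2) [OF D c] by (auto simp: same_place_def line_def)
  qed
  show ?thesis
  proof (rule walk_cases [of x, OF x])
    fix c' s' p assume c': "(c', s') \<in> I" "\<And>j. x j = c' (j - p)"
    have "1 \<le> s'" using dumbbells_D(2) [OF D c'(1)] by (simp add: line_def)
    then show ?thesis using pos [OF c'(1), of "1 + p" 1] c'(2) by simp
  next
    fix c' s' p assume c': "(c', s') \<in> I" "\<And>j. x j = lcyc N c' (j - p)"
    have "1 \<le> s'" using dumbbells_D(2) [OF D c'(1)] by (simp add: line_def)
    moreover have "(0 - p) mod N < N" using dumbbells_D(1) [OF D] by simp
    ultimately show ?thesis using pos [OF c'(1), of 0] c'(2) [of 0] unfolding lcyc_def by fastforce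
  next
    fix c' s' p assume c': "(c', s') \<in> I" "\<And>j. x j = rcyc N s' c' (j - p)"
    then have "c' = c \<and> s' = s" using pos [OF c'(1)] unfolding rcyc_def by blast
    then show ?thesis using c'(2) by blast
  qed
qed

text \<open>
  The periodic ends of a walk cannot contain a vertex of the bar, because the walk visits it only once.
\<close>

lemma crossing_bounds:
  assumes x: "line M x t" and M: "1 \<le> M" and c: "(c, s) \<in> I" "\<And>j. x j = c (j - p)"
  shows "0 \<le> p" "s + p \<le> t"
proof -
  have s: "1 \<le> s" using dumbbells_D(2) [OF D c(1)] by (simp add: line_def)
  have sep: "same_place N s i j" if "c i = c j" for i j using dumbbells_D(5) [OF D c(1) c(1) that] by blast
  show "0 \<le> p"
  proof (rule ccontr)
    assume "\<not> 0 \<le> p"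
    then have "x (p + 1 - M) = x (p + 1)" using x by (simp add: line_def)
    then have "c (1 - M) = c 1" using c(2) by simp
    then show False using sep [of "1 - M" 1] M s by (simp add: same_place_def)
  qed
  show "s + p \<le> t"
  proof (rule ccontr)
    assume "\<not> s + p \<le> t"
    then have "x (s + p + M) = x (s + p)" using x by (simp add: line_def)
    then have "c (s + M) = c s" using c(2) by (simp add: algebra_simps)
    then show False using sep [of "s + M" s] M s by (simp add: same_place_def)
  qed
qed

end

section \<open>Dumbbells of fine partitions\<close>

text \<open>
  A dumbbell of a finer partition projects to a walk in the coarser one.
\<close>

lemma refined_line:
  assumes P: "clopen_partition P" and dec: "\<And>a. a \<in> P \<Longrightarrow> decides k a"
    and g': "looped h P' N' I'" and res: "resolves k P'" and c: "(c', s') \<in> I'"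
  obtains x where "\<And>j. c' j \<subseteq> x j" "\<And>j. (x j, x (j + 1)) \<in> moves h P" "line N' x s'"
proof -
  note D' = loopedD(2) [OF g']
  have "\<exists>a\<in>P. c' j \<subseteq> a" for j
  proof -
    have cj: "c' j \<in> P'" using dumbbells_D(3) [OF D' c] .
    then obtain y where y: "y \<in> c' j" using partition_nonempty [OF loopedD(1) [OF g']] by blast
    obtain a where "a \<in> P" "y \<in> a" using partition_cell [OF P] by blast
    then show ?thesis using decides_cell [OF res dec cj] y by blast
  qed
  then obtain x where x: "\<And>j. x j \<in> P" "\<And>j. c' j \<subseteq> x j" by metis
  have ne: "c' j \<noteq> {}" for j using partition_nonempty [OF loopedD(1) [OF g'] dumbbells_D(3) [OF D' c]] .
  have "(x j, x (j + 1)) \<in> moves h P" for j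
  proof -
    obtain y where "y \<in> c' j" "h y \<in> c' (j + 1)" using dumbbells_D(4) [OF D' c, of j] by (auto simp: moves_def)
    then show ?thesis using x by (blast intro: movesI)
  qed
  moreover have eq: "x i = x j" if "c' i = c' j" for i j
  proof -
    obtain y where "y \<in> c' i" using ne by blast
    then show ?thesis using partition_cell_eq [OF P x(1) x(1)] x(2) that by blast
  qed
  have "line N' x s'" using dumbbells_D(2) [OF D' c] eq unfolding line_def by blast
  ultimately show ?thesis using that x(2) by blast
qed

lemma funpow_preimage: "h \<in> homeos \<Longrightarrow> \<exists>y. (h ^^ n) y = z"
proof (induction n arbitrary: z)
  case (Suc n)
  obtain y where "(h ^^ n) y = inverse_map h z" using Suc by blast
  then have "(h ^^ Suc n) y = z" using homeos_inv_simps(2) [OF Suc.prems] by simp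
  then show ?case by blast
qed simp

lemma funpow_homeos: "h \<in> homeos \<Longrightarrow> h ^^ n \<in> homeos"
proof (induction n)
  case 0
  have "id \<in> homeos" by (rule homeosI [of id id]) (auto simp: continuous_on_id)
  then show ?case by (simp add: id_def [symmetric])
qed (simp add: homeos_comp)

text \<open>
  Let \<open>u\<close> be the cell of a finer partition at position 0 of a line that crosses \<open>c\<close>.  The points that leave \<open>u\<close>
  along the bar reach \<open>c 1\<close> after \<open>p + 1\<close> steps, while other points of \<open>u\<close> go around the finer plate for longer
  than that and are still in the left plate of \<open>c\<close>.  If the partition is so fine that the points of one
  cell share their itineraries of length \<open>T\<close>, this forces \<open>p \<ge> T\<close>.  The bound for the right plate follows in the
  same way from the past of the points at position \<open>s' + 1\<close>.
\<close>

lemma crossing_lines_long: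
  assumes h: "h \<in> homeos" and g: "looped h P N I"
  obtains k where "\<And>P' N' I' c' s' c s p. looped h P' N' I' \<Longrightarrow> resolves k P' \<Longrightarrow> (c', s') \<in> I' \<Longrightarrow>
    (c, s) \<in> I \<Longrightarrow> (\<And>j. c' j \<subseteq> c (j - p)) \<Longrightarrow> int T \<le> p \<and> s + p + int T \<le> s'"
proof -
  note P = loopedD(1) [OF g] and D = loopedD(2) [OF g] and N = dumbbells_D(1) [OF loopedD(2) [OF g]]
  define F where "F = (\<lambda>(i, a). (h ^^ i) -` a) ` ({..T} \<times> P) \<union> (\<lambda>(i, a). (h ^^ i) ` a) ` ({..T} \<times> P) \<union> P"
  have "finite F" using partition_finite [OF P] by (simp add: F_def)
  moreover have "clopen a" if "a \<in> F" for a
    using that partition_clopen [OF P] clopen_image [OF funpow_homeos [OF h]]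
      clopen_homeo_vimage [OF funpow_homeos [OF h]] by (auto simp: F_def)
  ultimately obtain k where k: "\<And>a. a \<in> F \<Longrightarrow> decides k a" using finite_clopen_decides by metis
  have "int T \<le> p \<and> s + p + int T \<le> s'"
    if g': "looped h P' N' I'" and res: "resolves k P'" and c': "(c', s') \<in> I'" and c: "(c, s) \<in> I"
      and over: "\<And>j. c' j \<subseteq> c (j - p)" for P' N' I' c' s' c s p
  proof -
    note P' = loopedD(1) [OF g'] and D' = loopedD(2) [OF g'] and N' = dumbbells_D(1) [OF loopedD(2) [OF g']]
    have ln': "line N' c' s'" using dumbbells_D(2) [OF D' c'] .
    have s: "1 \<le> s" using dumbbells_D(2) [OF D c] by (simp add: line_def)
    have s': "1 \<le> s'" using ln' by (simp add: line_def)
    have ne: "c' j \<noteq> {}" for j using partition_nonempty [OF P' dumbbells_D(3) [OF D' c']] .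
    have cP: "c j \<in> P" for j using dumbbells_D(3) [OF D c] .
    have same: "x \<in> a \<longleftrightarrow> y \<in> a" if "a \<in> F" "x \<in> c' j" "y \<in> c' j" for a x y j
      using k [OF that(1)] res dumbbells_D(3) [OF D' c', of j] that(2,3)
      unfolding resolves_def decides_def by blast
    have sep: "same_place N s i j" if "x \<in> c i" "x \<in> c j" for x i j
      using cells_same_place [OF P D c that] .
    obtain x where x: "\<And>j. c' j \<subseteq> x j" "\<And>j. (x j, x (j + 1)) \<in> moves h P" "line N' x s'"
    proof (rule refined_line [OF P _ g' res c'])
      show "decides k a" if "a \<in> P" for a using k that by (simp add: F_def)
    qed blast
    have xc: "x j = c (j - p)" for j
    proof -
      obtain y where "y \<in> c' j" using ne by blast
      moreover have "x j \<in> P" using x(2) [of j] by (auto simp: moves_def)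
      ultimately show ?thesis using partition_cell_eq [OF P _ cP] x(1) over by blast
    qed
    have pb: "0 \<le> p" "s + p \<le> s'" using crossing_bounds [OF D x(3) N' c xc] by auto
    have "int T \<le> p"
    proof (rule ccontr)
      assume "\<not> int T \<le> p"
      then obtain n where n: "p = int n" "n < T" using pb(1) by (metis nonneg_int_cases not_le zless_nat_conj nat_int of_nat_less_iff)
      define M where "M = N' * (p + 1)"
      have "1 * (p + 1) \<le> N' * (p + 1)" using N' pb(1) by (intro mult_right_mono) auto
      then have M: "p + 1 \<le> M" by (simp add: M_def)
      have "(Suc n, c 1) \<in> {..T} \<times> P" using n(2) cP by simp
      then have "(\<lambda>(i, a). (h ^^ i) -` a) (Suc n, c 1) \<in> F" unfolding F_def by blast
      then have F: "(h ^^ Suc n) -` c 1 \<in> F" by (simp only: prod.case)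
      \<comment> \<open>A point that reaches \<open>c 1\<close> in \<open>p + 1\<close> steps.\<close>
      obtain z1 where z1: "z1 \<in> c' (p + 1)" using ne by blast
      obtain y1 where y1: "(h ^^ Suc n) y1 = z1" using funpow_preimage [OF h] by blast
      have "y1 \<in> c' (p + 1 - int (Suc n))"
        using funpow_back [OF h P' D' c', of "Suc n" y1 "p + 1"] y1 z1 pb s by simp
      then have y1c: "y1 \<in> c' 0" using n(1) by simp
      have "(h ^^ Suc n) y1 \<in> c 1" using y1 z1 over [of "p + 1"] by auto
      then have "y1 \<in> (h ^^ Suc n) -` c 1" by (simp only: vimage_eq)
      \<comment> \<open>A point that spends the next \<open>M > p\<close> steps in the finer left plate.\<close>
      obtain z where z: "z \<in> c' 0" using ne by blast
      obtain y2 where y2: "(h ^^ nat M) y2 = z" using funpow_preimage [OF h] by blast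
      have "y2 \<in> c' (0 - int (nat M))"
        using funpow_back [OF h P' D' c', of "nat M" y2 0] y2 z s' by simp
      moreover have "c' (0 - int (nat M)) = c' 0"
        using same_place_imp_eq [OF ln' N', of "0 - int (nat M)" 0] M pb(1) by (simp add: same_place_def M_def)
      ultimately have "y2 \<in> c' 0" by simp
      then have "(h ^^ Suc n) y2 \<in> c 1" using same [OF F y1c] \<open>y1 \<in> _ -` _\<close> by (simp only: vimage_eq)
      moreover have "(h ^^ (nat M - Suc n)) ((h ^^ Suc n) y2) = z"
      proof -
        have "nat M - Suc n + Suc n = nat M" using M n(1) by simp
        then show ?thesis using y2 by (metis comp_apply funpow_add)
      qed
      then have "(h ^^ Suc n) y2 \<in> c' (0 - int (nat M - Suc n))"
        using funpow_back [OF h P' D' c', of "nat M - Suc n" "(h ^^ Suc n) y2" 0] z s' by simp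
      then have "(h ^^ Suc n) y2 \<in> c (0 - int (nat M - Suc n) - p)" using over by blast
      ultimately have "same_place N s 1 (0 - int (nat M - Suc n) - p)" using sep by blast
      then show False using pb(1) s by (auto simp: same_place_def)
    qed
    moreover have "s + p + int T \<le> s'"
    proof (rule ccontr)
      assume "\<not> s + p + int T \<le> s'"
      then have "0 \<le> s' - p - s" "s' - p - s < int T" using pb(2) by auto
      then obtain n where n: "s' - p - s = int n" "n < T" by (metis nonneg_int_cases of_nat_less_iff)
      define M where "M = N' * (int n + 1)"
      have "1 * (int n + 1) \<le> N' * (int n + 1)" using N' by (intro mult_right_mono) auto
      then have M: "int n + 1 \<le> M" by (simp add: M_def)
      have "(Suc n, c s) \<in> {..T} \<times> P" using n(2) cP by simp
      then have "(\<lambda>(i, a). (h ^^ i) ` a) (Suc n, c s) \<in> F" unfolding F_def by blast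
      then have F: "(h ^^ Suc n) ` c s \<in> F" by (simp only: prod.case)
      \<comment> \<open>A point that came from \<open>c s\<close> within \<open>n + 1\<close> steps.\<close>
      obtain z1 where z1: "z1 \<in> c' (s + p)" using ne by blast
      have "(h ^^ Suc n) z1 \<in> c' (s + p + int (Suc n))"
        using funpow_forth [OF h P' D' c' z1, of "Suc n"] pb s by simp
      then have y1c: "(h ^^ Suc n) z1 \<in> c' (s' + 1)" using n(1) by (simp add: algebra_simps)
      have "z1 \<in> c s" using z1 over [of "s + p"] by auto
      then have y1: "(h ^^ Suc n) z1 \<in> (h ^^ Suc n) ` c s" by (rule imageI)
      \<comment> \<open>A point that has spent the last \<open>M > n\<close> steps in the finer right plate.\<close>
      obtain z where z: "z \<in> c' (s' + 1)" using ne by blast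
      have "(h ^^ nat M) z \<in> c' (s' + 1 + int (nat M))"
        using funpow_forth [OF h P' D' c' z, of "nat M"] s' by simp
      moreover have "N' dvd M" "int (nat M) = M" using M by (simp_all add: M_def)
      then have "c' (s' + 1 + int (nat M)) = c' (s' + 1)"
        using same_place_imp_eq [OF ln' N', of "s' + 1 + int (nat M)" "s' + 1"] M by (simp add: same_place_def)
      ultimately have "(h ^^ nat M) z \<in> c' (s' + 1)" by simp
      then have "(h ^^ nat M) z \<in> (h ^^ Suc n) ` c s" using same [OF F y1c] y1 by blast
      moreover have "(h ^^ nat M) z = (h ^^ Suc n) ((h ^^ (nat M - Suc n)) z)"
      proof -
        have "Suc n + (nat M - Suc n) = nat M" using M by simp
        then show ?thesis by (metis comp_apply funpow_add)
      qed
      moreover have "inj (h ^^ Suc n)" using homeos_bij [OF funpow_homeos [OF h]] bij_is_inj by blast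
      ultimately have "(h ^^ (nat M - Suc n)) z \<in> c s" by (metis inj_image_mem_iff)
      moreover have "(h ^^ (nat M - Suc n)) z \<in> c' (s' + 1 + int (nat M - Suc n))"
        using funpow_forth [OF h P' D' c' z, of "nat M - Suc n"] s' by simp
      then have "(h ^^ (nat M - Suc n)) z \<in> c (s' + 1 + int (nat M - Suc n) - p)" using over by blast
      ultimately have "same_place N s s (s' + 1 + int (nat M - Suc n) - p)" using sep by blast
      then show False using pb(2) s by (auto simp: same_place_def)
    qed
    ultimately show ?thesis ..
  qed
  then show ?thesis using that by blast
qed

text \<open>
  Cut the first cell of the bar into \<open>n\<close> pieces.  Different pieces meet different lines of a finer partition,
  because a line that crosses \<open>c\<close> has only one position over \<open>c 1\<close>.
\<close>

lemma many_crossing_lines: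
  assumes g: "looped h P N I" and c: "(c, s) \<in> I"
  obtains k where "\<And>P' N' I'. looped h P' N' I' \<Longrightarrow> resolves k P' \<Longrightarrow>
    n \<le> card {(c', s'). (c', s') \<in> I' \<and> (\<exists>p. \<forall>j. c' j \<subseteq> c (j - p))}"
proof (cases "n = 0")
  case True
  then show ?thesis using that by simp
next
  case False
  note P = loopedD(1) [OF g] and D = loopedD(2) [OF g]
  have s: "1 \<le> s" using dumbbells_D(2) [OF D c] by (simp add: line_def)
  have c1: "c 1 \<in> P" using dumbbells_D(3) [OF D c] .
  have "\<exists>U. (\<forall>i\<in>{..<n}. clopen (U i) \<and> U i \<noteq> {}) \<and> disjoint_family_on U {..<n} \<and> (\<Union>i\<in>{..<n}. U i) = c 1"
    using False partition_clopen [OF P c1] partition_nonempty [OF P c1] by (intro clopen_split) auto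
  then obtain U where U: "\<And>i. i < n \<Longrightarrow> clopen (U i)" "\<And>i. i < n \<Longrightarrow> U i \<noteq> {}"
    "disjoint_family_on U {..<n}" "(\<Union>i\<in>{..<n}. U i) = c 1" by auto
  have "finite (P \<union> U ` {..<n})" using partition_finite [OF P] by simp
  moreover have "clopen a" if "a \<in> P \<union> U ` {..<n}" for a using that U(1) partition_clopen [OF P] by auto
  ultimately obtain k where k: "\<And>a. a \<in> P \<union> U ` {..<n} \<Longrightarrow> decides k a" using finite_clopen_decides by metis
  have "n \<le> card {(c', s'). (c', s') \<in> I' \<and> (\<exists>p. \<forall>j. c' j \<subseteq> c (j - p))}"
    if g': "looped h P' N' I'" and res: "resolves k P'" for P' N' I'
  proof -
    define C where "C = {(c', s'). (c', s') \<in> I' \<and> (\<exists>p. \<forall>j. c' j \<subseteq> c (j - p))}"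
    note P' = loopedD(1) [OF g'] and D' = loopedD(2) [OF g']
    have "\<exists>l\<in>C. \<exists>j. fst l j \<subseteq> U i" if i: "i < n" for i
    proof -
      obtain y where y: "y \<in> U i" using U(2) [OF i] by blast
      obtain b where b: "b \<in> P'" "y \<in> b" using partition_cell [OF P'] by blast
      then have bU: "b \<subseteq> U i" using decides_cell [OF res k b(1), of "U i"] y i by blast
      obtain c' s' i' where c': "(c', s') \<in> I'" "b = c' i'" using dumbbells_vertexE [OF D' b(1)] by metis
      obtain x where x: "\<And>j. c' j \<subseteq> x j" "\<And>j. (x j, x (j + 1)) \<in> moves h P"
        by (rule refined_line [OF P _ g' res c'(1)]) (use k in blast)+
      have "y \<in> x i'" "y \<in> c 1" using x(1) b c' y U(4) i by blast+
      moreover have "x i' \<in> P" using x(2) [of i'] by (auto simp: moves_def)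
      ultimately have "x i' = c 1" using partition_cell_eq [OF P _ c1] by blast
      then have "x j = c (j - (i' - 1))" for j using walk_through_bar [OF D, where x = x, OF x(2) c, of 1 i'] s by simp
      then have "(c', s') \<in> C" using c'(1) x(1) by (auto simp: C_def)
      then show ?thesis using bU c'(2) by (intro bexI [of _ "(c', s')"]) auto
    qed
    then obtain e where e: "\<And>i. i < n \<Longrightarrow> e i \<in> C \<and> (\<exists>j. fst (e i) j \<subseteq> U i)" by metis
    have "inj_on e {..<n}"
    proof (rule inj_onI)
      fix i i' assume i: "i \<in> {..<n}" "i' \<in> {..<n}" "e i = e i'"
      obtain c' s' where l: "e i = (c', s')" by fastforce
      have c': "(c', s') \<in> I'" using e [of i] i(1) l by (auto simp: C_def)
      obtain p where p: "\<And>j. c' j \<subseteq> c (j - p)" using e [of i] i(1) l by (auto simp: C_def)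
      have "\<exists>j. fst (e i) j \<subseteq> U i" "\<exists>j. fst (e i') j \<subseteq> U i'" using e i(1,2) by blast+
      moreover have "fst (e i) = c'" "fst (e i') = c'" using l i(3) by simp_all
      ultimately obtain j j' where j: "c' j \<subseteq> U i" "c' j' \<subseteq> U i'" by metis
      have ne: "c' j \<noteq> {}" for j using partition_nonempty [OF P' dumbbells_D(3) [OF D' c']] .
      have one: "j - p = 1" if "c' j \<subseteq> c 1" for j
      proof -
        obtain y where "y \<in> c' j" using ne by blast
        then have "same_place N s (j - p) 1" using cells_same_place [OF P D c] that p by blast
        then show ?thesis using s by (auto simp: same_place_def)
      qed
      have "c' j \<subseteq> c 1" "c' j' \<subseteq> c 1" using j U(4) i(1,2) by blast+
      then have "j - p = 1" "j' - p = 1" using one by blast+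
      then have "j = j'" by simp
      then have "U i \<inter> U i' \<noteq> {}" using j ne by blast
      then show "i = i'" using U(3) i(1,2) by (auto simp: disjoint_family_on_def)
    qed
    moreover have "e ` {..<n} \<subseteq> C" using e by blast
    moreover have "finite C"
      by (rule finite_subset [OF _ dumbbells_finite [OF D' partition_finite [OF P']]]) (auto simp: C_def)
    ultimately have "card {..<n} \<le> card C" by (intro card_inj_on_le) auto
    then show ?thesis by (simp add: C_def)
  qed
  then show ?thesis using that by blast
qed

lemma line_in_invariant_set:
  assumes g: "looped h P N I" and A: "decides k A" "h ` A = A" and inj: "inj h" and res: "resolves k P"
    and c: "(c, s) \<in> I" and i: "c i \<inter> A \<noteq> {}"
  shows "c j \<subseteq> A"
proof (induction j rule: int_step_invariant [where k = i])
  have cP: "c j \<in> P" for j using dumbbells_D(3) [OF loopedD(2) [OF g] c] .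
  have in_A: "c j \<subseteq> A" if "c j \<inter> A \<noteq> {}" for j using decides_cell [OF res A(1) cP that] .
  have step: "\<exists>y. y \<in> c j \<and> h y \<in> c (j + 1)" for j
    using dumbbells_D(4) [OF loopedD(2) [OF g] c, of j] by (auto elim: movesE)
  have iff: "h y \<in> A \<longleftrightarrow> y \<in> A" for y using A(2) inj by (metis inj_image_mem_iff)
  {
    case 1 show ?case using in_A i by blast
  next
    case (2 j)
    then show ?case using step [of j] iff in_A [of "j + 1"] by blast
  next
    case (3 j)
    then show ?case using step [of "j - 1"] iff in_A [of "j - 1"] by force
  }
qed

text \<open>
  Some line of a suitable looped partition lies in \<open>A\<close>.  The lines of finer partitions that cross it lie in \<open>A\<close>
  too; they are long and numerous.
\<close>

lemma many_long_lines_in_invariant_set: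
  assumes h: "h \<in> homeos" and st: "\<And>m. 1 \<le> m \<Longrightarrow> looped_at m h"
    and A: "clopen A" "A \<noteq> {}" "h ` A = A"
  obtains k where "\<And>P' N' I'. looped h P' N' I' \<Longrightarrow> resolves k P' \<Longrightarrow>
    n \<le> card {(c', s'). (c', s') \<in> I' \<and> int T \<le> s' \<and> (\<forall>j. c' j \<subseteq> A)}"
proof -
  obtain k0 where "decides k0 A" using clopen_decides A(1) by blast
  then have k0: "decides (Suc k0) A" using decides_mono by force
  obtain P N I where P: "resolves (Suc k0) P" and g: "looped h P N I"
    using st [of "Suc k0"] by (auto simp: looped_at_def)
  obtain y where y: "y \<in> A" using A(2) by blast
  obtain b where b: "b \<in> P" "y \<in> b" using partition_cell [OF loopedD(1) [OF g]] by blast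
  obtain c s i where c: "(c, s) \<in> I" "b = c i" using dumbbells_vertexE [OF loopedD(2) [OF g] b(1)] by metis
  have cA: "c j \<subseteq> A" for j
    using line_in_invariant_set [OF g k0 A(3) bij_is_inj [OF homeos_bij [OF h]] P c(1)] y b c(2) by blast
  have s: "1 \<le> s" using dumbbells_D(2) [OF loopedD(2) [OF g] c(1)] by (simp add: line_def)
  obtain k1 where k1: "\<And>P' N' I' c' s' p. looped h P' N' I' \<Longrightarrow> resolves k1 P' \<Longrightarrow> (c', s') \<in> I' \<Longrightarrow>
    (\<And>j. c' j \<subseteq> c (j - p)) \<Longrightarrow> int T \<le> p \<and> s + p + int T \<le> s'"
    using crossing_lines_long [OF h g, of T] c(1) by metis
  obtain k2 where k2: "\<And>P' N' I'. looped h P' N' I' \<Longrightarrow> resolves k2 P' \<Longrightarrow>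
    n \<le> card {(c', s'). (c', s') \<in> I' \<and> (\<exists>p. \<forall>j. c' j \<subseteq> c (j - p))}"
    by (rule many_crossing_lines [OF g c(1), where n = n]) (rule that, blast)
  have "n \<le> card {(c', s'). (c', s') \<in> I' \<and> int T \<le> s' \<and> (\<forall>j. c' j \<subseteq> A)}"
    if g': "looped h P' N' I'" and res: "resolves (max k1 k2) P'" for P' N' I'
  proof -
    have r: "resolves k1 P'" "resolves k2 P'" using resolves_mono [OF res] by auto
    have "{(c', s'). (c', s') \<in> I' \<and> (\<exists>p. \<forall>j. c' j \<subseteq> c (j - p))} \<subseteq>
        {(c', s'). (c', s') \<in> I' \<and> int T \<le> s' \<and> (\<forall>j. c' j \<subseteq> A)}"
    proof
      fix l assume "l \<in> {(c', s'). (c', s') \<in> I' \<and> (\<exists>p. \<forall>j. c' j \<subseteq> c (j - p))}"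
      then obtain c' s' p where c': "l = (c', s')" "(c', s') \<in> I'" "\<And>j. c' j \<subseteq> c (j - p)" by auto
      then have "int T \<le> p \<and> s + p + int T \<le> s'" using k1 [OF g' r(1)] by blast
      moreover have "c' j \<subseteq> A" for j using c'(3) [of j] cA by blast
      ultimately show "l \<in> {(c', s'). (c', s') \<in> I' \<and> int T \<le> s' \<and> (\<forall>j. c' j \<subseteq> A)}"
        using c'(1,2) s by auto
    qed
    moreover have "finite {(c', s'). (c', s') \<in> I' \<and> int T \<le> s' \<and> (\<forall>j. c' j \<subseteq> A)}"
      by (rule finite_subset [OF _ dumbbells_finite [OF loopedD(2) [OF g'] partition_finite [OF loopedD(1) [OF g']]]]) auto
    ultimately show ?thesis using order_trans [OF k2 [OF g' r(2)] card_mono] by blast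
  qed
  then show ?thesis using that by blast
qed

section \<open>Lifting graph maps to fine partitions\<close>

text \<open>
  The walk \<open>x\<close> lies above the line \<open>l\<close> with respect to \<open>\<phi>\<close> and has its periodicity, so that mapping the vertex at
  position \<open>j\<close> of \<open>l\<close> to \<open>x j\<close> defines a graph map on the dumbbell of \<open>l\<close>.
\<close>

definition lifts :: "int \<Rightarrow> ('a \<times> 'a) set \<Rightarrow> ('a \<Rightarrow> cantor set) \<Rightarrow> (int \<Rightarrow> cantor set) \<times> int \<Rightarrow> (int \<Rightarrow> 'a) \<Rightarrow> bool" where
  "lifts N E \<phi> l x \<longleftrightarrow> (\<forall>j. (x j, x (j + 1)) \<in> E) \<and> line N x (snd l) \<and> (\<forall>j. fst l j \<subseteq> \<phi> (x j))"

text \<open>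
  All sufficiently fine looped partitions of \<open>h\<close> whose plate weight is a multiple of \<open>M\<close> have the property \<open>\<Phi>\<close>.
\<close>

definition if_fine :: "(cantor \<Rightarrow> cantor) \<Rightarrow> int \<Rightarrow> (int \<Rightarrow> ((int \<Rightarrow> cantor set) \<times> int) set \<Rightarrow> bool) \<Rightarrow> bool" where
  "if_fine h M \<Phi> \<longleftrightarrow> (\<exists>k. \<forall>P N I. looped h P N I \<longrightarrow> resolves k P \<longrightarrow> M dvd N \<longrightarrow> \<Phi> N I)"

lemma if_fineI: "(\<And>P N I. looped h P N I \<Longrightarrow> resolves k P \<Longrightarrow> M dvd N \<Longrightarrow> \<Phi> N I) \<Longrightarrow> if_fine h M \<Phi>"
  unfolding if_fine_def by blast

lemma if_fine_conj:
  assumes "if_fine h M \<Phi>" "if_fine h M \<Psi>"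
  shows "if_fine h M (\<lambda>N I. \<Phi> N I \<and> \<Psi> N I)"
proof -
  obtain k1 k2 where k: "\<And>P N I. looped h P N I \<Longrightarrow> resolves k1 P \<Longrightarrow> M dvd N \<Longrightarrow> \<Phi> N I"
    "\<And>P N I. looped h P N I \<Longrightarrow> resolves k2 P \<Longrightarrow> M dvd N \<Longrightarrow> \<Psi> N I"
    using assms unfolding if_fine_def by metis
  show ?thesis
    by (rule if_fineI [where k = "max k1 k2"]) (use k resolves_mono in \<open>meson max.cobounded1 max.cobounded2\<close>)
qed

lemma if_fine_ball:
  assumes "finite J" "\<And>i. i \<in> J \<Longrightarrow> if_fine h M (\<Phi> i)"
  shows "if_fine h M (\<lambda>N I. \<forall>i\<in>J. \<Phi> i N I)"
  using assms
proof (induction J rule: finite_induct)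
  case empty
  then show ?case by (simp add: if_fine_def)
next
  case (insert i J)
  then have "if_fine h M (\<lambda>N I. \<Phi> i N I \<and> (\<forall>i\<in>J. \<Phi> i N I))" by (intro if_fine_conj) auto
  then show ?case by simp
qed

lemma if_fine_mono:
  assumes "if_fine h M \<Phi>" "\<And>P N I. looped h P N I \<Longrightarrow> M dvd N \<Longrightarrow> \<Phi> N I \<Longrightarrow> \<Psi> N I"
  shows "if_fine h M \<Psi>"
  using assms unfolding if_fine_def by metis

lemma line_shift:
  assumes c: "line M c s" and M: "1 \<le> M" "M dvd N" "1 \<le> N" and \<tau>: "0 \<le> \<tau>" "s + \<tau> \<le> t"
  shows "line N (\<lambda>j. c (j - \<tau>)) t"
  unfolding line_def
proof (intro conjI allI impI)
  show "1 \<le> t" using c \<tau> by (simp add: line_def)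
  fix j
  show "c (j - N - \<tau>) = c (j - \<tau>)" if "j \<le> 0"
    using that M \<tau> by (intro same_place_imp_eq [OF c M(1)]) (simp add: same_place_def)
  show "c (j + N - \<tau>) = c (j - \<tau>)" if "t < j"
    using that M \<tau> by (intro same_place_imp_eq [OF c M(1)]) (simp add: same_place_def)
qed

lemma line_periodic:
  assumes "\<And>i j. M dvd i - j \<Longrightarrow> y i = y j" "M dvd N" "1 \<le> t"
  shows "line N (\<lambda>j. y (j - \<tau>)) t"
  unfolding line_def using assms by auto

lemma lcyc_walk:
  assumes D: "dumbbells V E N I" and c: "(c, s) \<in> I"
  obtains i where "i < 0" "N dvd i - j" "lcyc N c j = c i" "(lcyc N c j, lcyc N c (j + 1)) \<in> E"
proof -
  note N = dumbbells_D(1) [OF D] and ln = dumbbells_D(2) [OF D c]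
  define i where "i = j mod N - N"
  have i: "i < 0" "N dvd i - j"
  proof -
    show "i < 0" using N by (simp add: i_def)
    have "N dvd j mod N - j - N" by (rule dvd_diff) (simp_all add: mod_eq_dvd_iff [symmetric])
    then show "N dvd i - j" by (simp add: i_def algebra_simps)
  qed
  have "lcyc N c j = c i" using i by (intro lcyc_eqI [OF ln N]) auto
  moreover have "lcyc N c (j + 1) = c (i + 1)" using i by (intro lcyc_eqI [OF ln N]) auto
  ultimately show ?thesis using that [OF i] dumbbells_D(4) [OF D c, of i] by simp
qed

lemma rcyc_walk:
  assumes D: "dumbbells V E N I" and c: "(c, s) \<in> I"
  obtains i where "s < i" "N dvd i - j" "rcyc N s c j = c i" "(rcyc N s c j, rcyc N s c (j + 1)) \<in> E"
proof -
  note N = dumbbells_D(1) [OF D] and ln = dumbbells_D(2) [OF D c]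
  define i where "i = s + 1 + (j - s - 1) mod N"
  have i: "s < i" "N dvd i - j"
  proof -
    have "0 \<le> (j - s - 1) mod N" using N by simp
    then show "s < i" by (simp add: i_def)
    have "N dvd (j - s - 1) mod N - (j - s - 1)" by (simp add: mod_eq_dvd_iff [symmetric])
    then show "N dvd i - j" by (simp add: i_def algebra_simps)
  qed
  have "rcyc N s c j = c i" using i by (intro rcyc_eqI [OF ln N]) auto
  moreover have "rcyc N s c (j + 1) = c (i + 1)" using i by (intro rcyc_eqI [OF ln N]) auto
  ultimately show ?thesis using that [OF i] dumbbells_D(4) [OF D c, of i] by simp
qed

lemma assemble_hom:
  assumes D': "dumbbells V' E' N' I'" and D: "dumbbells V E N I"
    and X: "\<And>l j. l \<in> I' \<Longrightarrow> (X l j, X l (j + 1)) \<in> E" "\<And>l. l \<in> I' \<Longrightarrow> line N' (X l) (snd l)"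
    and cover: "\<And>c s. (c, s) \<in> I \<Longrightarrow> \<exists>l\<in>I'. \<exists>\<tau>. X l = (\<lambda>j. c (j - \<tau>))"
  obtains \<psi> where "\<And>c s j. (c, s) \<in> I' \<Longrightarrow> \<psi> (c j) = X (c, s) j" "E = map_prod \<psi> \<psi> ` E'"
proof -
  define \<psi> where "\<psi> = (\<lambda>a. SOME b. \<exists>c s j. (c, s) \<in> I' \<and> a = c j \<and> b = X (c, s) j)"
  have \<psi>: "\<psi> (c j) = X (c, s) j" if c: "(c, s) \<in> I'" for c s j
    unfolding \<psi>_def
  proof (rule some_equality)
    show "\<exists>c' s' j'. (c', s') \<in> I' \<and> c j = c' j' \<and> X (c, s) j = X (c', s') j'" using c by blast
    fix b assume "\<exists>c' s' j'. (c', s') \<in> I' \<and> c j = c' j' \<and> b = X (c', s') j'"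
    then obtain c' s' j' where b: "(c', s') \<in> I'" "c j = c' j'" "b = X (c', s') j'" by blast
    have e: "c = c' \<and> s = s' \<and> same_place N' s j j'" by (rule dumbbells_D(5) [OF D' c b(1,2)])
    then have "X (c, s) j = X (c, s) j'"
      using same_place_imp_eq [OF X(2) [OF c] dumbbells_D(1) [OF D'], of j j'] by (metis snd_conv)
    then show "b = X (c, s) j" using e b(3) by simp
  qed
  have "E = map_prod \<psi> \<psi> ` E'"
  proof (intro equalityI subsetI)
    fix e assume e: "e \<in> E"
    then obtain c s j where c: "(c, s) \<in> I" "e = (c j, c (j + 1))"
      using dumbbells_edgeE [OF D] by (metis prod.exhaust)
    obtain c' s' \<tau> where l: "(c', s') \<in> I'" "X (c', s') = (\<lambda>j. c (j - \<tau>))" using cover [OF c(1)] by fastforce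
    have "e = map_prod \<psi> \<psi> (c' (j + \<tau>), c' (j + \<tau> + 1))" using \<psi> [OF l(1)] l(2) c(2) by (simp add: algebra_simps)
    then show "e \<in> map_prod \<psi> \<psi> ` E'" using dumbbells_D(4) [OF D' l(1)] by blast
  next
    fix e assume "e \<in> map_prod \<psi> \<psi> ` E'"
    then obtain a b where e: "e = (\<psi> a, \<psi> b)" "(a, b) \<in> E'" by auto
    obtain c s j where "(c, s) \<in> I'" "a = c j" "b = c (j + 1)" using dumbbells_edgeE [OF D' e(2)] by metis
    then show "e \<in> E" using e(1) \<psi> X(1) by simp
  qed
  then show ?thesis using that \<psi> by blast
qed

text \<open>
  The greedy choice never gets stuck, since each candidate set has at least as many elements as there are choices
  to make.
\<close>

lemma distinct_representatives:
  assumes "finite J" "\<And>i. i \<in> J \<Longrightarrow> finite (C i) \<and> card J \<le> card (C i)"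
  shows "\<exists>e. inj_on e J \<and> (\<forall>i\<in>J. e i \<in> C i)"
  using assms
proof (induction J rule: finite_induct)
  case (insert i J)
  have "\<exists>e. inj_on e J \<and> (\<forall>i\<in>J. e i \<in> C i)"
    using insert.prems insert.hyps by (intro insert.IH) fastforce
  then obtain e where e: "inj_on e J" "\<forall>i\<in>J. e i \<in> C i" by blast
  have "card (e ` J) < card (C i)"
    using insert.prems [of i] insert.hyps card_image_le [of J e] by simp
  then have "\<not> C i \<subseteq> e ` J" using insert.hyps(1) card_mono [of "e ` J" "C i"] by auto
  then obtain x where x: "x \<in> C i" "x \<notin> e ` J" by blast
  have "inj_on (e(i := x)) (insert i J)" using e(1) x(2) insert.hyps(2) by (auto simp: inj_on_def)
  moreover have "\<forall>i'\<in>insert i J. (e(i := x)) i' \<in> C i'" using e(2) x(1) by auto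
  ultimately show ?case by blast
qed simp

text \<open>
  The set of candidates for a dumbbell \<open>(c, s)\<close> of the target consists of the lines that can be mapped onto it.
  If all these sets are large, each dumbbell of the target is covered by a line of its own.  The remaining lines
  can follow any lift.
\<close>

lemma looped_at_lift:
  assumes st: "\<And>m. 1 \<le> m \<Longrightarrow> looped_at m h" and D: "dumbbells V E (fact q) J" and V: "finite V"
    and lift: "if_fine h (fact q) (\<lambda>N I. \<forall>l\<in>I. \<exists>x. lifts N E \<phi> l x)"
    and onto: "\<And>c s. (c, s) \<in> J \<Longrightarrow>
      if_fine h (fact q) (\<lambda>N I. card J \<le> card {l \<in> I. \<exists>\<tau>. lifts N E \<phi> l (\<lambda>j. c (j - \<tau>))})"
  obtains P q' I \<psi> where "looped h P (fact q') I" "q \<le> q'" "resolves m P"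
    "E = map_prod \<psi> \<psi> ` moves h P" "\<And>a. a \<in> P \<Longrightarrow> a \<subseteq> \<phi> (\<psi> a)"
proof -
  have finJ: "finite J" using dumbbells_finite [OF D V] .
  have "if_fine h (fact q) (\<lambda>N I. \<forall>i\<in>J. card J \<le> card {l \<in> I. \<exists>\<tau>. lifts N E \<phi> l (\<lambda>j. fst i (j - \<tau>))})"
  proof (rule if_fine_ball [OF finJ])
    fix i assume "i \<in> J"
    then show "if_fine h (fact q) (\<lambda>N I. card J \<le> card {l \<in> I. \<exists>\<tau>. lifts N E \<phi> l (\<lambda>j. fst i (j - \<tau>))})"
      using onto [of "fst i" "snd i"] by simp
  qed
  from if_fine_conj [OF lift this] obtain k where k: "\<And>P N I. looped h P N I \<Longrightarrow> resolves k P \<Longrightarrow> fact q dvd N \<Longrightarrow>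
      (\<forall>l\<in>I. \<exists>x. lifts N E \<phi> l x) \<and>
      (\<forall>i\<in>J. card J \<le> card {l \<in> I. \<exists>\<tau>. lifts N E \<phi> l (\<lambda>j. fst i (j - \<tau>))})"
    unfolding if_fine_def by blast
  \<comment> \<open>As \<open>q'\<close> is a multiple of \<open>m'\<close>, this makes \<open>q'\<close> at least \<open>q\<close>, and \<open>q!\<close> divides \<open>q'!\<close>.\<close>
  define m' where "m' = Suc (max (max k m) q)"
  obtain P q' I where P: "resolves m' P" "1 \<le> q'" "m' dvd q'" and g: "looped h P (fact q') I"
    using st [of m'] by (auto simp: looped_at_def m'_def)
  have "m' \<le> q'" using P(2,3) by (intro dvd_imp_le) auto
  then have q: "q \<le> q'" by (simp add: m'_def)
  have res: "resolves k P" "resolves m P" using resolves_mono [OF P(1)] by (auto simp: m'_def)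
  have "fact q dvd (fact q' :: int)" using q by (rule fact_dvd)
  then have k': "\<forall>l\<in>I. \<exists>x. lifts (fact q') E \<phi> l x"
    "\<forall>i\<in>J. card J \<le> card {l \<in> I. \<exists>\<tau>. lifts (fact q') E \<phi> l (\<lambda>j. fst i (j - \<tau>))}"
    using k [OF g res(1)] by blast+
  note P' = loopedD(1) [OF g] and D' = loopedD(2) [OF g]
  have finI: "finite I" using dumbbells_finite [OF D' partition_finite [OF P']] .
  obtain x0 where x0: "\<And>l. l \<in> I \<Longrightarrow> lifts (fact q') E \<phi> l (x0 l)" using k'(1) by metis
  have "\<exists>e. inj_on e J \<and> (\<forall>i\<in>J. e i \<in> {l \<in> I. \<exists>\<tau>. lifts (fact q') E \<phi> l (\<lambda>j. fst i (j - \<tau>))})"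
    using finI k'(2) by (intro distinct_representatives [OF finJ]) auto
  then obtain e where e: "inj_on e J" "\<And>i. i \<in> J \<Longrightarrow> e i \<in> I"
    "\<And>i. i \<in> J \<Longrightarrow> \<exists>\<tau>. lifts (fact q') E \<phi> (e i) (\<lambda>j. fst i (j - \<tau>))" by auto
  then obtain \<tau> where \<tau>: "\<And>i. i \<in> J \<Longrightarrow> lifts (fact q') E \<phi> (e i) (\<lambda>j. fst i (j - \<tau> i))" by metis
  define X where "X = (\<lambda>l. if l \<in> e ` J then (\<lambda>j. fst (inv_into J e l) (j - \<tau> (inv_into J e l))) else x0 l)"
  have Xe: "X (e i) = (\<lambda>j. fst i (j - \<tau> i))" if "i \<in> J" for i
    using that e(1) by (simp add: X_def)
  have X: "lifts (fact q') E \<phi> l (X l)" if l: "l \<in> I" for l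
  proof (cases "l \<in> e ` J")
    case True
    then obtain i where "i \<in> J" "l = e i" by blast
    then show ?thesis using Xe \<tau> by simp
  next
    case False
    then show ?thesis using x0 [OF l] by (simp add: X_def)
  qed
  obtain \<psi> where \<psi>: "\<And>c s j. (c, s) \<in> I \<Longrightarrow> \<psi> (c j) = X (c, s) j" "E = map_prod \<psi> \<psi> ` moves h P"
  proof (rule assemble_hom [OF D' D])
    show "(X l j, X l (j + 1)) \<in> E" if "l \<in> I" for l j using X [OF that] by (simp add: lifts_def)
    show "line (fact q') (X l) (snd l)" if "l \<in> I" for l using X [OF that] by (simp add: lifts_def)
    show "\<exists>l\<in>I. \<exists>\<tau>. X l = (\<lambda>j. c (j - \<tau>))" if "(c, s) \<in> J" for c s
      using Xe [OF that] e(2) [OF that] by force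
  qed blast
  have "a \<subseteq> \<phi> (\<psi> a)" if "a \<in> P" for a
  proof -
    obtain c s j where c: "(c, s) \<in> I" "a = c j" using dumbbells_vertexE [OF D' \<open>a \<in> P\<close>] by metis
    then show ?thesis using X [OF c(1)] \<psi>(1) [OF c(1)] by (simp add: lifts_def)
  qed
  then show ?thesis using that g q res(2) \<psi>(2) by blast
qed

text \<open>
  A line over the cycle \<open>z\<close> differs from \<open>c0\<close> only by its phase modulo \<open>N0\<close>.  Delaying \<open>c0\<close> by fewer than \<open>N0\<close> steps
  matches the phases, and a bar of length at least \<open>N0 + s0\<close> has room for this delay.
\<close>

lemma cyclic_many_lifts:
  assumes h: "h \<in> homeos" and st: "\<And>m. 1 \<le> m \<Longrightarrow> looped_at m h"
    and A: "clopen A" "A \<noteq> {}" "h ` A = A"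
    and z: "\<And>i j. N0 dvd i - j \<Longrightarrow> z i = z j" "1 \<le> N0"
    and over: "if_fine h M (\<lambda>N I. \<forall>(c, s)\<in>I. (\<forall>j. c j \<subseteq> A) \<longrightarrow> (\<exists>p. \<forall>j. c j \<subseteq> z (j - p)))"
    and M: "1 \<le> M" and c0: "line M c0 s0" "\<And>j. (c0 j, c0 (j + 1)) \<in> E" "\<And>j. \<phi> (c0 j) = z (j - p0)"
  shows "if_fine h M (\<lambda>N I. n \<le> card {l \<in> I. \<exists>\<tau>. lifts N E \<phi> l (\<lambda>j. c0 (j - \<tau>))})"
proof -
  have s0: "1 \<le> s0" using c0(1) by (simp add: line_def)
  have "if_fine h M (\<lambda>N I. n \<le> card {(c, s). (c, s) \<in> I \<and> int (nat (N0 + s0)) \<le> s \<and> (\<forall>j. c j \<subseteq> A)})"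
    by (rule many_long_lines_in_invariant_set [OF h st A, where n = n and T = "nat (N0 + s0)"])
      (assumption, rule if_fineI, blast)
  from if_fine_conj [OF over this] show ?thesis
  proof (rule if_fine_mono)
    fix P N I
    assume g: "looped h P N I" and MN: "M dvd N"
      and *: "(\<forall>(c, s)\<in>I. (\<forall>j. c j \<subseteq> A) \<longrightarrow> (\<exists>p. \<forall>j. c j \<subseteq> z (j - p))) \<and>
        n \<le> card {(c, s). (c, s) \<in> I \<and> int (nat (N0 + s0)) \<le> s \<and> (\<forall>j. c j \<subseteq> A)}"
    note N = dumbbells_D(1) [OF loopedD(2) [OF g]]
    have "{(c, s). (c, s) \<in> I \<and> int (nat (N0 + s0)) \<le> s \<and> (\<forall>j. c j \<subseteq> A)} \<subseteq>
        {l \<in> I. \<exists>\<tau>. lifts N E \<phi> l (\<lambda>j. c0 (j - \<tau>))}"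
    proof
      fix l assume "l \<in> {(c, s). (c, s) \<in> I \<and> int (nat (N0 + s0)) \<le> s \<and> (\<forall>j. c j \<subseteq> A)}"
      then obtain c s where l: "l = (c, s)" "(c, s) \<in> I" "N0 + s0 \<le> s" "\<forall>j. c j \<subseteq> A"
        using z(2) s0 by auto
      then obtain p where p: "\<And>j. c j \<subseteq> z (j - p)" using * by blast
      define \<tau> where "\<tau> = (p - p0) mod N0"
      have \<tau>: "0 \<le> \<tau>" "\<tau> < N0" using z(2) by (simp_all add: \<tau>_def)
      have "z (j - \<tau> - p0) = z (j - p)" for j
      proof (rule z(1))
        have "N0 dvd (p - p0) - (p - p0) mod N0" by (simp add: mod_eq_dvd_iff [symmetric])
        then show "N0 dvd (j - \<tau> - p0) - (j - p)" by (simp add: \<tau>_def algebra_simps)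
      qed
      then have "c j \<subseteq> \<phi> (c0 (j - \<tau>))" for j using p c0(3) by simp
      moreover have "line N (\<lambda>j. c0 (j - \<tau>)) s"
        using line_shift [OF c0(1) M MN N] \<tau> l(3) by simp
      moreover have "(c0 (j - \<tau>), c0 (j + 1 - \<tau>)) \<in> E" for j
        using c0(2) [of "j - \<tau>"] by (simp add: algebra_simps)
      ultimately show "l \<in> {l \<in> I. \<exists>\<tau>. lifts N E \<phi> l (\<lambda>j. c0 (j - \<tau>))}"
        using l(1,2) by (auto simp: lifts_def)
    qed
    moreover have "finite {l \<in> I. \<exists>\<tau>. lifts N E \<phi> l (\<lambda>j. c0 (j - \<tau>))}"
      using dumbbells_finite [OF loopedD(2) [OF g] partition_finite [OF loopedD(1) [OF g]]] by simp
    ultimately show "n \<le> card {l \<in> I. \<exists>\<tau>. lifts N E \<phi> l (\<lambda>j. c0 (j - \<tau>))}"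
      using order_trans [OF _ card_mono] * by blast
  qed
qed

text \<open>
  One step of the back-and-forth: \<open>\<phi>\<close> maps the graph of \<open>g\<close> on \<open>Q\<close> onto the graph of \<open>f\<close> on \<open>P\<close>, and the plate weight of
  \<open>P\<close> divides that of \<open>Q\<close>.
\<close>

definition link where
  "link f P q I g Q q' J \<phi> \<longleftrightarrow> looped f P (fact q) I \<and> looped g Q (fact q') J \<and> q \<le> q' \<and>
     moves f P = map_prod \<phi> \<phi> ` moves g Q"

text \<open>
  Nothing lies below \<open>P\<close> yet, so all lines count as lines over a cycle of period 1, and the whole space serves as
  the invariant set.
\<close>

lemma link_start:
  assumes g: "g \<in> homeos" and st: "\<And>m. 1 \<le> m \<Longrightarrow> looped_at m g" and gP: "looped h P (fact q) I"
  obtains Q q' J \<psi> where "link h P q I g Q q' J \<psi>"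
proof -
  note P = loopedD(1) [OF gP] and D = loopedD(2) [OF gP]
  obtain a where "a \<in> P" using partition_cell [OF P] by blast
  then obtain c s where c: "(c, s) \<in> I" using dumbbells_vertexE [OF D] by metis
  define \<phi> where "\<phi> = (\<lambda>_ :: cantor set. UNIV :: cantor set)"
  have N: "1 \<le> (fact q :: int)" by (simp add: fact_ge_1)
  have lift: "if_fine g (fact q) (\<lambda>N J. \<forall>l\<in>J. \<exists>x. lifts N (moves h P) \<phi> l x)"
  proof (rule if_fineI [where k = 0], intro ballI)
    fix Q N J l assume gQ: "looped g Q N J" and dv: "fact q dvd N" and l: "l \<in> J"
    have s: "1 \<le> snd l" using dumbbells_D(2) [OF loopedD(2) [OF gQ], of "fst l" "snd l"] l by (simp add: line_def)
    have "(lcyc (fact q) c (j - 0), lcyc (fact q) c (j + 1 - 0)) \<in> moves h P" for j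
      by (rule lcyc_walk [OF D c, of j]) simp
    moreover have "line N (\<lambda>j. lcyc (fact q) c (j - 0)) (snd l)"
      by (rule line_periodic [where M = "fact q"]) (use lcyc_periodic dv s in blast)+
    ultimately have "lifts N (moves h P) \<phi> l (\<lambda>j. lcyc (fact q) c (j - 0))" by (simp add: lifts_def \<phi>_def)
    then show "\<exists>x. lifts N (moves h P) \<phi> l x" by blast
  qed
  have onto: "if_fine g (fact q) (\<lambda>N J. card I \<le> card {l \<in> J. \<exists>\<tau>. lifts N (moves h P) \<phi> l (\<lambda>j. c (j - \<tau>))})"
    if c: "(c, s) \<in> I" for c s
  proof (rule cyclic_many_lifts [OF g st, where A = UNIV and z = "\<lambda>_. UNIV" and ?N0.0 = 1 and ?p0.0 = 0])
    show "line (fact q) c s" using dumbbells_D(2) [OF D c] .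
    show "(c j, c (j + 1)) \<in> moves h P" for j using dumbbells_D(4) [OF D c] .
    show "g ` UNIV = UNIV" using homeos_bij [OF g] by (simp add: bij_is_surj)
  qed (auto simp: \<phi>_def if_fine_def N)
  obtain Q q' J \<psi> where "looped g Q (fact q') J" "q \<le> q'" "moves h P = map_prod \<psi> \<psi> ` moves g Q"
    by (rule looped_at_lift [OF st D partition_finite [OF P] lift onto, where m = 0]) blast+
  then show ?thesis using that gP by (auto simp: link_def)
qed

text \<open>
  The projection of a fine line to \<open>P\<close> and the projection of a line of \<open>Q\<close> to \<open>P\<close> are compared by \<open>walk_cases\<close>.
  Fine lines that cross a dumbbell of \<open>P\<close> are mapped onto any line of \<open>Q\<close> that crosses the same dumbbell, delayed by
  the difference of the crossing times.  Fine lines over a plate are mapped into a plate of such a line of \<open>Q\<close>, or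
  onto lines of \<open>Q\<close> over the same plate if they are long.
\<close>

lemma link_extend:
  assumes h: "h \<in> homeos" and st: "\<And>m. 1 \<le> m \<Longrightarrow> looped_at m h" and L: "link h P q I g Q q' J \<phi>"
  obtains P' q'' I' \<psi> where "link g Q q' J h P' q'' I' \<psi>" "resolves m P'" "\<And>a. a \<in> P' \<Longrightarrow> a \<subseteq> \<phi> (\<psi> a)"
proof -
  have gP: "looped h P (fact q) I" and gQ: "looped g Q (fact q') J" and q: "q \<le> q'"
    and E: "moves h P = map_prod \<phi> \<phi> ` moves g Q" using L by (auto simp: link_def)
  define N M :: int where "N = fact q" and "M = fact q'"
  note P = loopedD(1) [OF gP] and D = loopedD(2) [OF gP, folded N_def]
  note Q = loopedD(1) [OF gQ] and DQ = loopedD(2) [OF gQ, folded M_def]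
  have N: "1 \<le> N" and M: "1 \<le> M" by (simp_all add: N_def M_def fact_ge_1)
  have NM: "N dvd M" unfolding N_def M_def using q by (rule fact_dvd)
  have finJ: "finite J" using dumbbells_finite [OF DQ partition_finite [OF Q]] .
  have walk: "(\<phi> (c' j), \<phi> (c' (j + 1))) \<in> moves h P" if "(c', s') \<in> J" for c' s' j
    using dumbbells_D(4) [OF DQ that, of j] unfolding E by (metis image_eqI map_prod_simp)
  have ln: "line M (\<lambda>j. \<phi> (c' j)) s'" if "(c', s') \<in> J" for c' s'
    using dumbbells_D(2) [OF DQ that] by (simp add: line_def)
  have sep: "c1 = c2 \<and> s1 = s2 \<and> same_place N s1 i j"
    if "(c1, s1) \<in> I" "(c2, s2) \<in> I" "c1 i = c2 j" for c1 s1 c2 s2 i j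
    using dumbbells_D(5) [OF D that] .
  have lnI: "line N c s" "1 \<le> s" if "(c, s) \<in> I" for c s
    using dumbbells_D(2) [OF D that] by (auto simp: line_def)
  \<comment> \<open>An edge on a bar of \<open>P\<close> is the image of an edge of \<open>Q\<close>, whose line therefore crosses.\<close>
  have crossing: "\<exists>c' s' p. (c', s') \<in> J \<and> (\<forall>j. \<phi> (c' j) = c (j - p)) \<and> 0 \<le> p \<and> s + p \<le> s'"
    if c: "(c, s) \<in> I" for c s
  proof -
    have "(c 1, c (1 + 1)) \<in> map_prod \<phi> \<phi> ` moves g Q" using dumbbells_D(4) [OF D c, of 1] E by simp
    then obtain a b where ab: "(a, b) \<in> moves g Q" "\<phi> a = c 1" by auto
    obtain c' s' j where c': "(c', s') \<in> J" "a = c' j" using dumbbells_edgeE [OF DQ ab(1)] by metis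
    have "\<phi> (c' i) = c (i - (j - 1))" for i
      using walk_through_bar [OF D, where x = "\<lambda>j. \<phi> (c' j)", OF walk [OF c'(1)] c, of 1 j] ab(2) c'(2) lnI(2) [OF c]
      by simp
    moreover from this have "0 \<le> j - 1" "s + (j - 1) \<le> s'"
      using crossing_bounds [OF D ln [OF c'(1)] M c] by blast+
    ultimately show ?thesis using c'(1) by blast
  qed
  obtain T where T: "\<And>c' s'. (c', s') \<in> J \<Longrightarrow> s' \<le> int T"
  proof -
    have "finite ((\<lambda>l. nat (snd l)) ` J)" using finJ by simp
    then obtain T where "\<forall>i\<in>(\<lambda>l. nat (snd l)) ` J. i \<le> T" using finite_nat_set_iff_bounded_le by metis
    then have "s' \<le> int T" if "(c', s') \<in> J" for c' s' using that by fastforce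
    then show ?thesis using that by blast
  qed
  obtain k1 where k1: "\<And>a. a \<in> P \<Longrightarrow> decides k1 a"
    using finite_clopen_decides [OF partition_finite [OF P] partition_clopen [OF P]] by metis
  obtain k2 where k2: "\<And>P' N' I' c' s' c s p. looped h P' N' I' \<Longrightarrow> resolves k2 P' \<Longrightarrow> (c', s') \<in> I' \<Longrightarrow>
    (c, s) \<in> I \<Longrightarrow> (\<And>j. c' j \<subseteq> c (j - p)) \<Longrightarrow> int T \<le> p \<and> s + p + int T \<le> s'"
    using crossing_lines_long [OF h gP, of T] by metis
  \<comment> \<open>Fine crossing lines are long enough to be mapped onto any line of \<open>Q\<close> with the same crossing.\<close>
  have cross_lift: "lifts N' (moves g Q) \<phi> (c', s') (\<lambda>j. c0 (j - (p - p0)))"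
    if g': "looped h P' N' I'" "resolves k2 P'" "M dvd N'" "(c', s') \<in> I'" and c: "(c, s) \<in> I"
      and over: "\<And>j. c' j \<subseteq> c (j - p)" and c0: "(c0, s0) \<in> J" "\<And>j. \<phi> (c0 j) = c (j - p0)"
    for P' N' I' c' s' c s p c0 s0 p0
  proof -
    have long: "int T \<le> p" "s + p + int T \<le> s'" using k2 [OF g'(1,2,4) c over] by auto
    have b: "0 \<le> p0" "s + p0 \<le> s0" using crossing_bounds [OF D ln [OF c0(1)] M c c0(2)] by auto
    have "s0 \<le> int T" using T [OF c0(1)] .
    then have "0 \<le> p - p0" "s0 + (p - p0) \<le> s'" using long b lnI(2) [OF c] by linarith+
    then have "line N' (\<lambda>j. c0 (j - (p - p0))) s'"
      using line_shift [OF dumbbells_D(2) [OF DQ c0(1)] M g'(3) dumbbells_D(1) [OF loopedD(2) [OF g'(1)]]] by blast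
    moreover have "c' j \<subseteq> \<phi> (c0 (j - (p - p0)))" for j using over [of j] c0(2) by (simp add: algebra_simps)
    moreover have "(c0 (j - (p - p0)), c0 (j + 1 - (p - p0))) \<in> moves g Q" for j
      using dumbbells_D(4) [OF DQ c0(1), of "j - (p - p0)"] by (simp add: algebra_simps)
    ultimately show ?thesis by (simp add: lifts_def)
  qed
  have cyc_lift: "\<exists>x. lifts N' (moves g Q) \<phi> (c', s') x"
    if "M dvd N'" "1 \<le> s'" and y: "\<And>i j. M dvd i - j \<Longrightarrow> y i = y j" "\<And>j. (y j, y (j + 1)) \<in> moves g Q"
      "\<And>j. \<phi> (y j) = z (j - p0)" and c': "\<And>j. c' j \<subseteq> z (j - p)" for N' c' s' y z p0 p
  proof -
    have "line N' (\<lambda>j. y (j - (p - p0))) s'" by (rule line_periodic [where M = M]) (use that in blast)+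
    moreover have "(y (j - (p - p0)), y (j + 1 - (p - p0))) \<in> moves g Q" for j
      using y(2) [of "j - (p - p0)"] by (simp add: algebra_simps)
    moreover have "c' j \<subseteq> \<phi> (y (j - (p - p0)))" for j using c' [of j] y(3) by (simp add: algebra_simps)
    ultimately show ?thesis by (intro exI [of _ "\<lambda>j. y (j - (p - p0))"]) (simp add: lifts_def)
  qed
  have lift: "if_fine h M (\<lambda>N' I'. \<forall>l\<in>I'. \<exists>x. lifts N' (moves g Q) \<phi> l x)"
  proof (rule if_fineI [where k = "max k1 k2"], intro ballI)
    fix P' N' I' l
    assume g': "looped h P' N' I'" and res: "resolves (max k1 k2) P'" and MN': "M dvd N'" and l: "l \<in> I'"
    have res: "resolves k1 P'" "resolves k2 P'" using resolves_mono [OF res] by auto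
    obtain c' s' where l': "l = (c', s')" "(c', s') \<in> I'" using l by (cases l) auto
    have s': "1 \<le> s'" using dumbbells_D(2) [OF loopedD(2) [OF g'] l'(2)] by (simp add: line_def)
    obtain x where x: "\<And>j. c' j \<subseteq> x j" "\<And>j. (x j, x (j + 1)) \<in> moves h P"
      by (rule refined_line [OF P k1 g' res(1) l'(2)]) blast+
    show "\<exists>x. lifts N' (moves g Q) \<phi> l x"
      unfolding l'(1)
    proof (rule walk_cases [OF D, of x])
      show "(x j, x (j + 1)) \<in> moves h P" for j by (rule x(2))
    next
      fix c s p assume c: "(c, s) \<in> I" "\<And>j. x j = c (j - p)"
      obtain c0 s0 p0 where "(c0, s0) \<in> J" "\<forall>j. \<phi> (c0 j) = c (j - p0)" using crossing [OF c(1)] by blast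
      then have "lifts N' (moves g Q) \<phi> (c', s') (\<lambda>j. c0 (j - (p - p0)))"
        using cross_lift [OF g' res(2) MN' l'(2) c(1)] x(1) c(2) by simp
      then show "\<exists>x. lifts N' (moves g Q) \<phi> (c', s') x" by blast
    next
      fix c s p assume c: "(c, s) \<in> I" "\<And>j. x j = lcyc N c (j - p)"
      obtain c0 s0 p0 where c0: "(c0, s0) \<in> J" "\<And>j. \<phi> (c0 j) = c (j - p0)" "0 \<le> p0" using crossing [OF c(1)] by blast
      show "\<exists>x. lifts N' (moves g Q) \<phi> (c', s') x"
      proof (rule cyc_lift [OF MN' s' lcyc_periodic])
        fix j
        obtain i where i: "i < 0" "M dvd i - j" "lcyc M c0 j = c0 i" "(lcyc M c0 j, lcyc M c0 (j + 1)) \<in> moves g Q"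
          using lcyc_walk [OF DQ c0(1), of j] by metis
        show "(lcyc M c0 j, lcyc M c0 (j + 1)) \<in> moves g Q" by (rule i(4))
        have "N dvd (i - p0) - (j - p0)" using dvd_trans [OF NM i(2)] by simp
        then have "lcyc N c (j - p0) = c (i - p0)" using i(1) c0(3) by (intro lcyc_eqI [OF lnI(1) [OF c(1)] N]) auto
        then show "\<phi> (lcyc M c0 j) = lcyc N c (j - p0)" using i(3) c0(2) by simp
        show "c' j \<subseteq> lcyc N c (j - p)" using x(1) [of j] c(2) by simp
      qed
    next
      fix c s p assume c: "(c, s) \<in> I" "\<And>j. x j = rcyc N s c (j - p)"
      obtain c0 s0 p0 where c0: "(c0, s0) \<in> J" "\<And>j. \<phi> (c0 j) = c (j - p0)" "s + p0 \<le> s0" using crossing [OF c(1)] by blast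
      show "\<exists>x. lifts N' (moves g Q) \<phi> (c', s') x"
      proof (rule cyc_lift [OF MN' s' rcyc_periodic])
        fix j
        obtain i where i: "s0 < i" "M dvd i - j" "rcyc M s0 c0 j = c0 i"
          "(rcyc M s0 c0 j, rcyc M s0 c0 (j + 1)) \<in> moves g Q"
          using rcyc_walk [OF DQ c0(1), of j] by metis
        show "(rcyc M s0 c0 j, rcyc M s0 c0 (j + 1)) \<in> moves g Q" by (rule i(4))
        have "N dvd (i - p0) - (j - p0)" using dvd_trans [OF NM i(2)] by simp
        then have "rcyc N s c (j - p0) = c (i - p0)" using i(1) c0(3) by (intro rcyc_eqI [OF lnI(1) [OF c(1)] N]) auto
        then show "\<phi> (rcyc M s0 c0 j) = rcyc N s c (j - p0)" using i(3) c0(2) by simp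
        show "c' j \<subseteq> rcyc N s c (j - p)" using x(1) [of j] c(2) by simp
      qed
    qed
  qed
  have cyc_onto: "if_fine h M (\<lambda>N' I'. card J \<le> card {l \<in> I'. \<exists>\<tau>. lifts N' (moves g Q) \<phi> l (\<lambda>j. c0 (j - \<tau>))})"
    if c0: "(c0, s0) \<in> J" and c: "(c, s) \<in> I" and z: "\<And>i j. N dvd i - j \<Longrightarrow> z i = z j" "\<And>j. \<phi> (c0 j) = z (j - p0)"
      and A: "A \<noteq> {}" "clopen A" "h ` A = A" "A \<subseteq> (\<Union>j\<in>S. c j)"
      and S: "\<And>x. (\<And>j. (x j, x (j + 1)) \<in> moves h P) \<Longrightarrow> (\<And>j. \<exists>i\<in>S. x j = c i) \<Longrightarrow> \<exists>p. \<forall>j. x j = z (j - p)"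
    for c0 s0 c s z p0 A S
  proof (rule cyclic_many_lifts [OF h st A(2,1,3), where z = z and ?N0.0 = N and ?p0.0 = p0])
    show "if_fine h M (\<lambda>N' I'. \<forall>(c', s')\<in>I'. (\<forall>j. c' j \<subseteq> A) \<longrightarrow> (\<exists>p. \<forall>j. c' j \<subseteq> z (j - p)))"
    proof (rule if_fineI [where k = k1], intro ballI, clarify)
      fix P' N' I' c' s'
      assume g': "looped h P' N' I'" and res: "resolves k1 P'" and l: "(c', s') \<in> I'" and cA: "\<forall>j. c' j \<subseteq> A"
      obtain x where x: "\<And>j. c' j \<subseteq> x j" "\<And>j. (x j, x (j + 1)) \<in> moves h P"
        by (rule refined_line [OF P k1 g' res l]) blast+
      have "\<exists>i\<in>S. x j = c i" for j
      proof -
        obtain y where y: "y \<in> c' j"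
          using partition_nonempty [OF loopedD(1) [OF g'] dumbbells_D(3) [OF loopedD(2) [OF g'] l]] by blast
        then obtain i where i: "i \<in> S" "y \<in> c i" using cA A(4) by blast
        have "x j \<in> P" using x(2) [of j] by (auto simp: moves_def)
        then have "x j = c i" using partition_cell_eq [OF P _ dumbbells_D(3) [OF D c]] x(1) y i(2) by blast
        then show ?thesis using i(1) by blast
      qed
      then show "\<exists>p. \<forall>j. c' j \<subseteq> z (j - p)" using S [of x] x by metis
    qed
  qed (use z N M dumbbells_D(2,4) [OF DQ c0] in blast)+
  have onto: "if_fine h M (\<lambda>N' I'. card J \<le> card {l \<in> I'. \<exists>\<tau>. lifts N' (moves g Q) \<phi> l (\<lambda>j. c0 (j - \<tau>))})"
    if c0: "(c0, s0) \<in> J" for c0 s0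
  proof (rule walk_cases [OF D, of "\<lambda>j. \<phi> (c0 j)"])
    show "(\<phi> (c0 j), \<phi> (c0 (j + 1))) \<in> moves h P" for j by (rule walk [OF c0])
  next
    fix c s p0 assume c: "(c, s) \<in> I" "\<And>j. \<phi> (c0 j) = c (j - p0)"
    obtain k3 where k3: "\<And>P' N' I'. looped h P' N' I' \<Longrightarrow> resolves k3 P' \<Longrightarrow>
        card J \<le> card {(c', s'). (c', s') \<in> I' \<and> (\<exists>p. \<forall>j. c' j \<subseteq> c (j - p))}"
      by (rule many_crossing_lines [OF gP c(1), where n = "card J"]) (rule that, blast)
    show ?thesis
    proof (rule if_fineI [where k = "max k2 k3"])
      fix P' N' I' assume g': "looped h P' N' I'" and res: "resolves (max k2 k3) P'" and MN': "M dvd N'"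
      have res: "resolves k2 P'" "resolves k3 P'" using resolves_mono [OF res] by auto
      have "{(c', s'). (c', s') \<in> I' \<and> (\<exists>p. \<forall>j. c' j \<subseteq> c (j - p))} \<subseteq>
          {l \<in> I'. \<exists>\<tau>. lifts N' (moves g Q) \<phi> l (\<lambda>j. c0 (j - \<tau>))}"
      proof
        fix l assume "l \<in> {(c', s'). (c', s') \<in> I' \<and> (\<exists>p. \<forall>j. c' j \<subseteq> c (j - p))}"
        then obtain c' s' p where l: "l = (c', s')" "(c', s') \<in> I'" "\<And>j. c' j \<subseteq> c (j - p)" by auto
        then have "lifts N' (moves g Q) \<phi> (c', s') (\<lambda>j. c0 (j - (p - p0)))"
          using cross_lift [OF g' res(1) MN' l(2) c(1) _ c0 c(2)] by blast
        then show "l \<in> {l \<in> I'. \<exists>\<tau>. lifts N' (moves g Q) \<phi> l (\<lambda>j. c0 (j - \<tau>))}" using l(1,2) by blast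
      qed
      moreover have "finite {l \<in> I'. \<exists>\<tau>. lifts N' (moves g Q) \<phi> l (\<lambda>j. c0 (j - \<tau>))}"
        using dumbbells_finite [OF loopedD(2) [OF g'] partition_finite [OF loopedD(1) [OF g']]] by simp
      ultimately show "card J \<le> card {l \<in> I'. \<exists>\<tau>. lifts N' (moves g Q) \<phi> l (\<lambda>j. c0 (j - \<tau>))}"
        using order_trans [OF k3 [OF g' res(2)] card_mono] by blast
    qed
  next
    fix c s p0 assume c: "(c, s) \<in> I" "\<And>j. \<phi> (c0 j) = lcyc N c (j - p0)"
    obtain A where A: "A \<noteq> {}" "clopen A" "h ` A = A" "A \<subseteq> (\<Union>j\<in>{..0}. c j)"
      using loopedD(3) [OF gP c(1)] by (auto simp: left_loop_def)
    show ?thesis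
    proof (rule cyc_onto [where z = "lcyc N c", OF c0 c(1) lcyc_periodic c(2) A])
      fix x assume x: "\<And>j. (x j, x (j + 1)) \<in> moves h P" and xS: "\<And>j::int. \<exists>i\<in>{..0}. x j = c i"
      have "\<exists>i\<le>0. x j = c i" for j using xS [of j] by auto
      then show "\<exists>p. \<forall>j. x j = lcyc N c (j - p)" by (rule left_walk [OF D, where x = x, OF x c(1)])
    qed
  next
    fix c s p0 assume c: "(c, s) \<in> I" "\<And>j. \<phi> (c0 j) = rcyc N s c (j - p0)"
    obtain A where A: "A \<noteq> {}" "clopen A" "h ` A = A" "A \<subseteq> (\<Union>j\<in>{s<..}. c j)"
      using loopedD(4) [OF gP c(1)] by (auto simp: right_loop_def)
    show ?thesis
    proof (rule cyc_onto [where z = "rcyc N s c", OF c0 c(1) rcyc_periodic c(2) A])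
      fix x assume x: "\<And>j. (x j, x (j + 1)) \<in> moves h P" and xS: "\<And>j::int. \<exists>i\<in>{s<..}. x j = c i"
      have "\<exists>i>s. x j = c i" for j using xS [of j] by auto
      then show "\<exists>p. \<forall>j. x j = rcyc N s c (j - p)" by (rule right_walk [OF D, where x = x, OF x c(1)])
    qed
  qed
  obtain P' q'' I' \<psi> where "looped h P' (fact q'') I'" "q' \<le> q''" "resolves m P'"
    "moves g Q = map_prod \<psi> \<psi> ` moves h P'" "\<And>a. a \<in> P' \<Longrightarrow> a \<subseteq> \<phi> (\<psi> a)"
    by (rule looped_at_lift [OF st loopedD(2) [OF gQ] partition_finite [OF Q] lift [unfolded M_def] onto [unfolded M_def], where m = m]) blast+
  then show ?thesis using that gQ by (auto simp: link_def)
qed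

type_synonym linked = "cantor set set \<times> nat \<times> ((int \<Rightarrow> cantor set) \<times> int) set \<times>
  cantor set set \<times> nat \<times> ((int \<Rightarrow> cantor set) \<times> int) set \<times> (cantor set \<Rightarrow> cantor set)"

section \<open>Back and forth\<close>

lemma link_sequence:
  assumes H: "\<And>i. f i \<in> homeos" and st: "\<And>i m. 1 \<le> m \<Longrightarrow> looped_at m (f i)"
    and f2: "\<And>i. f (i + 2) = f i"
  obtains R q I \<theta> where "\<And>n. link (f n) (R n) (q n) (I n) (f (Suc n)) (R (Suc n)) (q (Suc n)) (I (Suc n)) (\<theta> n)"
    "\<And>n. resolves n (R (Suc (Suc n)))"
    "\<And>n a. a \<in> R (Suc (Suc n)) \<Longrightarrow> a \<subseteq> \<theta> n (\<theta> (Suc n) a)"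
proof -
  define ok where "ok n x \<longleftrightarrow> (case x of (P, q, I, Q, q', J, \<phi>) \<Rightarrow> link (f n) P q I (f (Suc n)) Q q' J \<phi>)"
    for n and x :: linked
  define nxt where "nxt n x y \<longleftrightarrow> (case x of (P, q, I, Q, q', J, \<phi>) \<Rightarrow> case y of (P', q1, I', Q', q2, J', \<psi>) \<Rightarrow>
      P' = Q \<and> q1 = q' \<and> I' = J \<and> resolves n Q' \<and> (\<forall>a\<in>Q'. a \<subseteq> \<phi> (\<psi> a)))" for n and x y :: linked
  have "\<exists>x. ok 0 x"
  proof -
    obtain P q I where g: "looped (f 0) P (fact q) I" using st [of 1 0] by (auto simp: looped_at_def)
    obtain Q q' J \<phi> where "link (f 0) P q I (f (Suc 0)) Q q' J \<phi>"
      by (rule link_start [OF H st g]) blast+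
    then have "ok 0 (P, q, I, Q, q', J, \<phi>)" by (simp add: ok_def)
    then show ?thesis by blast
  qed
  moreover have "\<exists>y. ok (Suc n) y \<and> nxt n x y" if x: "ok n x" for n x
  proof -
    obtain P q I Q q' J \<phi> where x': "x = (P, q, I, Q, q', J, \<phi>)" by (cases x) auto
    then have L: "link (f n) P q I (f (Suc n)) Q q' J \<phi>" using x by (simp add: ok_def)
    obtain P' q'' I' \<psi> where "link (f (Suc n)) Q q' J (f n) P' q'' I' \<psi>" "resolves n P'"
      "\<And>a. a \<in> P' \<Longrightarrow> a \<subseteq> \<phi> (\<psi> a)"
      by (rule link_extend [OF H st L, where m = n]) blast+
    then have "ok (Suc n) (Q, q', J, P', q'', I', \<psi>)" "nxt n x (Q, q', J, P', q'', I', \<psi>)"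
      using f2 [of n] by (auto simp: ok_def nxt_def x')
    then show ?thesis by blast
  qed
  ultimately obtain x where x: "\<And>n. ok n (x n) \<and> nxt n (x n) (x (Suc n))"
    using dependent_nat_choice [of ok nxt] by blast
  define R where "R = (\<lambda>n. fst (x n))"
  define q where "q = (\<lambda>n. fst (snd (x n)))"
  define I where "I = (\<lambda>n. fst (snd (snd (x n))))"
  define \<theta> where "\<theta> = (\<lambda>n. snd (snd (snd (snd (snd (snd (x n)))))))"
  have L: "link (f n) (R n) (q n) (I n) (f (Suc n)) (R (Suc n)) (q (Suc n)) (I (Suc n)) (\<theta> n)" for n
    using x [of n] by (auto simp: ok_def nxt_def R_def q_def I_def \<theta>_def split: prod.splits)
  have C: "resolves n (R (Suc (Suc n))) \<and> (\<forall>a\<in>R (Suc (Suc n)). a \<subseteq> \<theta> n (\<theta> (Suc n) a))" for n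
    using x [of n] x [of "Suc n"] by (auto simp: nxt_def R_def \<theta>_def split: prod.splits)
  show ?thesis by (rule that [of R q I \<theta>]) (use L C in blast)+
qed

text \<open>
  The image of \<open>x\<close> is the common point of the shrinking cells that \<open>\<theta>\<close> assigns to the cells of \<open>x\<close>.  It intertwines
  \<open>f\<close> and \<open>g\<close> because \<open>\<theta>\<close> preserves edges: the cells assigned to \<open>x\<close> and to \<open>f x\<close> are joined by a point that \<open>g\<close>
  moves from the one to the other.
\<close>

lemma limit_map:
  assumes R: "\<And>i. clopen_partition (R i)" and S: "\<And>i. clopen_partition (S i)"
    and \<theta>: "\<And>i a b. (a, b) \<in> moves f (R i) \<Longrightarrow> (\<theta> i a, \<theta> i b) \<in> moves g (S i)"
    and nested: "\<And>i a b x. a \<in> R (Suc i) \<Longrightarrow> b \<in> R i \<Longrightarrow> x \<in> a \<Longrightarrow> x \<in> b \<Longrightarrow> \<theta> (Suc i) a \<subseteq> \<theta> i b"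
    and res: "\<And>i. resolves i (S i)"
    and f: "f \<in> homeos" and g: "g \<in> homeos"
  obtains K where "continuous_on UNIV K" "\<And>i a x. a \<in> R i \<Longrightarrow> x \<in> a \<Longrightarrow> K x \<in> \<theta> i a" "\<And>x. K (f x) = g (K x)"
proof -
  have \<theta>S: "\<theta> i a \<in> S i" if a: "a \<in> R i" for i a
  proof -
    obtain b where "(a, b) \<in> moves f (R i)" using moves_total(1) [OF R f a] by blast
    from \<theta> [OF this] show ?thesis by (simp add: moves_def)
  qed
  have "\<exists>a. a \<in> R i \<and> x \<in> a" for x i using partition_cell [OF R] by metis
  note ex = this
  define cell where "cell x i = (SOME a. a \<in> R i \<and> x \<in> a)" for x i
  have cell: "cell x i \<in> R i" "x \<in> cell x i" for x i
    using someI_ex [OF ex, of i x] by (simp_all add: cell_def)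
  have cell_eq: "a = cell x i" if "a \<in> R i" "x \<in> a" for a x i
    using partition_cell_eq [OF R that(1) cell(1) that(2) cell(2)] .
  have "\<exists>y. \<forall>i. y \<in> \<theta> i (cell x i)" for x
  proof -
    have "(\<Inter>i. \<theta> i (cell x i)) \<noteq> {}"
    proof (rule compact_space_imp_nest)
      show "compact_space (euclidean :: cantor topology)" using compact_cantor by (simp add: compact_space_def)
      show "closedin euclidean (\<theta> i (cell x i))" for i
        using partition_clopen [OF S \<theta>S [OF cell(1)]] by (simp add: clopen_def)
      show "\<theta> i (cell x i) \<noteq> {}" for i using partition_nonempty [OF S \<theta>S [OF cell(1)]] .
      show "decseq (\<lambda>i. \<theta> i (cell x i))" using nested cell by (intro decseq_SucI) blast
    qed
    then show ?thesis by blast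
  qed
  then obtain K where K: "\<And>x i. K x \<in> \<theta> i (cell x i)" by metis
  have K': "K x \<in> \<theta> i a" if "a \<in> R i" "x \<in> a" for i a x using K cell_eq [OF that] by simp
  have close: "agree i y z" if "a \<in> R i" "y \<in> \<theta> i a" "z \<in> \<theta> i a" for i a y z
    using res [of i] \<theta>S [OF that(1)] that(2,3) unfolding resolves_def by blast
  have "\<exists>l. \<forall>x y. agree l x y \<longrightarrow> agree k (K x) (K y)" for k
  proof -
    obtain l where l: "\<And>a. a \<in> R k \<Longrightarrow> decides l a"
      using finite_clopen_decides [OF partition_finite [OF R [of k]]] partition_clopen [OF R] by metis
    have "agree k (K x) (K y)" if "agree l x y" for x y
    proof -
      have "y \<in> cell x k" using l [OF cell(1)] cell(2) that unfolding decides_def by blast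
      then have "K y \<in> \<theta> k (cell x k)" using K' [OF cell(1)] by blast
      then show ?thesis using close [OF cell(1) K] by blast
    qed
    then show ?thesis by blast
  qed
  then have "continuous_on UNIV K" unfolding continuous_on_iff_agree by blast
  moreover have "K (f x) = g (K x)" for x
  proof (rule agree_all_imp_eq)
    fix k
    obtain l where l: "\<And>y z. agree l y z \<Longrightarrow> agree k (g y) (g z)"
      using homeos_continuous [OF g] unfolding continuous_on_iff_agree by blast
    define i where "i = max k l"
    have "(cell x i, cell (f x) i) \<in> moves f (R i)" using cell by (blast intro: movesI)
    then obtain y where y: "y \<in> \<theta> i (cell x i)" "g y \<in> \<theta> i (cell (f x) i)" using \<theta> movesE by metis
    have "agree l y (K x)" using agree_mono [OF close [OF cell(1) y(1) K]] by (simp add: i_def)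
    moreover have "agree k (K (f x)) (g y)" using agree_mono [OF close [OF cell(1) K y(2)]] by (simp add: i_def)
    ultimately show "agree k (K (f x)) (g (K x))" using l agree_trans by blast
  qed
  ultimately show ?thesis using that K' by blast
qed

text \<open>
  The even members of the sequence of partitions belong to \<open>h\<close> and the odd ones to \<open>g\<close>.  The limits over odd and
  even indices are inverse to each other by \<open>a \<subseteq> \<theta> n (\<theta> (Suc n) a)\<close>.
\<close>

lemma conjugate_if_looped:
  assumes h: "h \<in> homeos" "\<And>m. 1 \<le> m \<Longrightarrow> looped_at m h" and g: "g \<in> homeos" "\<And>m. 1 \<le> m \<Longrightarrow> looped_at m g"
  obtains k where "k \<in> homeos" "g = k \<circ> h \<circ> inverse_map k"
proof -
  define f where "f = (\<lambda>i::nat. if even i then h else g)"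
  have fH: "f i \<in> homeos" and fst: "1 \<le> m \<Longrightarrow> looped_at m (f i)" and f2: "f (i + 2) = f i" for i m
    using h g by (auto simp: f_def)
  obtain R q I \<theta> where L: "\<And>n. link (f n) (R n) (q n) (I n) (f (Suc n)) (R (Suc n)) (q (Suc n)) (I (Suc n)) (\<theta> n)"
    and res: "\<And>n. resolves n (R (Suc (Suc n)))"
    and covers: "\<And>n a. a \<in> R (Suc (Suc n)) \<Longrightarrow> a \<subseteq> \<theta> n (\<theta> (Suc n) a)"
    by (rule link_sequence [of f, OF fH fst f2]) blast+
  have R: "clopen_partition (R n)" for n using L [of n] loopedD(1) unfolding link_def by blast
  have \<theta>: "(\<theta> n a, \<theta> n b) \<in> moves (f n) (R n)" if "(a, b) \<in> moves (f (Suc n)) (R (Suc n))" for n a b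
    using L [of n] that unfolding link_def by (metis image_eqI map_prod_simp)
  have \<theta>R: "\<theta> n a \<in> R n" if a: "a \<in> R (Suc n)" for n a
  proof -
    obtain b where "(a, b) \<in> moves (f (Suc n)) (R (Suc n))" using moves_total(1) [OF R fH a] by blast
    from \<theta> [OF this] show ?thesis by (simp add: moves_def)
  qed
  have covers_eq: "\<theta> n (\<theta> (Suc n) a) = b"
    if "a \<in> R (Suc (Suc n))" "b \<in> R n" "x \<in> a" "x \<in> b" for n a b x
    using partition_cell_eq [OF R \<theta>R [OF \<theta>R [OF that(1)]] that(2)] covers [OF that(1)] that(3,4) by blast
  have nested: "\<theta> (Suc (Suc n)) a \<subseteq> \<theta> n b"
    if "a \<in> R (Suc (Suc (Suc n)))" "b \<in> R (Suc n)" "x \<in> a" "x \<in> b" for n a b x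
    using covers [OF \<theta>R [OF that(1)]] covers_eq [OF that] by simp
  \<comment> \<open>\<open>R n\<close> resolves only \<open>n - 2\<close> coordinates, whence the offset of 2 in the indices below.\<close>
  have resolves: "resolves i (R (2 * i + 2 + n))" for i n
    using resolves_mono [OF res [of "2 * i + n"]] by simp
  have maps: "\<exists>K. continuous_on UNIV K \<and>
      (\<forall>i a x. a \<in> R (2 * i + 3 + n) \<longrightarrow> x \<in> a \<longrightarrow> K x \<in> \<theta> (2 * i + 2 + n) a) \<and>
      (\<forall>x. K (f (Suc n) x) = f n (K x))" for n
  proof -
    have per: "f (2 * i + 2 + n) = f n" "f (2 * i + 3 + n) = f (Suc n)" for i by (auto simp: f_def)
    obtain K where "continuous_on UNIV K" "\<And>i a x. a \<in> R (2 * i + 3 + n) \<Longrightarrow> x \<in> a \<Longrightarrow> K x \<in> \<theta> (2 * i + 2 + n) a"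
      "\<And>x. K (f (Suc n) x) = f n (K x)"
    proof (rule limit_map [where R = "\<lambda>i. R (2 * i + 3 + n)" and S = "\<lambda>i. R (2 * i + 2 + n)" and
          \<theta> = "\<lambda>i. \<theta> (2 * i + 2 + n)" and f = "f (Suc n)" and g = "f n"])
      show "(\<theta> (2 * i + 2 + n) a, \<theta> (2 * i + 2 + n) b) \<in> moves (f n) (R (2 * i + 2 + n))"
        if "(a, b) \<in> moves (f (Suc n)) (R (2 * i + 3 + n))" for i a b
        using \<theta> [of a b "2 * i + 2 + n"] that per [of i] by (simp add: numeral_3_eq_3)
      show "\<theta> (2 * Suc i + 2 + n) a \<subseteq> \<theta> (2 * i + 2 + n) b"
        if "a \<in> R (2 * Suc i + 3 + n)" "b \<in> R (2 * i + 3 + n)" "x \<in> a" "x \<in> b" for i a b x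
        using nested [of a "2 * i + 2 + n" b x] that by (simp add: numeral_3_eq_3)
    qed (use R fH resolves in blast)+
    then show ?thesis by blast
  qed
  obtain K0 where K0: "continuous_on UNIV K0"
    "\<And>i a x. a \<in> R (2 * i + 3) \<Longrightarrow> x \<in> a \<Longrightarrow> K0 x \<in> \<theta> (2 * i + 2) a" using maps [of 0] by auto
  obtain K1 where K1c: "continuous_on UNIV K1"
    and K1a: "\<forall>i a x. a \<in> R (2 * i + 3 + 1) \<longrightarrow> x \<in> a \<longrightarrow> K1 x \<in> \<theta> (2 * i + 2 + 1) a"
    and K1e: "\<forall>x. K1 (f (Suc 1) x) = f 1 (K1 x)"
    using maps [of 1] by blast
  have K1: "continuous_on UNIV K1"
    "\<And>i a x. a \<in> R (2 * i + 4) \<Longrightarrow> x \<in> a \<Longrightarrow> K1 x \<in> \<theta> (2 * i + 3) a" "\<And>x. K1 (h x) = g (K1 x)"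
  proof -
    have eq: "2 * i + 3 + 1 = 2 * i + (4 :: nat)" "2 * i + 2 + 1 = 2 * i + (3 :: nat)" for i by simp_all
    show "continuous_on UNIV K1" by (rule K1c)
    show "\<And>i a x. a \<in> R (2 * i + 4) \<Longrightarrow> x \<in> a \<Longrightarrow> K1 x \<in> \<theta> (2 * i + 3) a" using K1a unfolding eq by blast
    show "\<And>x. K1 (h x) = g (K1 x)" using K1e by (simp add: f_def)
  qed
  have inv01: "K0 (K1 x) = x" for x
  proof (rule agree_all_imp_eq)
    fix k
    obtain a where a: "a \<in> R (2 * k + 4)" "x \<in> a" using partition_cell [OF R] by blast
    have "\<theta> (2 * k + 3) a \<in> R (2 * k + 3)" using \<theta>R [of a "2 * k + 3"] a(1) by (simp add: eval_nat_numeral)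
    then have "K0 (K1 x) \<in> \<theta> (2 * k + 2) (\<theta> (2 * k + 3) a)" using K0(2) K1(2) [OF a] by blast
    moreover have "x \<in> \<theta> (2 * k + 2) (\<theta> (2 * k + 3) a)"
      using covers [of a "2 * k + 2"] a by (auto simp: eval_nat_numeral)
    moreover have "\<theta> (2 * k + 2) (\<theta> (2 * k + 3) a) \<in> R (2 * k + 2)"
      using \<theta>R [of "\<theta> (2 * k + 3) a" "2 * k + 2"] \<open>\<theta> (2 * k + 3) a \<in> R (2 * k + 3)\<close> by (simp add: eval_nat_numeral)
    ultimately show "agree k (K0 (K1 x)) x" using resolves [of k 0] unfolding resolves_def by simp
  qed
  have inv10: "K1 (K0 y) = y" for y
  proof (rule agree_all_imp_eq)
    fix k
    obtain a where a: "a \<in> R (2 * k + 5)" "y \<in> a" using partition_cell [OF R] by blast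
    have b: "\<theta> (2 * k + 4) a \<in> R (2 * k + 4)" using \<theta>R [of a "2 * k + 4"] a(1) by (simp add: eval_nat_numeral)
    have "K0 y \<in> \<theta> (2 * k + 4) a" using K0(2) [of a "Suc k" y] a by (simp add: eval_nat_numeral)
    then have "K1 (K0 y) \<in> \<theta> (2 * k + 3) (\<theta> (2 * k + 4) a)" using K1(2) b by blast
    moreover have "y \<in> \<theta> (2 * k + 3) (\<theta> (2 * k + 4) a)"
      using covers [of a "2 * k + 3"] a by (auto simp: eval_nat_numeral)
    moreover have "\<theta> (2 * k + 3) (\<theta> (2 * k + 4) a) \<in> R (2 * k + 3)"
      using \<theta>R [of "\<theta> (2 * k + 4) a" "2 * k + 3"] b by (simp add: eval_nat_numeral)
    moreover have "resolves k (R (2 * k + 3))" using resolves [of k 1] by (simp add: eval_nat_numeral)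
    ultimately show "agree k (K1 (K0 y)) y" unfolding resolves_def by blast
  qed
  have kH: "K1 \<in> homeos" by (rule homeosI [OF K1(1) K0(1) inv01 inv10])
  have "inverse_map K1 = K0" by (rule inv_equality) (rule inv01 inv10)+
  moreover have "g = K1 \<circ> h \<circ> K0" using K1(3) inv10 by (intro ext) simp
  ultimately have "g = K1 \<circ> h \<circ> inverse_map K1" by metis
  then show ?thesis using kH that by blast
qed

section \<open>The conjugacy class\<close>

lemma homeo_group_simps [simp]:
  "carrier homeo_group = homeos" "f \<otimes>\<^bsub>homeo_group\<^esub> g = f \<circ> g" "\<one>\<^bsub>homeo_group\<^esub> = id"
  by (simp_all add: homeo_group_def)

lemma homeo_group_inv: assumes "h \<in> homeos" shows "inv\<^bsub>homeo_group\<^esub> h = inverse_map h"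
proof -
  interpret group homeo_group by (rule homeo_group)
  show ?thesis
    using homeos_inv_simps [OF assms] homeos_inv [OF assms] assms
    by (intro inv_equality) (auto simp: fun_eq_iff)
qed

theorem theorem4p1:
  fixes S :: "(cantor \<Rightarrow> cantor) set"
  assumes S_def: "S = {h \<in> carrier homeo_group. \<forall>m::nat. 1 \<le> m \<longrightarrow>
      (\<exists>(P :: cantor set set) (q::nat).
         clopen_partition P \<and> mesh P < 1 / real m \<and> 1 \<le> q \<and> m dvd q \<and>
         (\<forall>D. component D (Gr h P) \<longrightarrow>
            balanced_dumbbell (fact q) D \<and> contains_left_loop h D \<and> contains_right_loop h D))}"
  shows "comeager_in homeo_topology S \<and> conjugacy_class homeo_group S"
proof -
  have "(\<exists>P q. clopen_partition P \<and> mesh P < 1 / real m \<and> 1 \<le> q \<and> m dvd q \<and>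
         (\<forall>D. component D (Gr h P) \<longrightarrow>
            balanced_dumbbell (fact q) D \<and> contains_left_loop h D \<and> contains_right_loop h D)) \<longleftrightarrow> looped_at m h"
    if h: "h \<in> homeos" and m: "1 \<le> m" for h m
  proof -
    have "(clopen_partition P \<and> mesh P < 1 / real m \<and> 1 \<le> q \<and> m dvd q \<and>
         (\<forall>D. component D (Gr h P) \<longrightarrow>
            balanced_dumbbell (fact q) D \<and> contains_left_loop h D \<and> contains_right_loop h D)) \<longleftrightarrow>
      (\<exists>I. resolves m P \<and> 1 \<le> q \<and> m dvd q \<and> looped h P (fact q) I)" for P q
    proof (cases "clopen_partition P")
      case True
      have "1 \<le> (fact q :: nat)" by (simp add: fact_ge_1)
      from looped_iff_components [OF h True this] show ?thesis
        using mesh_less_iff_resolves [OF True m] True by simp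
    qed (auto simp: looped_def)
    then show ?thesis unfolding looped_at_def by blast
  qed
  then have S: "S = {h \<in> homeos. \<forall>m\<ge>1. looped_at m h}" unfolding S_def by auto
  have Inter: "S = (\<Inter>m. looped_homeos m)"
  proof (intro equalityI subsetI)
    fix h assume h: "h \<in> (\<Inter>m. looped_homeos m)"
    have "looped_at m h" if m: "1 \<le> m" for m
    proof -
      obtain m' where "m = Suc m'" using m by (cases m) auto
      then show ?thesis using h by (simp add: looped_homeos_def)
    qed
    then show "h \<in> S" using h by (auto simp: S looped_homeos_def)
  qed (auto simp: S looped_homeos_def)
  have "comeager_in homeo_topology S"
    unfolding Inter by (rule comeager_if_open_dense) (rule looped_homeos_open looped_homeos_dense)+
  moreover have "conjugacy_class homeo_group S"
  proof -
    have "S \<noteq> {}"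
      unfolding Inter by (rule open_dense_Inter_nonempty) (rule looped_homeos_open looped_homeos_dense)+
    then obtain h where h: "h \<in> homeos" "\<And>m. 1 \<le> m \<Longrightarrow> looped_at m h" by (auto simp: S)
    have "S = {k \<circ> h \<circ> inverse_map k | k. k \<in> homeos}"
    proof (intro equalityI subsetI)
      fix g assume "g \<in> S"
      then have "g \<in> homeos" "\<And>m. 1 \<le> m \<Longrightarrow> looped_at m g" by (auto simp: S)
      then show "g \<in> {k \<circ> h \<circ> inverse_map k | k. k \<in> homeos}"
        using conjugate_if_looped [OF h] by blast
    next
      fix g assume "g \<in> {k \<circ> h \<circ> inverse_map k | k. k \<in> homeos}"
      then obtain k where k: "k \<in> homeos" "g = k \<circ> h \<circ> inverse_map k" by blast
      have "g \<in> homeos" unfolding k(2) by (intro homeos_comp homeos_inv k(1) h(1))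
      then show "g \<in> S" using looped_at_conjugate [OF k(1) h(2)] k(2) by (simp add: S)
    qed
    also have "\<dots> = {k \<otimes>\<^bsub>homeo_group\<^esub> h \<otimes>\<^bsub>homeo_group\<^esub> inv\<^bsub>homeo_group\<^esub> k | k. k \<in> carrier homeo_group}"
      by (intro Collect_cong ex_cong1) (auto simp: homeo_group_inv)
    finally show ?thesis unfolding conjugacy_class_def using h(1) by (intro bexI [of _ h]) simp_all
  qed
  ultimately show ?thesis ..
qed

end
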